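(* Let $k$ be a field of characteristic $0$. The cactus rank and the Waring rank of any symmetric cubic form $F$ in $n\ge 3$ variables $X_1,\dots,X_n$ over $k$ are equal unless $F=a_0p_1^3+a_1np_1p_2$ with $a_1\neq 0$ and $n\ge 4$. In this case we have $cr(F)=n+1<2(n-1)=wr(F)$.
   Context: $p_i=\sum_{j=1}^nX_j^i$, and $a_0,a_1\in k$. $S=k[x_1,\dots,x_n]$ acts on $k[X_1,\dots,X_n]$ with $x_i$ acting as $\partial/\partial X_i$, and $\operatorname{ann}(F)\subseteq S$ is the annihilator of $F$. The Waring rank $wr(F)$ of a form $F$ of degree $m$ is the smallest $r$ such that $F$ can be written as $L_1^m+\cdots+L_r^m$ for linear forms $L_i$. The cactus rank $cr(F)$ is the smallest degree of a zero-dimensional subscheme of $\mathbb P^{n-1}=\operatorname{Proj}S$ whose saturated ideal is contained in $\operatorname{ann}(F)$.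
   Formalization: The Waring rank is taken with linear forms over the algebraic closure of k, while the cactus rank stays over k; with linear forms over k the claim fails, e.g. for 2p_1^3 over the rationals. *)

theory Defs
  imports "HOL-Library.Poly_Mapping" "HOL-Library.Cardinality" "HOL-Algebra.Algebraic_Closure_Type"
begin

section \<open>Polynomials\<close>

text \<open>
  A finite type \<open>'n\<close> indexes the variables, so \<open>n = CARD('n)\<close>.  The type \<open>('n, 'a) mpoly\<close>, with the
  convolution product of \<^theory>\<open>HOL-Library.Poly_Mapping\<close>, is used both for
  \<open>k[X\<^sub>1,\<dots>,X\<^sub>n]\<close> and for \<open>S = k[x\<^sub>1,\<dots>,x\<^sub>n]\<close>.
\<close>

type_synonym 'n monomial = "'n \<Rightarrow>\<^sub>0 nat"
type_synonym ('n, 'a) mpoly = "'n monomial \<Rightarrow>\<^sub>0 'a"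

definition Const :: "'a::zero \<Rightarrow> ('n, 'a) mpoly" where
  "Const c = Poly_Mapping.single 0 c"

definition Var :: "'n \<Rightarrow> ('n, 'a::zero_neq_one) mpoly" where
  "Var i = Poly_Mapping.single (Poly_Mapping.single i 1) 1"

definition total_degree :: "'n::finite monomial \<Rightarrow> nat" where
  "total_degree m = (\<Sum>i\<in>UNIV. Poly_Mapping.lookup m i)"

text \<open>The zero polynomial is a form of every degree.\<close>

definition form :: "nat \<Rightarrow> ('n::finite, 'a::zero) mpoly \<Rightarrow> bool" where
  "form d F \<longleftrightarrow> (\<forall>m\<in>Poly_Mapping.keys F. total_degree m = d)"

definition homogeneous_component ::
    "nat \<Rightarrow> ('n::finite, 'a::comm_monoid_add) mpoly \<Rightarrow> ('n, 'a) mpoly" where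
  "homogeneous_component d F =
     (\<Sum>m\<in>{m\<in>Poly_Mapping.keys F. total_degree m = d}.
        Poly_Mapping.single m (Poly_Mapping.lookup F m))"

text \<open>\<^term>\<open>Poly_Mapping.map_key \<pi> m\<close> is the exponent vector \<open>i \<mapsto> m (\<pi> i)\<close>.\<close>

definition symmetric :: "('n::finite, 'a::zero) mpoly \<Rightarrow> bool" where
  "symmetric F \<longleftrightarrow> (\<forall>\<pi> m. bij \<pi> \<longrightarrow>
     Poly_Mapping.lookup F (Poly_Mapping.map_key \<pi> m) = Poly_Mapping.lookup F m)"

definition power_sum :: "nat \<Rightarrow> ('n::finite, 'a::comm_semiring_1) mpoly" where
  "power_sum i = (\<Sum>j\<in>UNIV. Var j ^ i)"


section \<open>The action of \<open>S\<close> by differentiation\<close>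

definition partial_deriv :: "'n \<Rightarrow> ('n, 'a::comm_semiring_1) mpoly \<Rightarrow> ('n, 'a) mpoly" where
  "partial_deriv i F = (\<Sum>m\<in>Poly_Mapping.keys F.
     Poly_Mapping.single (m - Poly_Mapping.single i 1)
       (of_nat (Poly_Mapping.lookup m i) * Poly_Mapping.lookup F m))"

text \<open>
  The monomial with exponent vector \<open>m\<close> acts as the composition of the operators \<open>\<partial>\<^sub>i\<close> iterated \<open>m i\<close>
  times.  The fold is independent of the order of the variables, since partial derivatives commute
  (lemma \<open>partial_deriv_commute\<close> below).
\<close>

definition monomial_action ::
    "'n::finite monomial \<Rightarrow> ('n, 'a::comm_semiring_1) mpoly \<Rightarrow> ('n, 'a) mpoly" where
  "monomial_action m F =
     Finite_Set.fold (\<lambda>i. partial_deriv i ^^ Poly_Mapping.lookup m i) F UNIV"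

definition diff_action ::
    "('n::finite, 'a::comm_semiring_1) mpoly \<Rightarrow> ('n, 'a) mpoly \<Rightarrow> ('n, 'a) mpoly" where
  "diff_action g F =
     (\<Sum>m\<in>Poly_Mapping.keys g. Const (Poly_Mapping.lookup g m) * monomial_action m F)"

definition annihilator :: "('n::finite, 'a::comm_semiring_1) mpoly \<Rightarrow> ('n, 'a) mpoly set" where
  "annihilator F = {g. diff_action g F = 0}"

lemma lookup_partial_deriv:
  "Poly_Mapping.lookup (partial_deriv i F) m =
     of_nat (Suc (Poly_Mapping.lookup m i)) *
     Poly_Mapping.lookup F (m + Poly_Mapping.single i 1)"
proof -
  let ?u = "Poly_Mapping.single i (1::nat)"
  have eq: "(of_nat (Poly_Mapping.lookup k i) * Poly_Mapping.lookup F k when k - ?u = m) =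
      (if k = m + ?u then of_nat (Suc (Poly_Mapping.lookup m i)) *
         Poly_Mapping.lookup F (m + ?u) else 0)" for k
  proof (cases "Poly_Mapping.lookup k i = 0")
    case True
    then have "k \<noteq> m + ?u"
      by (auto simp: lookup_add)
    with True show ?thesis
      by simp
  next
    case False
    then have "(k - ?u) + ?u = k"
      by (intro poly_mapping_eqI) (auto simp: lookup_add lookup_minus lookup_single when_def)
    then have "k - ?u = m \<longleftrightarrow> k = m + ?u"
      by (metis add_diff_cancel_right')
    then show ?thesis
      by (auto simp: when_def lookup_add)
  qed
  have "Poly_Mapping.lookup (partial_deriv i F) m =
      (\<Sum>k\<in>Poly_Mapping.keys F.
         (of_nat (Poly_Mapping.lookup k i) * Poly_Mapping.lookup F k when k - ?u = m))"
    by (simp add: partial_deriv_def lookup_sum lookup_single)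
  also have "\<dots> = of_nat (Suc (Poly_Mapping.lookup m i)) * Poly_Mapping.lookup F (m + ?u)"
    unfolding eq by (auto simp: sum.delta in_keys_iff)
  finally show ?thesis .
qed

lemma partial_deriv_commute:
  "partial_deriv i (partial_deriv j F) = partial_deriv j (partial_deriv i F)"
  by (cases "i = j")
     (auto intro!: poly_mapping_eqI simp: lookup_partial_deriv lookup_add lookup_single ac_simps)

lemma comp_fun_commute_monomial_action:
  "comp_fun_commute (\<lambda>i. partial_deriv i ^^ e i)"
proof -
  interpret comp_fun_commute partial_deriv
    by standard (simp add: fun_eq_iff partial_deriv_commute)
  show ?thesis
    by (rule comp_fun_commute_funpow)
qed

lemma diff_action_Var:
  fixes F :: "('n::finite, 'a::comm_ring_1) mpoly"
  shows "diff_action (Var i) F = partial_deriv i F"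
proof -
  let ?f = "\<lambda>j. partial_deriv j ^^ Poly_Mapping.lookup (Poly_Mapping.single i (1::nat)) j"
  interpret comp_fun_commute "?f :: 'n \<Rightarrow> ('n, 'a) mpoly \<Rightarrow> ('n, 'a) mpoly"
    by (rule comp_fun_commute_monomial_action)
  have rest: "Finite_Set.fold ?f F A = F" if "finite A" "i \<notin> A" for A
    using that
  proof (induction A rule: finite_induct)
    case (insert x A)
    then have "Finite_Set.fold ?f F (insert x A) = ?f x F"
      by (subst fold_insert) auto
    also have "\<dots> = F"
      using insert.prems by (simp add: lookup_single when_def)
    finally show ?case .
  qed simp
  have "Finite_Set.fold ?f F UNIV = ?f i (Finite_Set.fold ?f F (UNIV - {i}))"
    by (rule fold_rec) auto
  also have "Finite_Set.fold ?f F (UNIV - {i}) = F"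
    by (rule rest) auto
  finally have "monomial_action (Poly_Mapping.single i 1) F = partial_deriv i F"
    by (simp add: monomial_action_def)
  then show ?thesis
    by (simp add: diff_action_def Var_def Const_def)
qed


section \<open>Waring rank\<close>

definition waring_rank :: "nat \<Rightarrow> ('n::finite, 'a::comm_semiring_1) mpoly \<Rightarrow> nat" where
  "waring_rank d F =
     (LEAST r. \<exists>L. (\<forall>i<r. form 1 (L i)) \<and> F = (\<Sum>i<r. L i ^ d))"

text \<open>
  Extension of scalars to the algebraic closure of \<open>k\<close>.  The linear forms in a Waring decomposition
  are allowed to have coefficients there: over \<open>\<rat>\<close>, for instance, \<open>2 p\<^sub>1\<^sup>3\<close> has cactus
  rank 1 but is not the cube of a rational linear form.
\<close>

definition to_closure :: "('n, 'a::field) mpoly \<Rightarrow> ('n, 'a alg_closure) mpoly" where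
  "to_closure F = Poly_Mapping.map to_ac F"


section \<open>Cactus rank\<close>

definition scale :: "'a::comm_semiring_1 \<Rightarrow> ('n, 'a) mpoly \<Rightarrow> ('n, 'a) mpoly" where
  "scale c F = Const c * F"

interpretation mpoly: vector_space "scale :: 'a::field \<Rightarrow> ('n, 'a) mpoly \<Rightarrow> ('n, 'a) mpoly"
  by standard
     (simp_all add: scale_def Const_def single_add mult_single algebra_simps
        flip: mult.assoc)

text \<open>An ideal of \<open>S\<close> is an \<open>S\<close>-submodule of \<open>S\<close>.\<close>

definition homogeneous_ideal :: "('n::finite, 'a::field) mpoly set \<Rightarrow> bool" where
  "homogeneous_ideal I \<longleftrightarrow>
     module.subspace (*) I \<and> (\<forall>f\<in>I. \<forall>d. homogeneous_component d f \<in> I)"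

text \<open>Saturation with respect to the irrelevant ideal \<open>(x\<^sub>1,\<dots>,x\<^sub>n)\<close>: every \<open>f\<close> multiplied
  into \<open>I\<close> by all forms of some degree \<open>N\<close> lies in \<open>I\<close>.\<close>

definition saturated :: "('n::finite, 'a::field) mpoly set \<Rightarrow> bool" where
  "saturated I \<longleftrightarrow> (\<forall>f. (\<exists>N. \<forall>g. form N g \<longrightarrow> g * f \<in> I) \<longrightarrow> f \<in> I)"

text \<open>The Hilbert function \<open>t \<mapsto> dim\<^sub>k (S/I)\<^sub>t = dim\<^sub>k S\<^sub>t - dim\<^sub>k I\<^sub>t\<close>.\<close>

definition hilbert_function :: "('n::finite, 'a::field) mpoly set \<Rightarrow> nat \<Rightarrow> nat" where
  "hilbert_function I t =
     mpoly.dim {f :: ('n, 'a) mpoly. form t f} - mpoly.dim {f\<in>I. form t f}"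

text \<open>
  Closed subschemes of \<open>Proj S\<close> correspond bijectively to saturated homogeneous ideals.  The
  subscheme \<open>Proj (S/I)\<close> is zero-dimensional of degree \<open>r\<close> iff its Hilbert polynomial is the
  constant \<open>r\<close>.  The value \<open>r = 0\<close> is the empty subscheme (\<open>I = S\<close>); it occurs in
  \<open>cactus_rank F\<close> only for \<open>F = 0\<close>.
\<close>

definition zero_dim_subscheme_ideal :: "nat \<Rightarrow> ('n::finite, 'a::field) mpoly set \<Rightarrow> bool" where
  "zero_dim_subscheme_ideal r I \<longleftrightarrow>
     homogeneous_ideal I \<and> saturated I \<and> (\<forall>\<^sub>F t in sequentially. hilbert_function I t = r)"

definition cactus_rank :: "('n::finite, 'a::field) mpoly \<Rightarrow> nat" where
  "cactus_rank F = (LEAST r. \<exists>I. zero_dim_subscheme_ideal r I \<and> I \<subseteq> annihilator F)"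


section \<open>The exceptional symmetric cubics\<close>

definition cubic_p1p2 :: "'a::comm_semiring_1 \<Rightarrow> 'a \<Rightarrow> ('n::finite, 'a) mpoly" where
  "cubic_p1p2 a0 a1 = Const a0 * power_sum 1 ^ 3
     + Const (a1 * of_nat CARD('n)) * power_sum 1 * power_sum 2"

end

theory Submission
  imports Defs "HOL-Library.FuncSet"
begin

text \<open>
  A symmetric cubic is determined by three coefficients
  \<open>F\<^bsub>xyz\<^esub> = \<alpha> + \<beta> ([x = y] + [y = z] + [x = z]) + \<gamma> [x = y = z]\<close> of its polarisation, and the exceptional
  forms are those with \<open>\<gamma> = 0 \<noteq> \<beta>\<close>.  For \<open>\<gamma> \<noteq> 0\<close>, \<open>F\<close> is a combination of \<open>n\<close> or \<open>n + 1\<close> cubes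
  \<open>(\<gamma> X\<^sub>i + \<beta> p\<^sub>1)\<^sup>3\<close> and \<open>p\<^sub>1\<^sup>3\<close>, which bounds both ranks from above.

  The ideal of a scheme of degree \<open>r\<close> has Hilbert function at most \<open>r\<close>, so the catalecticant of \<open>F\<close>
  bounds the cactus rank from below.  A scheme attaining this bound contains in its ideal all quadrics
  that annihilate \<open>F\<close>.  In the cases where the bound is not sharp, these quadrics generate an ideal
  whose quotient has dimension at most 2 in every degree \<open>\<ge> 3\<close>, which is too small.

  An exceptional form is a hyperplane together with a quadric.  The apolar algebra of the
  dehomogenised cubic is a local scheme of degree \<open>n + 1\<close>, whereas the singular locus of \<open>F\<close>, which
  contains the intersection of hyperplane and quadric, forces \<open>2 (n - 1)\<close> summands in every Waring
  decomposition.
\<close>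

text \<open>The two ranks live over different fields: schemes over k, cubes over the closure. A
  decomposition into r cubes is an apolar scheme of degree at most r, so a lower bound for schemes
  over the closure also bounds the Waring rank. Hence the lower bounds for schemes are proved over
  any field of characteristic 0 and applied to both fields. The schemes attaining them must be
  defined over k, where cube roots and roots of unity need not exist; scalars in front of the cubes
  replace the former, functionals that mix conjugate points the latter. The forms \<gamma> X_i +
  \<beta> p_1 become linearly dependent when \<gamma> + n \<beta> = 0. For n >= 4 this changes the
  proof of the lower bound but not the number of cubes; for n = 3 it changes the number, so that
  case has decompositions of its own. An exceptional form with n = 3 does no harm, because then n +
  1 = 2 (n - 1).\<close>

abbreviation coef :: "('b \<Rightarrow>\<^sub>0 'a::zero) \<Rightarrow> 'b \<Rightarrow> 'a" where
  "coef \<equiv> Poly_Mapping.lookup"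

abbreviation unit_exp :: "'n \<Rightarrow> 'n monomial" where
  "unit_exp i \<equiv> Poly_Mapping.single i 1"

abbreviation xpow :: "'n monomial \<Rightarrow> ('n, 'a::zero_neq_one) mpoly" where
  "xpow a \<equiv> Poly_Mapping.single a 1"

section \<open>Forms and homogeneous components\<close>

lemma mpoly_eq_sum_single: "f = (\<Sum>a\<in>Poly_Mapping.keys f. Poly_Mapping.single a (coef f a))"
  by (rule poly_mapping_eqI) (auto simp: lookup_sum lookup_single when_def in_keys_iff)

lemma total_degree_add: "total_degree (a + b) = total_degree a + total_degree b"
  by (simp add: total_degree_def lookup_add sum.distrib)

lemma total_degree_zero [simp]: "total_degree 0 = 0"
  by (simp add: total_degree_def)

lemma total_degree_single [simp]: "total_degree (Poly_Mapping.single i k) = k"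
  by (simp add: total_degree_def lookup_single when_def)

lemma total_degree_eq_0_iff [simp]: "total_degree a = 0 \<longleftrightarrow> a = 0"
  by (auto simp: total_degree_def intro: poly_mapping_eqI)

lemma total_degree_Suc_decomp:
  assumes "total_degree a = Suc d"
  obtains i b where "a = unit_exp i + b" "total_degree b = d"
proof -
  have "a \<noteq> 0" using assms by auto
  then obtain i where i: "coef a i \<noteq> 0"
    by (metis lookup_zero poly_mapping_eqI)
  define b where "b = a - unit_exp i"
  have a: "a = unit_exp i + b"
    using i by (intro poly_mapping_eqI) (auto simp: b_def lookup_add lookup_minus lookup_single when_def)
  moreover have "total_degree b = d"
    using assms by (simp add: a total_degree_add)
  ultimately show ?thesis by (rule that)
qed

lemma finite_total_degree: "finite {a::'n::finite monomial. total_degree a = d}"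
proof (rule finite_imageD)
  have "coef ` {a::'n monomial. total_degree a = d} \<subseteq> UNIV \<rightarrow>\<^sub>E {..d}"
  proof (intro image_subsetI PiE_I)
    fix a :: "'n monomial" and i assume "a \<in> {a. total_degree a = d}"
    moreover have "coef a i \<le> total_degree a"
      unfolding total_degree_def by (rule member_le_sum) simp_all
    ultimately show "coef a i \<in> {..d}" by simp
  qed simp
  moreover have "finite ((UNIV::'n set) \<rightarrow>\<^sub>E {..d})"
    by (intro finite_PiE) auto
  ultimately show "finite (coef ` {a::'n monomial. total_degree a = d})"
    by (rule finite_subset)
  show "inj_on coef {a::'n monomial. total_degree a = d}"
    by (intro inj_onI poly_mapping_eqI) simp
qed

lemma form_iff: "form d f \<longleftrightarrow> (\<forall>a. coef f a \<noteq> 0 \<longrightarrow> total_degree a = d)"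
  by (auto simp: form_def in_keys_iff)

lemma form_zero [simp]: "form d 0"
  by (simp add: form_iff)

lemma form_add [intro]: "form d f \<Longrightarrow> form d g \<Longrightarrow> form d (f + g)"
  unfolding form_iff lookup_add by (metis add_0)

lemma form_diff [intro]:
  fixes f g :: "('n::finite, 'a::ab_group_add) mpoly"
  shows "form d f \<Longrightarrow> form d g \<Longrightarrow> form d (f - g)"
  unfolding form_iff lookup_minus by (metis diff_self)

lemma form_sum: "(\<And>i. i \<in> A \<Longrightarrow> form d (f i)) \<Longrightarrow> form d (sum f A)"
  by (induction A rule: infinite_finite_induct) auto

lemma form_single [intro]: "total_degree a = d \<Longrightarrow> form d (Poly_Mapping.single a c)"
  by (auto simp: form_iff lookup_single when_def)

lemma form_mult [intro]:
  assumes "form d f" "form e g"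
  shows "form (d + e) (f * g)"
  using assms keys_mult[of f g] by (auto simp: form_def total_degree_add)

lemma form_one [simp]: "form 0 1"
  by (simp flip: single_one add: form_single)

lemma form_power: "form d f \<Longrightarrow> form (k * d) (f ^ k)"
  by (induction k) auto

lemma form_Var [simp]: "form (Suc 0) (Var i)"
  by (simp add: Var_def form_single)

lemma form_Const [simp]: "form 0 (Const c)"
  by (simp add: Const_def form_single)

lemma form_scale [intro]: "form d f \<Longrightarrow> form d (scale c f)"
  using form_mult[of 0 "Const c" d f] by (simp add: scale_def)

lemma coef_homogeneous_component:
  "coef (homogeneous_component d f) a = (if total_degree a = d then coef f a else 0)"
  by (auto simp: homogeneous_component_def lookup_sum lookup_single when_def in_keys_iff)

lemma form_homogeneous_component [simp]: "form d (homogeneous_component d f)"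
  by (auto simp: form_iff coef_homogeneous_component split: if_splits)

lemma homogeneous_component_form:
  "form e f \<Longrightarrow> homogeneous_component d f = (if d = e then f else 0)"
  by (intro poly_mapping_eqI) (auto simp: coef_homogeneous_component form_iff)

lemma homogeneous_component_add:
  "homogeneous_component d (f + g) = homogeneous_component d f + homogeneous_component d g"
  by (intro poly_mapping_eqI) (auto simp: coef_homogeneous_component lookup_add)

lemma homogeneous_component_zero [simp]: "homogeneous_component d 0 = 0"
  by (intro poly_mapping_eqI) (auto simp: coef_homogeneous_component)

lemma homogeneous_component_sum:
  "homogeneous_component d (sum f A) = (\<Sum>i\<in>A. homogeneous_component d (f i))"
  by (induction A rule: infinite_finite_induct) (auto simp: homogeneous_component_add)

lemma mpoly_eq_sum_components:
  assumes "\<And>a. a \<in> Poly_Mapping.keys f \<Longrightarrow> total_degree a \<le> N"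
  shows "f = (\<Sum>d\<le>N. homogeneous_component d f)"
  by (rule poly_mapping_eqI) (use assms in \<open>auto simp: lookup_sum coef_homogeneous_component in_keys_iff\<close>)

lemma total_degree_bounded: "\<exists>N. \<forall>a\<in>Poly_Mapping.keys f. total_degree a \<le> N"
  by (rule exI[of _ "Max (total_degree ` Poly_Mapping.keys f)"]) auto

lemma homogeneous_component_mult_form:
  fixes f g :: "('n::finite, 'a::comm_ring_1) mpoly"
  assumes "form e g"
  shows "homogeneous_component (e + d) (g * f) = g * homogeneous_component d f"
    and "d < e \<Longrightarrow> homogeneous_component d (g * f) = 0"
proof -
  obtain N where N: "\<And>a. a \<in> Poly_Mapping.keys f \<Longrightarrow> total_degree a \<le> N"
    using total_degree_bounded by metis
  have "g * f = (\<Sum>k\<le>N. g * homogeneous_component k f)"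
    by (subst mpoly_eq_sum_components[of f N]) (auto simp: N sum_distrib_left)
  then have *: "homogeneous_component c (g * f) =
      (\<Sum>k\<le>N. if c = e + k then g * homogeneous_component k f else 0)" for c
    by (simp add: homogeneous_component_sum homogeneous_component_form[OF form_mult[OF assms form_homogeneous_component]])
  show "d < e \<Longrightarrow> homogeneous_component d (g * f) = 0"
    unfolding * by (auto intro!: sum.neutral)
  have "homogeneous_component d f = 0" if "\<not> d \<le> N"
    using N that by (intro poly_mapping_eqI) (force simp: coef_homogeneous_component in_keys_iff)
  then show "homogeneous_component (e + d) (g * f) = g * homogeneous_component d f"
    unfolding * by auto
qed

lemma coef_scale: "coef (scale c f) a = c * coef (f :: ('n, 'a::comm_ring_1) mpoly) a"
proof -
  have "scale c f = (\<Sum>b\<in>Poly_Mapping.keys f. Poly_Mapping.single b (c * coef f b))"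
    unfolding scale_def Const_def
    by (subst mpoly_eq_sum_single[of f]) (simp add: sum_distrib_left mult_single)
  then show ?thesis
    by (auto simp: lookup_sum lookup_single when_def in_keys_iff)
qed

lemma subspace_form: "mpoly.subspace {f :: ('n::finite, 'a::field) mpoly. form t f}"
  by (auto simp: mpoly.subspace_def)

lemma form_in_span_xpow:
  fixes f :: "('n::finite, 'a::field) mpoly"
  assumes "form t f"
  shows "f \<in> mpoly.span (xpow ` {a. total_degree a = t})"
proof -
  have "scale (coef f a) (xpow a) \<in> mpoly.span (xpow ` {a. total_degree a = t})"
    if "a \<in> Poly_Mapping.keys f" for a
    using assms that by (intro mpoly.span_scale mpoly.span_base) (auto simp: form_def)
  then have "(\<Sum>a\<in>Poly_Mapping.keys f. scale (coef f a) (xpow a))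
      \<in> mpoly.span (xpow ` {a. total_degree a = t})"
    by (rule mpoly.span_sum)
  also have "(\<Sum>a\<in>Poly_Mapping.keys f. scale (coef f a) (xpow a)) = f"
    by (subst (3) mpoly_eq_sum_single[of f]) (simp add: scale_def Const_def mult_single)
  finally show ?thesis .
qed

lemma form_Suc_in_subspace:
  fixes V :: "('n::finite, 'a::field) mpoly set"
  assumes "mpoly.subspace V" "\<And>i g. form d g \<Longrightarrow> Var i * g \<in> V" "form (Suc d) f"
  shows "f \<in> V"
proof -
  have "xpow ` {a. total_degree a = Suc d} \<subseteq> V"
  proof clarsimp
    fix a :: "'n monomial" assume "total_degree a = Suc d"
    then obtain i b where a: "a = unit_exp i + b" "total_degree b = d"
      by (rule total_degree_Suc_decomp)
    then have "(xpow a :: ('n, 'a) mpoly) = Var i * xpow b"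
      by (simp add: Var_def mult_single)
    then show "xpow a \<in> V"
      using assms(2)[of "xpow b" i] a by (simp add: form_single)
  qed
  then have "mpoly.span (xpow ` {a. total_degree a = Suc d}) \<subseteq> V"
    using assms(1) by (rule mpoly.span_minimal)
  with form_in_span_xpow[OF assms(3)] show ?thesis by blast
qed

lemma form_0_eq: "form 0 f \<Longrightarrow> f = Const (coef f 0)"
  by (rule poly_mapping_eqI) (auto simp: form_iff Const_def lookup_single when_def)

section \<open>Linear functionals given by weights on monomials\<close>

text \<open>Elements of the full dual of S: the weight \<open>w\<close> need not have finite
  support. Evaluation at a point, contraction with F and differential conditions at a point all take
  this shape, and multiplication by a variable acts on weights as a shift
  (\<open>pairing_Var_mult\<close>).\<close>

definition pairing :: "('n monomial \<Rightarrow> 'a) \<Rightarrow> ('n, 'a::comm_ring_1) mpoly \<Rightarrow> 'a" where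
  "pairing w f = (\<Sum>a\<in>Poly_Mapping.keys f. coef f a * w a)"

lemma pairing_superset:
  "finite A \<Longrightarrow> Poly_Mapping.keys f \<subseteq> A \<Longrightarrow> pairing w f = (\<Sum>a\<in>A. coef f a * w a)"
  unfolding pairing_def by (rule sum.mono_neutral_left) (auto simp: in_keys_iff)

lemma pairing_zero [simp]: "pairing w 0 = 0"
  by (simp add: pairing_def)

lemma pairing_add: "pairing w (f + g) = pairing w f + pairing w g"
proof -
  let ?A = "Poly_Mapping.keys f \<union> Poly_Mapping.keys g"
  have "pairing w (f + g) = (\<Sum>a\<in>?A. coef (f + g) a * w a)"
    by (rule pairing_superset) (use keys_add[of f g] in auto)
  moreover have "pairing w f = (\<Sum>a\<in>?A. coef f a * w a)" "pairing w g = (\<Sum>a\<in>?A. coef g a * w a)"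
    by (auto intro: pairing_superset)
  ultimately show ?thesis
    by (simp add: lookup_add sum.distrib algebra_simps)
qed

lemma pairing_sum: "pairing w (sum f A) = (\<Sum>i\<in>A. pairing w (f i))"
  by (induction A rule: infinite_finite_induct) (auto simp: pairing_add)

lemma pairing_single [simp]: "pairing w (Poly_Mapping.single a c) = c * w a"
  by (simp add: pairing_def)

lemma pairing_single_mult:
  "pairing w (Poly_Mapping.single b c * f) = c * pairing (\<lambda>a. w (b + a)) f"
proof -
  have "Poly_Mapping.single b c * f =
      (\<Sum>a\<in>Poly_Mapping.keys f. Poly_Mapping.single (b + a) (c * coef f a))"
    by (subst mpoly_eq_sum_single[of f]) (simp add: sum_distrib_left mult_single)
  then have "pairing w (Poly_Mapping.single b c * f) =
      (\<Sum>a\<in>Poly_Mapping.keys f. c * (coef f a * w (b + a)))"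
    by (simp add: pairing_sum mult.assoc)
  then show ?thesis
    by (simp add: pairing_def sum_distrib_left)
qed

lemma pairing_Var_mult: "pairing w (Var i * f) = pairing (\<lambda>a. w (unit_exp i + a)) f"
  by (simp add: Var_def pairing_single_mult)

lemma pairing_scale: "pairing w (scale c f) = c * pairing w f"
  by (simp add: scale_def Const_def pairing_single_mult)

lemma pairing_diff: "pairing w (f - g) = pairing w f - pairing w g"
  using pairing_add[of w "f - g" g] by simp

lemma pairing_component:
  "pairing w (homogeneous_component d f) = pairing (\<lambda>a. if total_degree a = d then w a else 0) f"
proof -
  have "Poly_Mapping.keys (homogeneous_component d f) \<subseteq> Poly_Mapping.keys f"
    by (auto simp: in_keys_iff coef_homogeneous_component split: if_splits)
  then have "pairing w (homogeneous_component d f) =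
      (\<Sum>a\<in>Poly_Mapping.keys f. coef (homogeneous_component d f) a * w a)"
    by (intro pairing_superset) auto
  then show ?thesis
    by (auto simp: pairing_def coef_homogeneous_component intro!: sum.cong)
qed

lemma pairing_cong:
  "(\<And>a. a \<in> Poly_Mapping.keys f \<Longrightarrow> w a = v a) \<Longrightarrow> pairing w f = pairing v f"
  by (simp add: pairing_def)

lemma pairing_weight_sum:
  "pairing (\<lambda>a. \<Sum>i\<in>A. c i * w i a) f = (\<Sum>i\<in>A. c i * pairing (w i) f)"
  unfolding pairing_def sum_distrib_left sum_distrib_right
  by (subst sum.swap) (auto intro!: sum.cong simp: algebra_simps)

lemma pairing_weight_add: "pairing (\<lambda>a. v a + w a) f = pairing v f + pairing w f"
  by (simp add: pairing_def algebra_simps sum.distrib)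

lemma pairing_weight_diff: "pairing (\<lambda>a. v a - w a) f = pairing v f - pairing w f"
  by (simp add: pairing_def algebra_simps sum_subtractf)

lemma pairing_weight_cmult: "pairing (\<lambda>a. c * w a) f = c * pairing w f"
  by (simp add: pairing_def algebra_simps sum_distrib_left)

section \<open>The annihilator in terms of divided-power coefficients\<close>

definition exp_fact :: "'n::finite monomial \<Rightarrow> 'a::field_char_0" where
  "exp_fact a = (\<Prod>i\<in>UNIV. fact (coef a i))"

text \<open>\<open>dp F a\<close> is the coefficient of \<open>F\<close> at the divided power \<open>X\<^sup>a / a!\<close>, i.e. the value of the
  differential operator \<open>x\<^sup>a\<close> on \<open>F\<close> at the origin.\<close>

definition dp :: "('n::finite, 'a::field_char_0) mpoly \<Rightarrow> 'n monomial \<Rightarrow> 'a" where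
  "dp F a = exp_fact a * coef F a"

lemma exp_fact_nonzero [simp]: "exp_fact a \<noteq> 0"
  by (simp add: exp_fact_def)

lemma exp_fact_zero [simp]: "exp_fact 0 = 1"
  by (simp add: exp_fact_def)

lemma exp_fact_unit_add:
  "exp_fact (unit_exp i + a) = (of_nat (Suc (coef a i)) * exp_fact a :: 'a::field_char_0)"
proof -
  have "exp_fact (unit_exp i + a) =
      fact (Suc (coef a i)) * (\<Prod>j\<in>UNIV - {i}. fact (coef a j) :: 'a)"
    unfolding exp_fact_def
    by (subst prod.remove[of _ i]) (auto simp: lookup_add lookup_single when_def intro!: prod.cong)
  also have "\<dots> = of_nat (Suc (coef a i)) * exp_fact a"
    unfolding exp_fact_def by (subst (2) prod.remove[of _ i]) (auto simp: algebra_simps)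
  finally show ?thesis .
qed

text \<open>The factorials absorb the factor produced by differentiation, so in these coordinates
  \<open>partial_deriv i\<close> is a plain shift of exponents and S acts by contraction.\<close>

lemma dp_partial_deriv: "dp (partial_deriv i F) a = dp F (unit_exp i + a)"
  unfolding dp_def lookup_partial_deriv exp_fact_unit_add
  by (metis (no_types, lifting) add.commute mult.assoc mult.commute)

lemma dp_partial_deriv_funpow:
  "dp ((partial_deriv i ^^ k) F) a = dp F (Poly_Mapping.single i k + a)"
proof (induction k arbitrary: a)
  case (Suc k)
  have "Poly_Mapping.single i k + (unit_exp i + a) = Poly_Mapping.single i (Suc k) + a"
    by (metis Suc_eq_plus1 add.assoc single_add)
  then show ?case by (simp add: dp_partial_deriv Suc)
qed simp

lemma dp_monomial_action:
  fixes F :: "('n::finite, 'a::field_char_0) mpoly"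
  shows "dp (monomial_action b F) a = dp F (b + a)"
proof -
  let ?f = "\<lambda>i. partial_deriv i ^^ coef b i"
  interpret comp_fun_commute "?f :: 'n \<Rightarrow> ('n, 'a) mpoly \<Rightarrow> ('n, 'a) mpoly"
    by (rule comp_fun_commute_monomial_action)
  have "dp (Finite_Set.fold ?f F A) a = dp F ((\<Sum>i\<in>A. Poly_Mapping.single i (coef b i)) + a)"
    if "finite A" for A a
    using that
  proof (induction A arbitrary: a rule: finite_induct)
    case (insert i A)
    then show ?case by (simp add: dp_partial_deriv_funpow add_ac)
  qed simp
  moreover have "(\<Sum>i\<in>UNIV. Poly_Mapping.single i (coef b i)) = b"
    by (rule poly_mapping_eqI) (simp add: lookup_sum lookup_single when_def)
  ultimately show ?thesis by (simp add: monomial_action_def)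
qed

lemma dp_sum: "dp (sum f A) a = (\<Sum>i\<in>A. dp (f i) a)"
  by (simp add: dp_def lookup_sum sum_distrib_left)

lemma dp_add: "dp (f + g) a = dp f a + dp g a"
  by (simp add: dp_def lookup_add algebra_simps)

lemma dp_scale: "dp (scale c f) a = c * dp f a"
  by (simp add: dp_def coef_scale algebra_simps)

lemma dp_eq_0_iff: "dp F a = 0 \<longleftrightarrow> coef F a = 0"
  by (simp add: dp_def)

lemma dp_diff_action: "dp (diff_action g F) b = pairing (dp F) (xpow b * g)"
  unfolding diff_action_def pairing_single_mult
  by (simp add: dp_sum dp_scale[unfolded scale_def] dp_monomial_action pairing_def add.commute)

text \<open>The divided-power coefficient at \<open>b\<close> of \<open>g\<close> acting on F is the
  constant term of \<open>xpow b * g\<close> acting on F. Hence the annihilator is the largest ideal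
  inside the kernel of the functional with weights \<open>dp F\<close>.\<close>

lemma annihilator_iff: "g \<in> annihilator F \<longleftrightarrow> (\<forall>b. pairing (dp F) (xpow b * g) = 0)"
proof -
  have "diff_action g F = 0 \<longleftrightarrow> (\<forall>b. dp (diff_action g F) b = 0)"
    by (auto simp: poly_mapping_eq_iff fun_eq_iff dp_eq_0_iff)
  then show ?thesis by (simp add: annihilator_def dp_diff_action)
qed

section \<open>Codimension in a vector space\<close>

text \<open>Independence of the classes of \<open>E\<close> in the quotient by \<open>U\<close>,
  expressed by coefficient functions so that no quotient space has to be formed.\<close>

definition indep_mod ::
    "('k::zero \<Rightarrow> 'b \<Rightarrow> 'b) \<Rightarrow> 'b::comm_monoid_add set \<Rightarrow> 'b set \<Rightarrow> bool" where
  "indep_mod s U E \<longleftrightarrow> finite E \<and> (\<forall>c. (\<Sum>e\<in>E. s (c e) e) \<in> U \<longrightarrow> (\<forall>e\<in>E. c e = 0))"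

context vector_space
begin

text \<open>A basis of \<open>U\<close> together with \<open>E\<close> stays independent inside
  \<open>V\<close>. The finite set \<open>B0\<close> witnesses finite dimension, so that
  \<open>dim\<close> counts finite bases and the difference of natural numbers is the
  codimension.\<close>

lemma card_le_codim:
  assumes U: "subspace U" "U \<subseteq> V" and V: "V \<subseteq> span B0" "finite B0"
    and E: "E \<subseteq> V" "indep_mod scale U E"
  shows "card E \<le> dim V - dim U"
proof -
  obtain BU where BU: "BU \<subseteq> U" "independent BU" "U \<subseteq> span BU" "card BU = dim U"
    by (rule basis_exists)
  obtain C where C: "C \<subseteq> V" "independent C" "V \<subseteq> span C" "card C = dim V"
    by (rule basis_exists)
  have "BU \<subseteq> span B0" "C \<subseteq> span B0" using BU(1) C(1) U(2) V(1) by auto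
  then have finBU: "finite BU" and finC: "finite C"
    using independent_span_bound[OF V(2)] BU(2) C(2) by auto
  have finE: "finite E" and indE: "\<And>c e. (\<Sum>e\<in>E. c e *s e) \<in> U \<Longrightarrow> e \<in> E \<Longrightarrow> c e = 0"
    using E(2) by (auto simp: indep_mod_def)
  have disj: "BU \<inter> E = {}"
  proof (rule ccontr)
    assume "BU \<inter> E \<noteq> {}"
    then obtain e where e: "e \<in> E" "e \<in> U" using BU by blast
    have "(\<Sum>x\<in>E. (if x = e then 1 else 0) *s x) = (\<Sum>x\<in>E. if x = e then x else 0)"
      by (intro sum.cong) auto
    also have "\<dots> = e" using e finE by simp
    finally show False using indE[of "\<lambda>x. if x = e then 1 else 0" e] e by simp
  qed
  have "independent (BU \<union> E)"
  proof (rule independent_if_scalars_zero)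
    show "finite (BU \<union> E)" using finBU finE by simp
    fix f x assume s: "(\<Sum>x\<in>BU \<union> E. f x *s x) = 0" and x: "x \<in> BU \<union> E"
    have s': "(\<Sum>x\<in>BU. f x *s x) + (\<Sum>x\<in>E. f x *s x) = 0"
      using s disj finBU finE by (simp add: sum.union_disjoint)
    have "(\<Sum>x\<in>BU. f x *s x) \<in> U"
      using BU(1) U(1) by (intro subspace_sum subspace_scale) auto
    moreover have "(\<Sum>x\<in>E. f x *s x) = - (\<Sum>x\<in>BU. f x *s x)"
      using s' by (simp add: add_eq_0_iff)
    ultimately have "(\<Sum>x\<in>E. f x *s x) \<in> U"
      using U(1) by (simp add: subspace_neg)
    then have E0: "\<And>e. e \<in> E \<Longrightarrow> f e = 0" by (rule indE)
    then have "(\<Sum>x\<in>BU. f x *s x) = 0" using s' by simp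
    then have "\<And>b. b \<in> BU \<Longrightarrow> f b = 0"
      using independentD[OF BU(2) finBU subset_refl] by blast
    with E0 x show "f x = 0" by auto
  qed
  moreover have "BU \<union> E \<subseteq> span C"
    using BU(1) U(2) E(1) C(3) by blast
  ultimately have "card (BU \<union> E) \<le> card C"
    using independent_span_bound[OF finC] by blast
  then show ?thesis
    using disj finBU finE BU(4) C(4) by (simp add: card_Un_disjoint)
qed

lemma codim_le_card:
  assumes U: "subspace U" "U \<subseteq> V" and V: "V \<subseteq> span B0" "finite B0"
    and E: "finite E" "V \<subseteq> span (U \<union> E)"
  shows "dim V - dim U \<le> card E"
proof -
  obtain BU where BU: "BU \<subseteq> U" "independent BU" "U \<subseteq> span BU" "card BU = dim U"
    by (rule basis_exists)
  obtain C where C: "C \<subseteq> V" "independent C" "V \<subseteq> span C" "card C = dim V"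
    by (rule basis_exists)
  have "BU \<subseteq> span B0" using BU(1) U(2) V(1) by auto
  then have finBU: "finite BU"
    using independent_span_bound[OF V(2)] BU(2) by auto
  have "span (U \<union> E) \<subseteq> span (BU \<union> E)"
    using BU(3) span_mono[of BU "BU \<union> E"] span_superset[of "BU \<union> E"]
    by (intro span_minimal) auto
  then have "card C \<le> card (BU \<union> E)"
    using independent_span_bound[of "BU \<union> E" C] finBU E C by blast
  also have "\<dots> \<le> card BU + card E" by (rule card_Un_le)
  finally show ?thesis using BU C by simp
qed

lemma codim_basis:
  assumes U: "subspace U" "U \<subseteq> V" and V: "V \<subseteq> span B0" "finite B0"
  obtains D where "D \<subseteq> V" "indep_mod scale U D" "card D = dim V - dim U"
proof -
  obtain BU where BU: "BU \<subseteq> U" "independent BU" "U \<subseteq> span BU" "card BU = dim U"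
    by (rule basis_exists)
  obtain C where C: "BU \<subseteq> C" "C \<subseteq> V" "independent C" "V \<subseteq> span C"
    using maximal_independent_subset_extend[of BU V] BU(1,2) U(2) by blast
  have cC: "card C = dim V" using C(2,4,3) by (rule basis_card_eq_dim)
  have "C \<subseteq> span B0" using C(2) V(1) by auto
  then have finC: "finite C" using independent_span_bound[OF V(2)] C(3) by auto
  then have finBU: "finite BU" using C finite_subset by blast
  have "indep_mod scale U (C - BU)"
    unfolding indep_mod_def
  proof (intro conjI allI impI ballI)
    show "finite (C - BU)" using finC by simp
    fix c e assume cs: "(\<Sum>e\<in>C - BU. c e *s e) \<in> U" and e: "e \<in> C - BU"
    from cs BU(3) have "(\<Sum>e\<in>C - BU. c e *s e) \<in> span BU" by blast
    then obtain b where b: "(\<Sum>e\<in>C - BU. c e *s e) = (\<Sum>v\<in>BU. b v *s v)"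
      by (auto simp: span_finite[OF finBU])
    define f where "f v = (if v \<in> BU then - b v else c v)" for v
    have "(\<Sum>v\<in>C. f v *s v) = (\<Sum>v\<in>C - BU. f v *s v) + (\<Sum>v\<in>BU. f v *s v)"
      using C(1) finC by (rule sum.subset_diff)
    also have "\<dots> = (\<Sum>v\<in>C - BU. c v *s v) + (\<Sum>v\<in>BU. - (b v *s v))"
      by (intro arg_cong2[of _ _ _ _ "(+)"] sum.cong) (auto simp: f_def)
    also have "\<dots> = 0" by (simp add: b sum_negf)
    finally have "f e = 0"
      using independentD[OF C(3) finC subset_refl] e by blast
    with e show "c e = 0" by (simp add: f_def)
  qed
  moreover have "card (C - BU) = dim V - dim U"
    using C(1) finBU BU(4) cC by (simp add: card_Diff_subset)
  ultimately show ?thesis using C(2) that[of "C - BU"] by blast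
qed

text \<open>A vector of \<open>V\<close> outside the span could be added to \<open>E\<close>,
  against the bound in \<open>card_le_codim\<close>.\<close>

lemma spanning_if_card_ge_codim:
  assumes U: "subspace U" "U \<subseteq> V" and V: "V \<subseteq> span B0" "finite B0"
    and E: "E \<subseteq> V" "indep_mod scale U E" "dim V - dim U \<le> card E"
  shows "V \<subseteq> span (U \<union> E)"
proof (rule ccontr)
  assume "\<not> ?thesis"
  then obtain v where v: "v \<in> V" "v \<notin> span (U \<union> E)" by blast
  then have vE: "v \<notin> E" using span_superset[of "U \<union> E"] by blast
  have finE: "finite E" and indE: "\<And>c e. (\<Sum>e\<in>E. c e *s e) \<in> U \<Longrightarrow> e \<in> E \<Longrightarrow> c e = 0"
    using E(2) by (auto simp: indep_mod_def)
  have "indep_mod scale U (insert v E)"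
    unfolding indep_mod_def
  proof (intro conjI allI impI)
    show "finite (insert v E)" using finE by simp
    fix c assume "(\<Sum>e\<in>insert v E. c e *s e) \<in> U"
    then have s: "c v *s v + (\<Sum>e\<in>E. c e *s e) \<in> U" using finE vE by simp
    have "c v = 0"
    proof (rule ccontr)
      assume cv: "c v \<noteq> 0"
      have "(\<Sum>e\<in>E. c e *s e) \<in> span (U \<union> E)"
        by (intro span_sum span_scale span_base) auto
      then have "c v *s v \<in> span (U \<union> E)"
        using s span_base[of _ "U \<union> E"] by (metis UnI1 add_diff_cancel_right' span_diff)
      then have "inverse (c v) *s (c v *s v) \<in> span (U \<union> E)" by (rule span_scale)
      with cv v(2) show False by simp
    qed
    with s indE show "\<forall>e\<in>insert v E. c e = 0" by auto
  qed
  then have "card (insert v E) \<le> dim V - dim U"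
    using card_le_codim[OF U V] v E by blast
  with E(3) finE vE show False by simp
qed

end

section \<open>Hilbert functions of ideals\<close>

abbreviation is_ideal :: "'a::comm_ring_1 set \<Rightarrow> bool" where
  "is_ideal \<equiv> module.subspace (*)"

lemma is_ideal_iff:
  "is_ideal I \<longleftrightarrow> 0 \<in> I \<and> (\<forall>f\<in>I. \<forall>g\<in>I. f + g \<in> I) \<and> (\<forall>f\<in>I. \<forall>h. h * f \<in> I)"
proof -
  have "Modules.module ((*) :: 'a \<Rightarrow> 'a \<Rightarrow> 'a)" by standard (simp_all add: algebra_simps)
  then show ?thesis by (auto simp: Modules.module.subspace_def)
qed

lemma is_idealD:
  assumes "is_ideal I"
  shows "0 \<in> I" "f \<in> I \<Longrightarrow> g \<in> I \<Longrightarrow> f + g \<in> I" "f \<in> I \<Longrightarrow> h * f \<in> I"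
    "f \<in> I \<Longrightarrow> f * h \<in> I" "f \<in> I \<Longrightarrow> - f \<in> I" "f \<in> I \<Longrightarrow> g \<in> I \<Longrightarrow> f - g \<in> I"
proof -
  show *: "0 \<in> I" "f \<in> I \<Longrightarrow> g \<in> I \<Longrightarrow> f + g \<in> I" "f \<in> I \<Longrightarrow> h * f \<in> I" for f g h
    using assms by (auto simp: is_ideal_iff)
  show "f \<in> I \<Longrightarrow> f * h \<in> I" using *(3)[of f h] by (simp add: mult.commute)
  show m: "f \<in> I \<Longrightarrow> - f \<in> I" for f using *(3)[of f "- 1"] by simp
  show "f \<in> I \<Longrightarrow> g \<in> I \<Longrightarrow> f - g \<in> I" using *(2)[of f "- g"] m[of g] by simp
qed

lemma is_ideal_sum: "is_ideal I \<Longrightarrow> (\<And>i. i \<in> A \<Longrightarrow> f i \<in> I) \<Longrightarrow> sum f A \<in> I"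
  by (induction A rule: infinite_finite_induct) (auto simp: is_idealD)

lemma is_ideal_power_diff:
  assumes I: "is_ideal I" and ab: "a - b \<in> I"
  shows "a ^ m - b ^ m \<in> I"
proof (induction m)
  case (Suc m)
  have "a ^ Suc m - b ^ Suc m = a * (a ^ m - b ^ m) + (a - b) * b ^ m"
    by (simp add: algebra_simps)
  then show ?case using Suc ab I by (simp add: is_idealD)
qed (simp add: is_idealD[OF I])

lemma is_ideal_colon: "is_ideal I \<Longrightarrow> is_ideal {x. x * f \<in> I}"
  by (auto simp: is_ideal_iff distrib_right mult.assoc)

lemma is_ideal_subspace:
  fixes I :: "('n, 'a::field) mpoly set"
  shows "is_ideal I \<Longrightarrow> mpoly.subspace I"
  by (auto simp: mpoly.subspace_def is_idealD scale_def)

definition indep_at :: "('n::finite, 'a::field) mpoly set \<Rightarrow> nat \<Rightarrow> ('n, 'a) mpoly set \<Rightarrow> bool" where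
  "indep_at I t D \<longleftrightarrow> finite D \<and> (\<forall>d\<in>D. form t d) \<and>
     (\<forall>c. (\<Sum>d\<in>D. scale (c d) d) \<in> I \<longrightarrow> (\<forall>d\<in>D. c d = 0))"

context
  fixes I :: "('n::finite, 'a::field) mpoly set" and t :: nat
  assumes I: "is_ideal I"
begin

private lemma subspace_degree: "mpoly.subspace {f\<in>I. form t f}"
proof -
  have "{f\<in>I. form t f} = I \<inter> {f. form t f}" by blast
  then show ?thesis
    by (simp only: mpoly.subspace_inter[OF is_ideal_subspace[OF I] subspace_form])
qed

private lemma forms_span:
  "{f :: ('n, 'a) mpoly. form t f} \<subseteq> mpoly.span (xpow ` {a. total_degree a = t})"
  by (auto intro: form_in_span_xpow)

private lemma indep_at_iff:
  "indep_at I t D \<longleftrightarrow> D \<subseteq> {f. form t f} \<and> indep_mod scale {f\<in>I. form t f} D"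
proof -
  have "form t (\<Sum>d\<in>D. scale (c d) d)" if "\<forall>d\<in>D. form t d" for c
    using that by (intro form_sum) auto
  then show ?thesis
    unfolding indep_at_def indep_mod_def by auto
qed

private lemmas codim_facts = subspace_degree _ forms_span finite_imageI[OF finite_total_degree]

lemma card_le_hilbert_function: "indep_at I t D \<Longrightarrow> card D \<le> hilbert_function I t"
  unfolding hilbert_function_def indep_at_iff
  by (rule mpoly.card_le_codim[OF codim_facts]) auto

lemma hilbert_function_basis:
  obtains D where "indep_at I t D" "card D = hilbert_function I t"
  unfolding hilbert_function_def indep_at_iff
  by (rule mpoly.codim_basis[OF codim_facts]) (auto intro: that)

private lemma in_span_decomp:
  assumes "f \<in> mpoly.span ({f\<in>I. form t f} \<union> E)" "finite E"
  obtains c where "f - (\<Sum>d\<in>E. scale (c d) d) \<in> I"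
proof -
  from assms(1) obtain x y where xy: "f = x + y" "x \<in> mpoly.span {f\<in>I. form t f}" "y \<in> mpoly.span E"
    unfolding mpoly.span_Un by blast
  from xy(2) have "x \<in> I"
    using mpoly.span_eq_iff[THEN iffD2, OF subspace_degree] by auto
  moreover from xy(3) obtain c where "y = (\<Sum>d\<in>E. scale (c d) d)"
    unfolding mpoly.span_finite[OF assms(2)] by blast
  ultimately show ?thesis using that[of c] xy(1) by simp
qed

lemma spanning_at:
  assumes "indep_at I t D" "hilbert_function I t \<le> card D" "form t f"
  obtains c where "f - (\<Sum>d\<in>D. scale (c d) d) \<in> I"
proof -
  have "{f. form t f} \<subseteq> mpoly.span ({f\<in>I. form t f} \<union> D)"
    by (rule mpoly.spanning_if_card_ge_codim[OF codim_facts])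
       (use assms in \<open>auto simp: indep_at_iff hilbert_function_def\<close>)
  with assms in_span_decomp[of f D] that show ?thesis
    by (auto simp: indep_at_def)
qed

text \<open>The spanning hypothesis may use elements of \<open>I\<close> of all degrees: as
  \<open>f\<close> and the elements of \<open>E\<close> are forms of degree \<open>t\<close>, the
  summand taken from \<open>I\<close> is automatically one too.\<close>

lemma hilbert_function_le_card:
  assumes "finite E" "\<And>f. form t f \<Longrightarrow> f \<in> mpoly.span (I \<union> E)"
    "\<And>e. e \<in> E \<Longrightarrow> form t e"
  shows "hilbert_function I t \<le> card E"
  unfolding hilbert_function_def
proof (rule mpoly.codim_le_card[OF codim_facts])
  show "{f. form t f} \<subseteq> mpoly.span ({f \<in> I. form t f} \<union> E)"
  proof clarify
    fix f :: "('n, 'a) mpoly" assume f: "form t f"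
    from assms(2)[OF f] obtain x y where xy: "f = x + y" "x \<in> mpoly.span I" "y \<in> mpoly.span E"
      unfolding mpoly.span_Un by blast
    have "form t y"
      using xy(3) mpoly.span_minimal[OF _ subspace_form, of E t] assms(3) by auto
    then have "form t x" using xy(1) f form_diff[of t f y] by simp
    moreover have "x \<in> I"
      using xy(2) mpoly.span_eq_iff[THEN iffD2, OF is_ideal_subspace[OF I]] by auto
    ultimately show "f \<in> mpoly.span ({f \<in> I. form t f} \<union> E)"
      using xy unfolding mpoly.span_Un by (auto intro: mpoly.span_base)
  qed
qed (use assms in auto)

end

section \<open>Multiplication by forms and the Hilbert function of a saturated ideal\<close>

lemma indep_at_mult:
  assumes I: "is_ideal I" and D: "indep_at I t D" and g: "form e g"
    and reg: "\<And>f. form t f \<Longrightarrow> g * f \<in> I \<Longrightarrow> f \<in> I"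
  shows "indep_at I (t + e) ((*) g ` D)" "card ((*) g ` D) = card D"
proof -
  have finD: "finite D" and Df: "\<And>d. d \<in> D \<Longrightarrow> form t d"
    and Di: "\<And>c d. (\<Sum>d\<in>D. scale (c d) d) \<in> I \<Longrightarrow> d \<in> D \<Longrightarrow> c d = 0"
    using D by (auto simp: indep_at_def)
  have Di': "c d = 0" if "(\<Sum>d\<in>D. scale (c d) (g * d)) \<in> I" "d \<in> D" for c d
  proof -
    have "(\<Sum>d\<in>D. scale (c d) (g * d)) = g * (\<Sum>d\<in>D. scale (c d) d)"
      by (simp add: sum_distrib_left scale_def mult_ac)
    with that reg[of "\<Sum>d\<in>D. scale (c d) d"] Df show ?thesis
      by (intro Di[OF _ that(2)]) (auto intro!: form_sum)
  qed
  have inj: "inj_on ((*) g) D"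
  proof (rule inj_onI, rule ccontr)
    fix x y assume xy: "x \<in> D" "y \<in> D" "g * x = g * y" "x \<noteq> y"
    define c :: "('a, 'b) mpoly \<Rightarrow> 'b" where "c d = (if d = x then 1 else if d = y then - 1 else 0)" for d
    have "(\<Sum>d\<in>D. scale (c d) (g * d)) = (\<Sum>d\<in>{x, y}. scale (c d) (g * d))"
      using finD xy by (intro sum.mono_neutral_right) (auto simp: c_def)
    also have "\<dots> = 0" using xy by (simp add: c_def)
    finally have "c x = 0" using Di'[of c x] xy is_idealD(1)[OF I] by simp
    then show False by (simp add: c_def)
  qed
  then show "card ((*) g ` D) = card D" by (rule card_image)
  show "indep_at I (t + e) ((*) g ` D)"
    unfolding indep_at_def
  proof (intro conjI allI impI ballI)
    show "finite ((*) g ` D)" using finD by simp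
    show "form (t + e) d" if "d \<in> (*) g ` D" for d
      using that Df form_mult[OF _ g, of t] by (auto simp: mult.commute[of g])
    fix c d assume "(\<Sum>d\<in>(*) g ` D. scale (c d) d) \<in> I" "d \<in> (*) g ` D"
    then show "c d = 0"
      using Di'[of "\<lambda>d. c (g * d)"] by (auto simp: sum.reindex[OF inj])
  qed
qed

lemma indep_at_subset: "indep_at J t D \<Longrightarrow> I \<subseteq> J \<Longrightarrow> indep_at I t D"
  unfolding indep_at_def by blast

lemma xpow_single: "xpow (Poly_Mapping.single i k) = Var i ^ k"
proof (induction k)
  case (Suc k)
  have "Poly_Mapping.single i (Suc k) = unit_exp i + Poly_Mapping.single i k"
    by (simp flip: single_add)
  then have "xpow (Poly_Mapping.single i (Suc k)) = Var i * (xpow (Poly_Mapping.single i k) :: ('a, 'b) mpoly)"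
    by (simp add: Var_def mult_single)
  then show ?case by (simp only: Suc power_Suc)
qed simp

text \<open>By the pigeonhole principle every monomial whose degree is the sum of all
  \<open>N i\<close> is divisible by some \<open>Var i ^ N i\<close>, so every form of that degree
  multiplies \<open>f\<close> into \<open>I\<close>.\<close>

lemma saturated_Var_power:
  fixes I :: "('n::finite, 'a::field) mpoly set"
  assumes I: "is_ideal I" "saturated I" and f: "\<And>i. \<exists>N. Var i ^ N * f \<in> I"
  shows "f \<in> I"
proof -
  from f obtain N where N: "\<And>i. Var i ^ N i * f \<in> I" by metis
  let ?K = "{x. x * f \<in> I}"
  have K: "is_ideal ?K" by (rule is_ideal_colon[OF I(1)])
  have "xpow a \<in> ?K" if a: "total_degree a = (\<Sum>i\<in>UNIV. N i)" for a
  proof -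
    obtain i where i: "N i \<le> coef a i"
    proof (rule ccontr)
      assume "\<not> thesis"
      with that have "\<And>i. coef a i < N i" using not_le_imp_less by blast
      then have "total_degree a < (\<Sum>i\<in>UNIV. N i)"
        unfolding total_degree_def by (intro sum_strict_mono) auto
      with a show False by simp
    qed
    define b where "b = a - Poly_Mapping.single i (N i)"
    have "a = b + Poly_Mapping.single i (N i)"
      using i by (intro poly_mapping_eqI) (auto simp: b_def lookup_add lookup_minus lookup_single when_def)
    then have "(xpow a :: ('n, 'a) mpoly) = xpow b * Var i ^ N i"
      by (simp add: mult_single flip: xpow_single)
    then show ?thesis using is_idealD(3)[OF K, of "Var i ^ N i" "xpow b"] N[of i] by simp
  qed
  then have "mpoly.span (xpow ` {a. total_degree a = (\<Sum>i\<in>UNIV. N i)}) \<subseteq> ?K"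
    by (intro mpoly.span_minimal is_ideal_subspace[OF K]) auto
  then have "\<forall>g. form (\<Sum>i\<in>UNIV. N i) g \<longrightarrow> g * f \<in> I"
    using form_in_span_xpow by blast
  with I(2) show ?thesis unfolding saturated_def by blast
qed

text \<open>
  Since \<open>I\<close> is saturated, some form is a nonzerodivisor modulo \<open>I\<close>.  Instead of associated primes,
  the proof uses a form \<open>g\<close> for which \<open>I : g\<^sup>\<infinity>\<close> is minimal in degree \<open>t\<close>.  If \<open>f\<close> of degree \<open>t\<close>
  lies in \<open>I : g\<^sup>\<infinity>\<close> but not in \<open>I\<close>, then some variable \<open>x\<close> is not nilpotent on \<open>f\<close>.  As the Hilbert
  function of \<open>I : g\<^sup>\<infinity>\<close> is bounded, some power \<open>x\<^sup>N = g\<^sup>j u + h\<close> with \<open>h \<in> I : g\<^sup>\<infinity>\<close>, and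
  \<open>g\<^sup>a + h\<close> contradicts minimality.
\<close>

lemma hilbert_function_le_degree:
  fixes I :: "('n::finite, 'a::field) mpoly set"
  assumes Z: "zero_dim_subscheme_ideal r I"
  shows "hilbert_function I t \<le> r"
proof -
  from Z have I: "is_ideal I" and sat: "saturated I"
    and ev: "\<forall>\<^sub>F t in sequentially. hilbert_function I t = r"
    by (auto simp: zero_dim_subscheme_ideal_def homogeneous_ideal_def)
  from ev obtain T where T: "\<And>s. s \<ge> T \<Longrightarrow> hilbert_function I s = r"
    by (auto simp: eventually_sequentially)
  define J where "J g = {f. \<exists>k. g ^ k * f \<in> I}" for g
  have JI: "is_ideal (J g)" for g
    unfolding is_ideal_iff
  proof (intro conjI ballI allI)
    show "0 \<in> J g" using is_idealD(1)[OF I] by (simp add: J_def)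
    fix f assume "f \<in> J g"
    then obtain k where k: "g ^ k * f \<in> I" by (auto simp: J_def)
    show "h * f \<in> J g" for h
      using is_idealD(3)[OF I k, of h] by (auto simp: J_def mult_ac)
    fix f' assume "f' \<in> J g"
    then obtain l where l: "g ^ l * f' \<in> I" by (auto simp: J_def)
    have "g ^ (k + l) * (f + f') = g ^ l * (g ^ k * f) + g ^ k * (g ^ l * f')"
      by (simp add: algebra_simps power_add)
    then show "f + f' \<in> J g" using is_idealD[OF I] k l unfolding J_def by (metis (mono_tags) mem_Collect_eq)
  qed
  have IJ: "I \<subseteq> J g" for g
    by (auto simp: J_def intro: exI[of _ 0])
  have Jsat: "f \<in> J g" if "g ^ k * f \<in> J g" for g k f
  proof -
    from that obtain l where "g ^ l * (g ^ k * f) \<in> I" by (auto simp: J_def)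
    then have "g ^ (l + k) * f \<in> I" by (simp add: power_add mult_ac)
    then show ?thesis by (auto simp: J_def)
  qed
  have hfJ: "hilbert_function (J g) s \<le> hilbert_function I s" for g s
    using hilbert_function_basis[OF JI] indep_at_subset[OF _ IJ] card_le_hilbert_function[OF I] by metis
  let ?P = "\<lambda>g :: ('n, 'a) mpoly. \<exists>e>0. form e g"
  have "\<exists>g. ?P g \<and> (\<forall>g'. ?P g' \<longrightarrow> hilbert_function (J g') t \<le> hilbert_function (J g) t)"
  proof (rule ex_has_greatest_nat)
    show "?P (Var undefined)" using form_Var by blast
    show "\<forall>g. ?P g \<longrightarrow> hilbert_function (J g) t < Suc (hilbert_function I t)"
      using hfJ le_imp_less_Suc by blast
  qed
  then obtain g e where e: "e > 0" and g: "form e g"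
    and max: "\<And>g' e'. e' > 0 \<Longrightarrow> form e' g' \<Longrightarrow> hilbert_function (J g') t \<le> hilbert_function (J g) t"
    by blast
  have gpow: "form (k * e) (g ^ k)" for k using form_power[OF g] by simp
  have regular: "f \<in> I" if f: "form t f" "f \<in> J g" for f
  proof (rule ccontr)
    assume fI: "f \<notin> I"
    from f(2) obtain j0 where "g ^ j0 * f \<in> I" by (auto simp: J_def)
    then have "g * (g ^ j0 * f) \<in> I" by (rule is_idealD(3)[OF I])
    then obtain j where j: "j > 0" "g ^ j * f \<in> I" by (intro that[of "Suc j0"]) (simp_all add: mult_ac)
    from fI saturated_Var_power[OF I sat, of f] obtain i where i: "\<And>N. Var i ^ N * f \<notin> I" by blast
    define q where "q = j * e"
    have q: "q > 0" using j e by (simp add: q_def)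
    \<comment> \<open>Multiplication by \<open>g ^ j\<close> is injective modulo \<open>J g\<close>,
      so the Hilbert function of \<open>J g\<close> does not decrease along the multiples of
      \<open>q\<close>. Being bounded, it repeats a value at two consecutive multiples, and between
      these degrees multiplication by \<open>g ^ j\<close> is also surjective.\<close>
    have step: "indep_at (J g) (k * q + q) ((*) (g ^ j) ` D) \<and> card ((*) (g ^ j) ` D) = card D"
      if "indep_at (J g) (k * q) D" for k D
      using indep_at_mult[OF JI that gpow[of j]] Jsat unfolding q_def by blast
    have xpow: "hilbert_function (J g) (k * q) \<le> hilbert_function (J g) (k * q + q)" for k
      using hilbert_function_basis[OF JI] step card_le_hilbert_function[OF JI] by metis
    have "\<exists>k. hilbert_function (J g) (k * q + q) \<le> hilbert_function (J g) (k * q)"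
    proof (rule ccontr)
      assume "\<not> ?thesis"
      then have lt: "hilbert_function (J g) (k * q) < hilbert_function (J g) (Suc k * q)" for k
        by (simp add: not_le add.commute)
      have "k \<le> hilbert_function (J g) (k * q)" for k
      proof (induction k)
        case (Suc k)
        with lt[of k] show ?case by simp
      qed simp
      from this[of "T + Suc r"] hfJ[of g "(T + Suc r) * q"] T[of "(T + Suc r) * q"] q
      show False by (metis One_nat_def Suc_leI add_lessD1 le_add1 le_trans less_eq_Suc_le mult.right_neutral mult_le_mono not_less_eq_eq add.commute)
    qed
    then obtain k where k: "hilbert_function (J g) (k * q + q) \<le> hilbert_function (J g) (k * q)" by blast
    define N where "N = Suc k * q"
    obtain D where D: "indep_at (J g) (k * q) D" "card D = hilbert_function (J g) (k * q)"
      by (rule hilbert_function_basis[OF JI])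
    have "form N (Var i ^ N :: ('n, 'a) mpoly)" using form_power[OF form_Var, of N i] by simp
    then obtain c where c: "Var i ^ N - (\<Sum>d\<in>(*) (g ^ j) ` D. scale (c d) d) \<in> J g"
      using spanning_at[OF JI[of g], of "k * q + q" "(*) (g ^ j) ` D" "Var i ^ N"] step[OF D(1)] D(2) k
      by (auto simp: N_def add.commute)
    define h where "h = Var i ^ N - (\<Sum>d\<in>(*) (g ^ j) ` D. scale (c d) d)"
    have hJ: "h \<in> J g" using c by (simp add: h_def)
    have "\<exists>u. (\<Sum>d\<in>(*) (g ^ j) ` D. scale (c d) d) = g ^ j * u"
    proof -
      have "g ^ j dvd (\<Sum>d\<in>(*) (g ^ j) ` D. scale (c d) d)"
        by (intro dvd_sum) (auto simp: scale_def)
      then show ?thesis by (auto simp: dvd_def)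
    qed
    then obtain u where u: "(\<Sum>d\<in>(*) (g ^ j) ` D. scale (c d) d) = g ^ j * u" by blast
    have hform: "form N h"
      unfolding h_def
    proof (rule form_diff)
      show "form N (Var i ^ N :: ('n, 'a) mpoly)" by fact
      show "form N (\<Sum>d\<in>(*) (g ^ j) ` D. scale (c d) d)"
        using step[OF D(1)] by (intro form_sum form_scale) (auto simp: indep_at_def N_def add.commute)
    qed
    \<comment> \<open>The exponent makes \<open>g ^ a\<close> a form of degree \<open>N\<close>, so
      that \<open>g'\<close> is homogeneous.\<close>
    define a where "a = Suc k * j"
    define g' where "g' = g ^ a + h"
    have "form N (g ^ a)" using gpow[of a] by (simp only: a_def N_def q_def mult.assoc)
    then have g': "form N g'" using hform by (simp add: g'_def form_add)
    have sub: "J g' \<subseteq> J g"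
    proof
      fix x assume "x \<in> J g'"
      then obtain m where "g' ^ m * x \<in> I" by (auto simp: J_def)
      then have 1: "g' ^ m * x \<in> J g" using IJ by blast
      have "g' ^ m - (g ^ a) ^ m \<in> J g"
        by (rule is_ideal_power_diff[OF JI]) (simp add: g'_def hJ)
      then have "(g' ^ m - (g ^ a) ^ m) * x \<in> J g" by (rule is_idealD(4)[OF JI])
      with 1 have "g' ^ m * x - (g' ^ m - (g ^ a) ^ m) * x \<in> J g" by (rule is_idealD(6)[OF JI])
      then have "g ^ (a * m) * x \<in> J g" by (simp add: algebra_simps power_mult)
      then show "x \<in> J g" by (rule Jsat)
    qed
    \<comment> \<open>The difference \<open>g' - Var i ^ N\<close> is a multiple of
      \<open>g ^ j\<close>, which sends \<open>f\<close> into \<open>I\<close>. Modulo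
      \<open>I\<close>, powers of \<open>g'\<close> therefore act on \<open>f\<close> like powers of
      \<open>Var i\<close>, none of which sends \<open>f\<close> into \<open>I\<close>.\<close>
    have fJ: "f \<notin> J g'"
    proof
      assume "f \<in> J g'"
      then obtain m where m: "g' ^ m * f \<in> I" by (auto simp: J_def)
      let ?K = "{x. x * f \<in> I}"
      have K: "is_ideal ?K" by (rule is_ideal_colon[OF I])
      have "g' - Var i ^ N = g ^ j * (g ^ (k * j) - u)"
        unfolding g'_def h_def u a_def by (simp add: algebra_simps power_add)
      then have "g' - Var i ^ N \<in> ?K"
        using is_idealD(4)[OF K, of "g ^ j"] j(2) by simp
      then have "g' ^ m - (Var i ^ N) ^ m \<in> ?K" by (rule is_ideal_power_diff[OF K])
      moreover have "g' ^ m \<in> ?K" using m by simp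
      ultimately have "g' ^ m - (g' ^ m - (Var i ^ N) ^ m) \<in> ?K" using is_idealD(6)[OF K] by blast
      then show False using i[of "N * m"] by (simp add: power_mult)
    qed
    obtain D' where D': "indep_at (J g) t D'" "card D' = hilbert_function (J g) t"
      by (rule hilbert_function_basis[OF JI])
    have D'i: "\<And>c d. (\<Sum>d\<in>D'. scale (c d) d) \<in> J g \<Longrightarrow> d \<in> D' \<Longrightarrow> c d = 0"
      and finD': "finite D'" using D'(1) by (auto simp: indep_at_def)
    have fD': "f \<notin> D'"
    proof
      assume fD: "f \<in> D'"
      have "(\<Sum>d\<in>D'. scale (if d = f then 1 else 0) d) = (\<Sum>d\<in>D'. if d = f then d else 0)"
        by (intro sum.cong) auto
      also have "\<dots> = f" using fD finD' by simp
      finally show False using D'i[of "\<lambda>d. if d = f then 1 else 0" f] f(2) fD by simp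
    qed
    \<comment> \<open>As \<open>f\<close> lies in \<open>J g\<close> but not in the smaller ideal
      \<open>J g'\<close>, adding it to \<open>D'\<close> raises the Hilbert function above its
      maximum.\<close>
    have "indep_at (J g') t (insert f D')"
      unfolding indep_at_def
    proof (intro conjI allI impI)
      show "finite (insert f D')" using finD' by simp
      show "\<forall>d\<in>insert f D'. form t d" using D'(1) f by (auto simp: indep_at_def)
      fix c assume "(\<Sum>d\<in>insert f D'. scale (c d) d) \<in> J g'"
      then have s: "scale (c f) f + (\<Sum>d\<in>D'. scale (c d) d) \<in> J g'"
        using finD' fD' by simp
      have "scale (c f) f \<in> J g" using f(2) is_idealD(3)[OF JI] by (simp add: scale_def)
      with s sub have "(scale (c f) f + (\<Sum>d\<in>D'. scale (c d) d)) - scale (c f) f \<in> J g"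
        by (intro is_idealD(6)[OF JI]) auto
      then have c0: "\<And>d. d \<in> D' \<Longrightarrow> c d = 0" by (intro D'i) simp_all
      then have "scale (c f) f \<in> J g'" using s by simp
      then have "scale (inverse (c f)) (scale (c f) f) \<in> J g'"
        unfolding scale_def by (rule is_idealD(3)[OF JI])
      with fJ have "c f = 0" by (cases "c f = 0") auto
      with c0 show "\<forall>d\<in>insert f D'. c d = 0" by auto
    qed
    then have "card (insert f D') \<le> hilbert_function (J g') t"
      by (rule card_le_hilbert_function[OF JI])
    also have "\<dots> \<le> hilbert_function (J g) t"
      using max[OF _ g'] q by (simp add: N_def)
    finally show False using D'(2) finD' fD' by simp
  qed
  obtain D where D: "indep_at I t D" "card D = hilbert_function I t"
    by (rule hilbert_function_basis[OF I])
  have "indep_at (J g) t D"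
    unfolding indep_at_def
  proof (intro conjI allI impI)
    show "finite D" "\<forall>d\<in>D. form t d" using D by (auto simp: indep_at_def)
    fix c assume s: "(\<Sum>d\<in>D. scale (c d) d) \<in> J g"
    have "form t (\<Sum>d\<in>D. scale (c d) d)"
      using D(1) by (intro form_sum form_scale) (auto simp: indep_at_def)
    with s have "(\<Sum>d\<in>D. scale (c d) d) \<in> I" by (intro regular)
    then show "\<forall>d\<in>D. c d = 0" using D(1) by (auto simp: indep_at_def)
  qed
  \<comment> \<open>\<open>g ^ T\<close> has degree \<open>T * e >= T\<close>, so it carries degree
    \<open>t\<close> injectively into the range where the Hilbert function is constantly
    \<open>r\<close>.\<close>
  note * = indep_at_mult[OF JI this gpow[of T] Jsat]
  have "indep_at I (t + T * e) ((*) (g ^ T) ` D)"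
    using *(1) IJ by (rule indep_at_subset) auto
  then have "card ((*) (g ^ T) ` D) \<le> hilbert_function I (t + T * e)"
    by (rule card_le_hilbert_function[OF I])
  also have "\<dots> = r" using e by (intro T) (simp add: trans_le_add2)
  finally show ?thesis using *(2) D(2) by simp
qed

section \<open>Zero-dimensional subschemes cut out by functionals\<close>

text \<open>The common kernel of the functionals will be the inhomogeneous ideal of an affine
  scheme; testing each homogeneous component separately extracts its homogeneous part, which is the
  ideal of the projective scheme.\<close>

definition scheme_ideal ::
    "('j \<Rightarrow> 'n::finite monomial \<Rightarrow> 'a::field) \<Rightarrow> 'j set \<Rightarrow> ('n, 'a) mpoly set" where
  "scheme_ideal w J = {f. \<forall>d. \<forall>i\<in>J. pairing (w i) (homogeneous_component d f) = 0}"

definition lin :: "('n::finite \<Rightarrow> 'a::field) \<Rightarrow> ('n, 'a) mpoly" where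
  "lin u = (\<Sum>k\<in>UNIV. scale (u k) (Var k))"

lemma form_lin [simp]: "form (Suc 0) (lin u)"
  unfolding lin_def by (intro form_sum form_scale) simp

lemma lin_mult: "lin u * f = (\<Sum>k\<in>UNIV. scale (u k) (Var k * f))"
  by (simp add: lin_def sum_distrib_right scale_def mult.assoc)

lemma form_1_eq_lin:
  assumes "form 1 L"
  shows "L = lin (\<lambda>k. coef L (unit_exp k))"
proof (rule poly_mapping_eqI)
  fix a
  have *: "coef (lin (\<lambda>k. coef L (unit_exp k))) a =
      (\<Sum>k\<in>UNIV. if unit_exp k = a then coef L (unit_exp k) else 0)"
    by (auto simp: lin_def lookup_sum coef_scale Var_def lookup_single when_def intro!: sum.cong)
  show "coef L a = coef (lin (\<lambda>k. coef L (unit_exp k))) a"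
  proof (cases "\<exists>i. a = unit_exp i")
    case True
    then obtain i where a: "a = unit_exp i" by blast
    have "unit_exp k = a \<longleftrightarrow> k = i" for k
      by (auto simp: a dest: arg_cong[of _ _ "\<lambda>a. coef a k"] simp: lookup_single when_def split: if_splits)
    then show ?thesis unfolding * by (simp add: a)
  next
    case False
    have "coef L a = 0"
    proof (rule ccontr)
      assume "coef L a \<noteq> 0"
      then have "total_degree a = Suc 0" using assms by (simp add: form_iff)
      then obtain i b where "a = unit_exp i + b" "total_degree b = 0" by (rule total_degree_Suc_decomp)
      then have "a = unit_exp i" by simp
      with False show False by blast
    qed
    then show ?thesis unfolding * using False by (auto intro!: sum.neutral)
  qed
qed

text \<open>The common kernel of the functionals is an ideal by \<open>closed\<close>, of
  codimension \<open>card J\<close> by \<open>dual\<close>, and \<open>unit\<close> says that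
  \<open>lin u\<close> acts as 1 on the quotient: a finite scheme in the affine chart
  \<open>lin u = 1\<close>. So \<open>lin u\<close> is a nonzerodivisor modulo the homogeneous
  ideal, which gives saturation, and its powers raise the dual polynomials to forms of any large
  degree, which gives the Hilbert function.\<close>

lemma zero_dim_scheme_ideal:
  fixes w :: "'j \<Rightarrow> 'n::finite monomial \<Rightarrow> 'a::field" and u :: "'n \<Rightarrow> 'a"
  assumes fin: "finite J"
    and closed: "\<And>f k i. (\<And>j. j \<in> J \<Longrightarrow> pairing (w j) f = 0) \<Longrightarrow> i \<in> J \<Longrightarrow>
      pairing (w i) (Var k * f) = 0"
    and unit: "\<And>i a. i \<in> J \<Longrightarrow> (\<Sum>k\<in>UNIV. u k * w i (unit_exp k + a)) = w i a"
    and dual: "\<And>i. i \<in> J \<Longrightarrow> \<exists>f. \<forall>j\<in>J. pairing (w j) f = (if j = i then 1 else 0)"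
  shows "zero_dim_subscheme_ideal (card J) (scheme_ideal w J)"
proof -
  define A where "A = {f. \<forall>i\<in>J. pairing (w i) f = 0}"
  have A0: "0 \<in> A" and A_add: "\<And>f g. f \<in> A \<Longrightarrow> g \<in> A \<Longrightarrow> f + g \<in> A"
    by (auto simp: A_def pairing_add)
  have A_Var: "f \<in> A \<Longrightarrow> Var k * f \<in> A" for f k
    using closed unfolding A_def by blast
  have A_single: "f \<in> A \<Longrightarrow> Poly_Mapping.single a c * f \<in> A" for f a c
  proof (induction "total_degree a" arbitrary: a)
    case 0
    then show ?case by (simp add: A_def pairing_single_mult)
  next
    case (Suc d)
    from Suc.hyps(2)[symmetric] obtain i b where a: "a = unit_exp i + b" "total_degree b = d"
      by (rule total_degree_Suc_decomp)
    have "Poly_Mapping.single a c * f = Var i * (Poly_Mapping.single b c * f)"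
      by (simp add: a Var_def mult_single flip: mult.assoc)
    then show ?case using A_Var Suc a by auto
  qed
  let ?I = "scheme_ideal w J"
  have I_iff: "f \<in> ?I \<longleftrightarrow> (\<forall>d. homogeneous_component d f \<in> A)" for f
    by (auto simp: scheme_ideal_def A_def)
  have I_form: "form t f \<Longrightarrow> f \<in> ?I \<longleftrightarrow> f \<in> A" for f t
    unfolding I_iff by (auto simp: homogeneous_component_form A0)
  have I_add: "f + g \<in> ?I" if "f \<in> ?I" "g \<in> ?I" for f g
    using that A_add by (simp add: I_iff homogeneous_component_add)
  have I0: "0 \<in> ?I" using A0 by (simp add: I_iff)
  have I_single: "Poly_Mapping.single a c * f \<in> ?I" if "f \<in> ?I" for a c f
    unfolding I_iff
  proof
    fix d
    have fa: "form (total_degree a) (Poly_Mapping.single a c)" by (rule form_single) simp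
    show "homogeneous_component d (Poly_Mapping.single a c * f) \<in> A"
    proof (cases "d < total_degree a")
      case True
      then show ?thesis using homogeneous_component_mult_form(2)[OF fa True] A0 by simp
    next
      case False
      then show ?thesis
        using homogeneous_component_mult_form(1)[OF fa, of "d - total_degree a" f] A_single that
        by (simp add: I_iff)
    qed
  qed
  have I_mult: "h * f \<in> ?I" if "f \<in> ?I" for h f
  proof -
    have "(\<Sum>a\<in>B. Poly_Mapping.single a (coef h a) * f) \<in> ?I" for B
      using that I_single I_add I0 by (induction B rule: infinite_finite_induct) auto
    then have "(\<Sum>a\<in>Poly_Mapping.keys h. Poly_Mapping.single a (coef h a)) * f \<in> ?I"
      by (simp add: sum_distrib_right)
    then show ?thesis by (simp flip: mpoly_eq_sum_single)
  qed
  have ideal: "is_ideal ?I"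
    unfolding is_ideal_iff using I0 I_add I_mult by blast
  have hom: "homogeneous_ideal ?I"
    unfolding homogeneous_ideal_def using ideal I_form[OF form_homogeneous_component] I_iff by blast
  have lin_pairing: "pairing (w i) (lin u * f) = pairing (w i) f" if "i \<in> J" for i f
  proof -
    have "pairing (w i) (lin u * f) = pairing (\<lambda>a. \<Sum>k\<in>UNIV. u k * w i (unit_exp k + a)) f"
      by (simp add: lin_mult pairing_sum pairing_scale pairing_Var_mult pairing_weight_sum)
    also have "\<dots> = pairing (w i) f" using unit[OF that] by (intro pairing_cong) simp
    finally show ?thesis .
  qed
  have linpow_pairing: "pairing (w i) (lin u ^ N * f) = pairing (w i) f" if "i \<in> J" for i f N
    by (induction N) (auto simp: mult.assoc lin_pairing that)
  have form_linpow: "form N (lin u ^ N)" for N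
    using form_power[OF form_lin, of N u] by simp
  have sat: "saturated ?I"
    unfolding saturated_def
  proof (intro allI impI)
    fix f assume "\<exists>N. \<forall>g. form N g \<longrightarrow> g * f \<in> ?I"
    then obtain N where "lin u ^ N * f \<in> ?I" using form_linpow by blast
    then have "lin u ^ N * homogeneous_component d f \<in> A" for d
      using homogeneous_component_mult_form(1)[OF form_linpow[of N], of d f] by (metis I_iff)
    then have "homogeneous_component d f \<in> A" for d
      by (simp add: A_def linpow_pairing)
    then show "f \<in> ?I" by (simp add: I_iff)
  qed
  from dual obtain p where p: "\<And>i j. i \<in> J \<Longrightarrow> j \<in> J \<Longrightarrow> pairing (w j) (p i) = (if j = i then 1 else 0)"
    by metis
  have "\<forall>i. \<exists>N. \<forall>a\<in>Poly_Mapping.keys (p i). total_degree a \<le> N"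
    using total_degree_bounded by blast
  then obtain N where N: "\<And>i a. a \<in> Poly_Mapping.keys (p i) \<Longrightarrow> total_degree a \<le> N i"
    by metis
  have "hilbert_function ?I t = card J" if t: "t \<ge> (\<Sum>i\<in>J. N i)" for t
  proof -
    \<comment> \<open>The homogenisation of \<open>p i\<close> by powers of \<open>lin u\<close>;
      the functionals do not notice these factors.\<close>
    define g where "g i = (\<Sum>d\<le>N i. lin u ^ (t - d) * homogeneous_component d (p i))" for i
    have Nt: "N i \<le> t" if "i \<in> J" for i
      using member_le_sum[of i J N] that fin t by simp
    have gf: "form t (g i)" if "i \<in> J" for i
      unfolding g_def
    proof (rule form_sum)
      fix d assume "d \<in> {..N i}"
      then have "t = (t - d) + d" using Nt[OF that] by simp
      then show "form t (lin u ^ (t - d) * homogeneous_component d (p i))"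
        using form_mult[OF form_linpow form_homogeneous_component] by metis
    qed
    have gp: "pairing (w j) (g i) = (if j = i then 1 else 0)" if ij: "i \<in> J" "j \<in> J" for i j
    proof -
      have "pairing (w j) (g i) = pairing (w j) (\<Sum>d\<le>N i. homogeneous_component d (p i))"
        by (simp add: g_def pairing_sum linpow_pairing ij)
      also have "\<dots> = pairing (w j) (p i)" using mpoly_eq_sum_components[of "p i" "N i"] N by simp
      finally show ?thesis using p ij by simp
    qed
    have comb: "pairing (w j) (\<Sum>i\<in>J. scale (c i) (g i)) = c j" if "j \<in> J" for c j
    proof -
      have "pairing (w j) (\<Sum>i\<in>J. scale (c i) (g i)) = (\<Sum>i\<in>J. if j = i then c i else 0)"
        unfolding pairing_sum pairing_scale using that by (intro sum.cong) (auto simp: gp)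
      then show ?thesis using that fin by simp
    qed
    have inj: "inj_on g J"
    proof (rule inj_onI, rule ccontr)
      fix i j assume ij: "i \<in> J" "j \<in> J" "g i = g j" "i \<noteq> j"
      then show False using gp[of i i] gp[of j i] by simp
    qed
    have "indep_at ?I t (g ` J)"
      unfolding indep_at_def
    proof (intro conjI allI impI)
      show "finite (g ` J)" "\<forall>d\<in>g ` J. form t d" using fin gf by auto
      fix c assume "(\<Sum>d\<in>g ` J. scale (c d) d) \<in> ?I"
      then have "(\<Sum>i\<in>J. scale (c (g i)) (g i)) \<in> ?I" by (simp add: sum.reindex[OF inj])
      moreover have "form t (\<Sum>i\<in>J. scale (c (g i)) (g i))" using gf by (intro form_sum form_scale)
      ultimately have "(\<Sum>i\<in>J. scale (c (g i)) (g i)) \<in> A" using I_form by blast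
      then show "\<forall>d\<in>g ` J. c d = 0" using comb[of _ "\<lambda>i. c (g i)"] by (auto simp: A_def)
    qed
    then have ge: "card J \<le> hilbert_function ?I t"
      using card_le_hilbert_function[OF ideal] card_image[OF inj] by metis
    have "hilbert_function ?I t \<le> card (g ` J)"
    proof (rule hilbert_function_le_card[OF ideal])
      show "finite (g ` J)" "\<And>e. e \<in> g ` J \<Longrightarrow> form t e" using fin gf by auto
      fix f :: "('n, 'a) mpoly" assume f: "form t f"
      define h where "h = (\<Sum>i\<in>J. scale (pairing (w i) f) (g i))"
      have "form t h" unfolding h_def using gf by (intro form_sum form_scale)
      then have "form t (f - h)" using f by (rule form_diff[rotated])
      moreover have "f - h \<in> A" by (simp add: A_def pairing_diff h_def comb)
      ultimately have "f - h \<in> ?I" using I_form by blast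
      then have "f - h \<in> mpoly.span (?I \<union> g ` J)" by (intro mpoly.span_base) simp
      moreover have "h \<in> mpoly.span (?I \<union> g ` J)"
        unfolding h_def by (intro mpoly.span_sum mpoly.span_scale mpoly.span_base) simp
      ultimately have "(f - h) + h \<in> mpoly.span (?I \<union> g ` J)" by (rule mpoly.span_add)
      then show "f \<in> mpoly.span (?I \<union> g ` J)" by simp
    qed
    with ge show ?thesis using card_image[OF inj] by simp
  qed
  then have "\<forall>\<^sub>F t in sequentially. hilbert_function ?I t = card J"
    unfolding eventually_sequentially by blast
  with hom sat show ?thesis by (simp add: zero_dim_subscheme_ideal_def)
qed

text \<open>The degree is only bounded: a decomposition may contain zero vectors or proportional
  ones, and then its points form a scheme of smaller degree.\<close>

definition has_apolar_scheme :: "nat \<Rightarrow> ('n::finite, 'a::field) mpoly \<Rightarrow> bool" where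
  "has_apolar_scheme m F \<longleftrightarrow> (\<exists>r\<le>m. \<exists>I. zero_dim_subscheme_ideal r I \<and> I \<subseteq> annihilator F)"

lemma has_apolar_schemeI:
  "zero_dim_subscheme_ideal r I \<Longrightarrow> I \<subseteq> annihilator F \<Longrightarrow> has_apolar_scheme r F"
  unfolding has_apolar_scheme_def by blast

lemma has_apolar_scheme_mono: "has_apolar_scheme m F \<Longrightarrow> m \<le> m' \<Longrightarrow> has_apolar_scheme m' F"
  unfolding has_apolar_scheme_def by (meson le_trans)

lemma cactus_rank_eqI:
  assumes "has_apolar_scheme m F"
    and "\<And>r I. zero_dim_subscheme_ideal r I \<Longrightarrow> I \<subseteq> annihilator F \<Longrightarrow> m \<le> r"
  shows "cactus_rank F = m"
proof -
  from assms obtain I where "zero_dim_subscheme_ideal m I" "I \<subseteq> annihilator F"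
    unfolding has_apolar_scheme_def by (metis le_antisym)
  with assms(2) show ?thesis
    unfolding cactus_rank_def by (intro Least_equality) blast+
qed

text \<open>The ideal contains \<open>xpow b * f\<close> and its component of degree
  \<open>m\<close>, while the weights \<open>dp F\<close> are supported in degree \<open>m\<close>;
  so degree \<open>m\<close> decides.\<close>

lemma ideal_subset_annihilatorI:
  fixes F :: "('n::finite, 'a::field_char_0) mpoly"
  assumes I: "homogeneous_ideal I" and F: "form m F"
    and *: "\<And>f. f \<in> I \<Longrightarrow> form m f \<Longrightarrow> pairing (dp F) f = 0"
  shows "I \<subseteq> annihilator F"
proof
  fix f assume "f \<in> I"
  have "pairing (dp F) (xpow b * f) = 0" for b
  proof -
    have "xpow b * f \<in> I"
      using I \<open>f \<in> I\<close> by (auto simp: homogeneous_ideal_def is_idealD)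
    then have "homogeneous_component m (xpow b * f) \<in> I" using I by (auto simp: homogeneous_ideal_def)
    then have "pairing (dp F) (homogeneous_component m (xpow b * f)) = 0" by (rule *) simp
    moreover have "(\<lambda>a. if total_degree a = m then dp F a else 0) = dp F"
      using F by (auto simp: fun_eq_iff dp_def form_iff)
    ultimately show ?thesis by (simp add: pairing_component)
  qed
  then show "f \<in> annihilator F" by (simp add: annihilator_iff)
qed

lemma zero_dim_imp_homogeneous_ideal: "zero_dim_subscheme_ideal r I \<Longrightarrow> homogeneous_ideal I"
  by (simp add: zero_dim_subscheme_ideal_def)

section \<open>Cubic forms as symmetric tensors\<close>

text \<open>The third derivative at the origin. The factorials in \<open>dp\<close> make formulas
  uniform for repeated indices; in particular \<open>lin l ^ 3\<close> has the tensor
  \<open>6 * l x * l y * l z\<close>.\<close>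

definition coef3 :: "('n::finite, 'a::field_char_0) mpoly \<Rightarrow> 'n \<Rightarrow> 'n \<Rightarrow> 'n \<Rightarrow> 'a" where
  "coef3 F x y z = dp F (unit_exp x + unit_exp y + unit_exp z)"

lemma total_degree_3E:
  assumes "total_degree a = 3"
  obtains x y z where "a = unit_exp x + unit_exp y + unit_exp z"
proof -
  from assms have "total_degree a = Suc 2" by simp
  then obtain x b where 1: "a = unit_exp x + b" "total_degree b = 2" by (rule total_degree_Suc_decomp)
  then have "total_degree b = Suc 1" by simp
  then obtain y c where 2: "b = unit_exp y + c" "total_degree c = 1" by (rule total_degree_Suc_decomp)
  then have "total_degree c = Suc 0" by simp
  then obtain z d where 3: "c = unit_exp z + d" "total_degree d = 0" by (rule total_degree_Suc_decomp)
  with 1 2 that[of x y z] show ?thesis by (simp add: add.assoc)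
qed

lemma cubic_eqI:
  assumes "form 3 F" "form 3 G" "\<And>x y z. coef3 F x y z = coef3 G x y z"
  shows "F = G"
proof (rule poly_mapping_eqI)
  fix a show "coef F a = coef G a"
  proof (cases "total_degree a = 3")
    case True
    then obtain x y z where "a = unit_exp x + unit_exp y + unit_exp z" by (rule total_degree_3E)
    with assms(3)[of x y z] show ?thesis by (simp add: coef3_def dp_def)
  next
    case False
    with assms(1,2) have "coef F a = 0" "coef G a = 0" unfolding form_iff by blast+
    then show ?thesis by simp
  qed
qed

lemma pairing_dp_cubic:
  assumes "form 3 f" "\<And>x y z. coef3 F x y z = w (unit_exp x + unit_exp y + unit_exp z)"
  shows "pairing (dp F) f = pairing w f"
proof (rule pairing_cong)
  fix a assume "a \<in> Poly_Mapping.keys f"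
  then have "total_degree a = 3" using assms(1) by (auto simp: form_def)
  then obtain x y z where "a = unit_exp x + unit_exp y + unit_exp z" by (rule total_degree_3E)
  with assms(2)[of x y z] show "dp F a = w a" by (simp add: coef3_def)
qed

lemma coef_Var_mult: "coef (Var k * G) a = (if coef a k = 0 then 0 else coef G (a - unit_exp k))"
  for G :: "('n::finite, 'a::comm_ring_1) mpoly"
proof -
  have eq: "unit_exp k + c = a \<longleftrightarrow> coef a k \<noteq> 0 \<and> c = a - unit_exp k" for c
  proof
    assume "unit_exp k + c = a"
    then show "coef a k \<noteq> 0 \<and> c = a - unit_exp k" by (auto simp: lookup_add)
  next
    assume "coef a k \<noteq> 0 \<and> c = a - unit_exp k"
    then show "unit_exp k + c = a"
      by (intro poly_mapping_eqI) (auto simp: lookup_add lookup_minus lookup_single when_def)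
  qed
  have "Var k * G = (\<Sum>c\<in>Poly_Mapping.keys G. Poly_Mapping.single (unit_exp k + c) (coef G c))"
    unfolding Var_def by (subst mpoly_eq_sum_single[of G]) (simp add: sum_distrib_left mult_single)
  then have "coef (Var k * G) a = (\<Sum>c\<in>Poly_Mapping.keys G. if coef a k \<noteq> 0 \<and> c = a - unit_exp k then coef G c else 0)"
    by (simp add: lookup_sum lookup_single when_def eq[simplified])
  then show ?thesis by (auto simp: in_keys_iff)
qed

lemma partial_deriv_Var_mult:
  fixes G :: "('n::finite, 'a::comm_ring_1) mpoly"
  shows "partial_deriv x (Var k * G) = (if x = k then G else 0) + Var k * partial_deriv x G"
proof (rule poly_mapping_eqI)
  fix a
  show "coef (partial_deriv x (Var k * G)) a = coef ((if x = k then G else 0) + Var k * partial_deriv x G) a"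
  proof (cases "x = k")
    case True
    have "coef a k \<noteq> 0 \<Longrightarrow> a - unit_exp k + unit_exp k = a"
      by (intro poly_mapping_eqI) (auto simp: lookup_add lookup_minus lookup_single when_def)
    with True show ?thesis
      by (auto simp: lookup_partial_deriv coef_Var_mult lookup_add lookup_minus distrib_right)
  next
    case False
    then have "coef a k \<noteq> 0 \<Longrightarrow> a + unit_exp x - unit_exp k = a - unit_exp k + unit_exp x"
      by (intro poly_mapping_eqI) (auto simp: lookup_add lookup_minus lookup_single when_def)
    with False show ?thesis
      by (auto simp: lookup_partial_deriv coef_Var_mult lookup_add lookup_minus lookup_single)
  qed
qed

lemma partial_deriv_add: "partial_deriv x (f + g) = partial_deriv x f + partial_deriv x g"
  for f :: "('n::finite, 'a::comm_ring_1) mpoly"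
  by (rule poly_mapping_eqI) (simp add: lookup_partial_deriv lookup_add algebra_simps)

lemma partial_deriv_zero [simp]: "partial_deriv x 0 = 0"
  by (rule poly_mapping_eqI) (simp add: lookup_partial_deriv)

lemma partial_deriv_scale: "partial_deriv x (scale c f) = scale c (partial_deriv x f)"
  for f :: "('n::finite, 'a::comm_ring_1) mpoly"
  by (rule poly_mapping_eqI) (simp add: lookup_partial_deriv coef_scale algebra_simps)

lemma partial_deriv_sum: "partial_deriv x (sum f A) = (\<Sum>i\<in>A. partial_deriv x (f i))"
  for f :: "'i \<Rightarrow> ('n::finite, 'a::comm_ring_1) mpoly"
  by (induction A rule: infinite_finite_induct) (auto simp: partial_deriv_add)

lemma partial_deriv_lin_mult:
  "partial_deriv x (lin l * G) = scale (l x) G + lin l * partial_deriv x G"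
proof -
  have "partial_deriv x (lin l * G) =
      (\<Sum>k\<in>UNIV. scale (l k) (if x = k then G else 0)) + lin l * partial_deriv x G"
    by (simp add: lin_mult partial_deriv_sum partial_deriv_scale partial_deriv_Var_mult
        mpoly.scale_right_distrib sum.distrib)
  also have "(\<Sum>k\<in>UNIV. scale (l k) (if x = k then G else 0)) = (\<Sum>k\<in>UNIV. if x = k then scale (l k) G else 0)"
    by (intro sum.cong) auto
  finally show ?thesis by simp
qed

lemma coef3_eq_partial_deriv:
  "coef3 F x y z = coef (partial_deriv z (partial_deriv y (partial_deriv x F))) 0"
proof -
  have "coef3 F x y z = dp (partial_deriv z (partial_deriv y (partial_deriv x F))) 0"
    by (simp add: coef3_def dp_partial_deriv add_ac)
  then show ?thesis by (simp add: dp_def)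
qed

lemma partial_deriv_one [simp]: "partial_deriv x 1 = 0"
proof (rule poly_mapping_eqI)
  fix a
  have "coef (a + unit_exp x) x \<noteq> coef 0 x" by (simp add: lookup_add)
  then have "a + unit_exp x \<noteq> 0" by metis
  then show "coef (partial_deriv x 1) a = coef 0 a"
    by (simp add: lookup_partial_deriv lookup_one)
qed

lemma coef_lin_mult_zero: "coef (lin l * G) 0 = 0"
  by (simp add: lin_mult lookup_sum coef_scale coef_Var_mult)

lemma coef3_lin_cube: "coef3 (lin l ^ 3) x y z = 6 * l x * l y * l z"
proof -
  have "lin l ^ 3 = lin l * (lin l * (lin l * 1))" by (simp add: power3_eq_cube mult.assoc)
  then show ?thesis
    by (simp only: coef3_eq_partial_deriv partial_deriv_lin_mult partial_deriv_add partial_deriv_scale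
        partial_deriv_one mult_zero_right mpoly.scale_zero_right lookup_add coef_scale
        coef_lin_mult_zero distrib_left add_0_right add_0_left lookup_one_zero)
       (simp add: algebra_simps)
qed

lemma coef3_add: "coef3 (F + G) x y z = coef3 F x y z + coef3 G x y z"
  by (simp add: coef3_def dp_add)

lemma coef3_sum: "coef3 (sum F A) x y z = (\<Sum>i\<in>A. coef3 (F i) x y z)"
  by (simp add: coef3_def dp_sum)

lemma coef3_scale: "coef3 (scale c F) x y z = c * coef3 F x y z"
  by (simp add: coef3_def dp_scale)

section \<open>Reduced schemes\<close>

definition point_weight :: "('n::finite \<Rightarrow> 'a::field) \<Rightarrow> 'n monomial \<Rightarrow> 'a" where
  "point_weight p a = (\<Prod>k\<in>UNIV. p k ^ coef a k)"

lemma point_weight_zero [simp]: "point_weight p 0 = 1"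
  by (simp add: point_weight_def)

lemma point_weight_add: "point_weight p (a + b) = point_weight p a * point_weight p b"
  by (simp add: point_weight_def lookup_add power_add prod.distrib)

lemma point_weight_unit [simp]: "point_weight p (Poly_Mapping.single k (Suc 0)) = p k"
proof -
  have "point_weight p (unit_exp k) = (\<Prod>j\<in>UNIV. if k = j then p j else 1)"
    unfolding point_weight_def by (intro prod.cong) (auto simp: lookup_single when_def)
  then show ?thesis by simp
qed

lemma pairing_point_mult:
  "pairing (point_weight p) (f * g) = pairing (point_weight p) f * pairing (point_weight p) g"
proof -
  have "f * g = (\<Sum>a\<in>Poly_Mapping.keys f. Poly_Mapping.single a (coef f a) * g)"
    by (subst mpoly_eq_sum_single[of f]) (simp add: sum_distrib_right)
  then show ?thesis
    by (simp add: pairing_sum pairing_single_mult point_weight_add pairing_weight_cmult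
        pairing_def[of _ f] sum_distrib_right mult.assoc)
qed

lemma pairing_point_one [simp]: "pairing (point_weight p) 1 = 1"
  by (simp flip: single_one)

lemma pairing_point_prod:
  "pairing (point_weight p) (prod f A) = (\<Prod>i\<in>A. pairing (point_weight p) (f i))"
  by (induction A rule: infinite_finite_induct) (auto simp: pairing_point_mult)

text \<open>Normalised by \<open>u\<close>, the points lie in one affine chart. Evaluations are
  multiplicative, so their common kernel is an ideal, and the dual polynomials are Lagrange
  interpolation products of linear factors separating \<open>p\<close> from the other
  points.\<close>

lemma zero_dim_points:
  fixes R :: "('n::finite \<Rightarrow> 'a::field) set"
  assumes fin: "finite R" and u: "\<And>p. p \<in> R \<Longrightarrow> (\<Sum>k\<in>UNIV. u k * p k) = 1"
  shows "zero_dim_subscheme_ideal (card R) (scheme_ideal point_weight R)"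
proof (rule zero_dim_scheme_ideal[OF fin])
  show "pairing (point_weight i) (Var k * f) = 0"
    if "\<And>j. j \<in> R \<Longrightarrow> pairing (point_weight j) f = 0" "i \<in> R" for f k i
    using that by (simp add: pairing_point_mult)
  show "(\<Sum>k\<in>UNIV. u k * point_weight i (unit_exp k + a)) = point_weight i a" if "i \<in> R" for i a
    using u[OF that] by (simp add: point_weight_add flip: sum_distrib_right mult.assoc)
  fix p assume p: "p \<in> R"
  have "\<exists>k. p k \<noteq> q k" if "q \<noteq> p" for q using that by auto
  then obtain k where k: "\<And>q. q \<noteq> p \<Longrightarrow> p (k q) \<noteq> q (k q)" by metis
  define f where "f = (\<Prod>q\<in>R - {p}. scale (1 / (p (k q) - q (k q))) (Var (k q) - Const (q (k q))))"
  have f: "pairing (point_weight r) f = (\<Prod>q\<in>R - {p}. (r (k q) - q (k q)) / (p (k q) - q (k q)))" for r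
    by (simp add: f_def pairing_point_prod pairing_scale pairing_diff Var_def Const_def)
  have "pairing (point_weight r) f = (if r = p then 1 else 0)" if r: "r \<in> R" for r
  proof (cases "r = p")
    case True
    then show ?thesis unfolding f using k by (auto intro!: prod.neutral)
  next
    case False
    then have "(\<Prod>q\<in>R - {p}. (r (k q) - q (k q)) / (p (k q) - q (k q))) = 0"
      using r fin by (intro prod_zero) auto
    with False show ?thesis unfolding f by simp
  qed
  then show "\<exists>f. \<forall>j\<in>R. pairing (point_weight j) f = (if j = p then 1 else 0)" by blast
qed

text \<open>The field is infinite, so a functional that fails only at the new vector can be
  perturbed in one coordinate without failing at the old ones.\<close>

lemma exists_functional_nonzero:
  fixes P :: "('n::finite \<Rightarrow> 'a::field_char_0) set"
  assumes "finite P" "\<And>p. p \<in> P \<Longrightarrow> \<exists>k. p k \<noteq> 0"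
  shows "\<exists>u. \<forall>p\<in>P. (\<Sum>k\<in>UNIV. u k * p k) \<noteq> 0"
  using assms
proof (induction P rule: finite_induct)
  case (insert p P)
  then obtain u where u: "\<And>q. q \<in> P \<Longrightarrow> (\<Sum>k\<in>UNIV. u k * q k) \<noteq> 0" by blast
  show ?case
  proof (cases "(\<Sum>k\<in>UNIV. u k * p k) = 0")
    case False
    with u show ?thesis by blast
  next
    case True
    obtain k where k: "p k \<noteq> 0" using insert.prems by blast
    \<comment> \<open>Excluding 0 makes the new value at \<open>p\<close> nonzero. Where
      \<open>q k = 0\<close> the quotient has the default value 0; the value at such
      \<open>q\<close> is unaffected by the perturbation.\<close>
    have "finite (insert 0 ((\<lambda>q. - (\<Sum>k\<in>UNIV. u k * q k) / q k) ` P))" using insert.hyps by simp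
    then obtain s where s: "s \<notin> insert 0 ((\<lambda>q. - (\<Sum>k\<in>UNIV. u k * q k) / q k) ` P)"
      using ex_new_if_finite[OF infinite_UNIV_char_0] by blast
    define v where "v j = u j + (if j = k then s else 0)" for j
    have v: "(\<Sum>j\<in>UNIV. v j * q j) = (\<Sum>j\<in>UNIV. u j * q j) + s * q k" for q
    proof -
      have "(\<Sum>j\<in>UNIV. v j * q j) = (\<Sum>j\<in>UNIV. u j * q j + (if j = k then s * q j else 0))"
        by (intro sum.cong) (auto simp: v_def algebra_simps)
      then show ?thesis by (simp add: sum.distrib)
    qed
    have "(\<Sum>j\<in>UNIV. v j * q j) \<noteq> 0" if q: "q \<in> insert p P" for q
    proof (cases "q = p")
      case True
      then show ?thesis unfolding v using \<open>(\<Sum>k\<in>UNIV. u k * p k) = 0\<close> k s by simp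
    next
      case False
      then have q: "q \<in> P" using q by simp
      show ?thesis
      proof
        assume "(\<Sum>j\<in>UNIV. v j * q j) = 0"
        then have *: "s * q k = - (\<Sum>j\<in>UNIV. u j * q j)"
          unfolding v by (metis add.commute eq_neg_iff_add_eq_0)
        with u[OF q] have "q k \<noteq> 0" by auto
        with * have "s = - (\<Sum>j\<in>UNIV. u j * q j) / q k" by (simp add: field_simps)
        with s q show False by blast
      qed
    qed
    then show ?thesis by blast
  qed
qed simp

text \<open>The easy direction of the apolarity lemma: a cubic form vanishing at all the points
  pairs to zero with F. The coefficients \<open>c i\<close> are arbitrary, so no cube roots are
  extracted. Zero vectors are dropped and the others scaled into a common chart.\<close>

lemma has_apolar_scheme_decomposition:
  fixes F :: "('n::finite, 'a::field_char_0) mpoly"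
  assumes F: "form 3 F" and fin: "finite A"
    and dec: "\<And>x y z. coef3 F x y z = (\<Sum>i\<in>A. c i * (p i x * p i y * p i z))"
  shows "has_apolar_scheme (card A) F"
proof -
  define B where "B = {i\<in>A. \<exists>k. p i k \<noteq> 0}"
  have finB: "finite B" using fin by (simp add: B_def)
  have "\<exists>u. \<forall>q\<in>p ` B. (\<Sum>k\<in>UNIV. u k * q k) \<noteq> 0"
    by (rule exists_functional_nonzero) (use finB in \<open>auto simp: B_def\<close>)
  then obtain u where u: "\<And>i. i \<in> B \<Longrightarrow> (\<Sum>k\<in>UNIV. u k * p i k) \<noteq> 0" by blast
  define s where "s i = (\<Sum>k\<in>UNIV. u k * p i k)" for i
  define q where "q i k = p i k / s i" for i k
  define R where "R = q ` B"
  have "finite R" using finB by (simp add: R_def)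
  moreover have "(\<Sum>k\<in>UNIV. u k * r k) = 1" if "r \<in> R" for r
  proof -
    from that obtain i where i: "i \<in> B" "r = q i" by (auto simp: R_def)
    have "s i \<noteq> 0" using u[OF i(1)] by (simp add: s_def)
    moreover have "(\<Sum>k\<in>UNIV. u k * q i k) = (\<Sum>k\<in>UNIV. u k * p i k) / s i"
      by (simp add: q_def sum_divide_distrib)
    ultimately show ?thesis using i by (simp add: s_def)
  qed
  ultimately have Z: "zero_dim_subscheme_ideal (card R) (scheme_ideal point_weight R)"
    by (rule zero_dim_points)
  have "scheme_ideal point_weight R \<subseteq> annihilator F"
  proof (rule ideal_subset_annihilatorI[OF zero_dim_imp_homogeneous_ideal[OF Z] F])
    fix f assume f: "f \<in> scheme_ideal point_weight R" "form 3 f"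
    have R0: "pairing (point_weight r) f = 0" if "r \<in> R" for r
      using f that by (auto simp: scheme_ideal_def homogeneous_component_form dest!: spec[of _ 3])
    have "pairing (dp F) f = pairing (\<lambda>a. \<Sum>i\<in>A. c i * point_weight (p i) a) f"
      by (rule pairing_dp_cubic[OF f(2)]) (simp add: dec point_weight_add)
    also have "\<dots> = (\<Sum>i\<in>A. c i * pairing (point_weight (p i)) f)"
      by (rule pairing_weight_sum)
    also have "\<dots> = 0"
    proof (intro sum.neutral ballI)
      fix i assume i: "i \<in> A"
      have cube: "pairing (point_weight (p i)) f = t ^ 3 * pairing (point_weight r) f"
        if "\<And>k. p i k = t * r k" for t r
      proof -
        have "pairing (point_weight (p i)) f = pairing (\<lambda>a. t ^ 3 * point_weight r a) f"
        proof (rule pairing_cong)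
          fix a assume "a \<in> Poly_Mapping.keys f"
          then have "total_degree a = 3" using f(2) by (auto simp: form_def)
          then show "point_weight (p i) a = t ^ 3 * point_weight r a"
            by (simp add: point_weight_def that power_mult_distrib prod.distrib total_degree_def
                flip: power_sum)
        qed
        then show ?thesis by (simp add: pairing_weight_cmult)
      qed
      show "c i * pairing (point_weight (p i)) f = 0"
      proof (cases "i \<in> B")
        case True
        have "pairing (point_weight (p i)) f = s i ^ 3 * pairing (point_weight (q i)) f"
          by (rule cube) (use u[OF True] in \<open>simp add: q_def s_def\<close>)
        with R0[of "q i"] True show ?thesis by (simp add: R_def)
      next
        case False
        then show ?thesis using cube[of 0 "\<lambda>_. 0"] i by (simp add: B_def)
      qed
    qed
    finally show "pairing (dp F) f = 0" .
  qed
  with Z have R: "has_apolar_scheme (card R) F" by (rule has_apolar_schemeI)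
  have "card R \<le> card B" unfolding R_def using finB by (rule card_image_le)
  also have "\<dots> \<le> card A" unfolding B_def using fin by (intro card_mono) auto
  finally show ?thesis using R has_apolar_scheme_mono by blast
qed

section \<open>Lower bounds for the cactus rank\<close>

text \<open>For a cubic F and a quadric \<open>q\<close> this is the coefficient at X_k of the
  linear form obtained by letting \<open>q\<close> act on F; as a map on quadrics it is the
  catalecticant.\<close>

definition polar :: "('n::finite, 'a::field_char_0) mpoly \<Rightarrow> ('n, 'a) mpoly \<Rightarrow> 'n \<Rightarrow> 'a" where
  "polar F q k = pairing (dp F) (Var k * q)"

lemma Const_diff: "Const (a - b) = Const a - Const b"
  by (simp add: Const_def single_diff)

lemma Const_uminus: "Const (- a) = - Const a"
  by (simp add: Const_def single_uminus)

lemma Const_zero [simp]: "Const 0 = 0"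
  by (simp add: Const_def)

lemma polar_scale: "polar F (scale c q) k = c * polar F q k"
proof -
  have "Var k * scale c q = scale c (Var k * q)" by (simp add: scale_def mult_ac)
  then show ?thesis by (simp add: polar_def pairing_scale)
qed

lemma polar_diff: "polar F (p - q) k = polar F p k - polar F q k"
  by (simp add: polar_def right_diff_distrib pairing_diff)

lemma polar_sum: "polar F (sum q A) k = (\<Sum>i\<in>A. polar F (q i) k)"
  by (simp add: polar_def sum_distrib_left pairing_sum)

lemma polar_annihilator: "q \<in> annihilator F \<Longrightarrow> polar F q k = 0"
  by (auto simp: annihilator_iff polar_def Var_def)

text \<open>As \<open>I\<close> annihilates F, polars depend only on classes modulo
  \<open>I\<close>. Quadrics with independent polars are therefore independent modulo
  \<open>I\<close>, and the Hilbert function in degree 2 bounds their number. In the case of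
  equality they form a basis of the quotient, on which the catalecticant is then injective, so its
  kernel lies in \<open>I\<close>.\<close>

lemma cactus_scheme_quadrics:
  fixes F :: "('n::finite, 'a::field_char_0) mpoly"
  assumes Z: "zero_dim_subscheme_ideal r I" and sub: "I \<subseteq> annihilator F"
    and fin: "finite J" and Q: "\<And>i. i \<in> J \<Longrightarrow> form 2 (Q i)"
    and independent: "\<forall>c. (\<forall>k. (\<Sum>i\<in>J. c i * polar F (Q i) k) = 0) \<longrightarrow> (\<forall>i\<in>J. c i = 0)"
  shows "card J \<le> r"
    and "card J = r \<Longrightarrow> form 2 q \<Longrightarrow> (\<And>k. polar F q k = 0) \<Longrightarrow> q \<in> I"
proof -
  have I: "is_ideal I"
    using Z by (auto simp: zero_dim_subscheme_ideal_def homogeneous_ideal_def)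
  have ind: "c i = 0" if "\<And>k. (\<Sum>i\<in>J. c i * polar F (Q i) k) = 0" "i \<in> J" for c i
    using independent that by blast
  have polar0: "polar F p k = 0" if "p \<in> I" for p k
    using that sub polar_annihilator by blast
  have inj: "inj_on Q J"
  proof (rule inj_onI, rule ccontr)
    fix i j assume ij: "i \<in> J" "j \<in> J" "Q i = Q j" "i \<noteq> j"
    define c :: "_ \<Rightarrow> 'a" where "c l = (if l = i then 1 else if l = j then - 1 else 0)" for l
    have "(\<Sum>l\<in>J. c l * polar F (Q l) k) = (\<Sum>l\<in>{i, j}. c l * polar F (Q l) k)" for k
      using fin ij by (intro sum.mono_neutral_right) (auto simp: c_def)
    then have "(\<Sum>l\<in>J. c l * polar F (Q l) k) = 0" for k
      using ij by (simp add: c_def)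
    then have "c i = 0" by (rule ind) (use ij in simp)
    then show False by (simp add: c_def)
  qed
  have ind': "c i = 0" if "(\<Sum>i\<in>J. scale (c i) (Q i)) \<in> I" "i \<in> J" for c i
  proof (rule ind[OF _ that(2)])
    fix k
    have "polar F (\<Sum>i\<in>J. scale (c i) (Q i)) k = 0" using that(1) by (rule polar0)
    then show "(\<Sum>i\<in>J. c i * polar F (Q i) k) = 0" by (simp add: polar_sum polar_scale)
  qed
  have D: "indep_at I 2 (Q ` J)"
    unfolding indep_at_def
  proof (intro conjI allI impI)
    show "finite (Q ` J)" "\<forall>d\<in>Q ` J. form 2 d" using fin Q by auto
    fix c assume "(\<Sum>d\<in>Q ` J. scale (c d) d) \<in> I"
    then show "\<forall>d\<in>Q ` J. c d = 0"
      using ind'[of "\<lambda>i. c (Q i)"] by (auto simp: sum.reindex[OF inj])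
  qed
  have card: "card (Q ` J) = card J" using inj by (rule card_image)
  show "card J \<le> r"
    using card_le_hilbert_function[OF I D] hilbert_function_le_degree[OF Z, of 2] card by simp
  assume r: "card J = r" and q: "form 2 q" "\<And>k. polar F q k = 0"
  have "hilbert_function I 2 \<le> card (Q ` J)"
    using hilbert_function_le_degree[OF Z] r card by simp
  then obtain c where "q - (\<Sum>d\<in>Q ` J. scale (c d) d) \<in> I"
    using spanning_at[OF I D _ q(1)] by blast
  then have c: "q - (\<Sum>i\<in>J. scale (c (Q i)) (Q i)) \<in> I" by (simp add: sum.reindex[OF inj])
  have "c (Q i) = 0" if "i \<in> J" for i
  proof (rule ind[OF _ that])
    fix k
    show "(\<Sum>i\<in>J. c (Q i) * polar F (Q i) k) = 0"
      using polar0[OF c, of k] q(2) by (simp add: polar_diff polar_sum polar_scale)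
  qed
  with c show "q \<in> I" by simp
qed

section \<open>Degree bounds from relations between products of linear forms\<close>

lemma form_Suc_in_subspace_span:
  fixes V :: "('n::finite, 'a::field) mpoly set"
  assumes V: "mpoly.subspace V" and W: "\<And>k. Var k \<in> mpoly.span W"
    and wg: "\<And>w g. w \<in> W \<Longrightarrow> form d g \<Longrightarrow> w * g \<in> V" and f: "form (Suc d) f"
  shows "f \<in> V"
proof (rule form_Suc_in_subspace[OF V _ f])
  fix i and g :: "('n, 'a) mpoly" assume g: "form d g"
  have "mpoly.subspace {x. x * g \<in> V}"
    using V by (auto simp: mpoly.subspace_def distrib_right scale_def mult.assoc)
  then have "mpoly.span W \<subseteq> {x. x * g \<in> V}"
    using wg[OF _ g] by (intro mpoly.span_minimal) auto
  with W show "Var i * g \<in> V" by blast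
qed

lemma cubic_in_subspace:
  fixes V :: "('n::finite, 'a::field) mpoly set"
  assumes V: "mpoly.subspace V" and W: "\<And>k. Var k \<in> mpoly.span W"
    and www: "\<And>v w x. v \<in> W \<Longrightarrow> w \<in> W \<Longrightarrow> x \<in> W \<Longrightarrow> v * w * x \<in> V" and f: "form 3 f"
  shows "f \<in> V"
proof -
  have sub: "mpoly.subspace {x. y * x \<in> V}" for y
    using V by (auto simp: mpoly.subspace_def distrib_left scale_def mult.left_commute[of y])
  have 1: "v * w * g \<in> V" if "v \<in> W" "w \<in> W" "form (Suc 0) g" for v w g
  proof -
    have "g \<in> {x. v * w * x \<in> V}"
    proof (rule form_Suc_in_subspace_span[OF sub W _ that(3)])
      fix x h assume x: "x \<in> W" and h: "form 0 (h :: ('n, 'a) mpoly)"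
      have "v * w * (x * h) = scale (coef h 0) (v * w * x)"
        by (subst form_0_eq[OF h]) (simp add: scale_def mult_ac)
      then show "x * h \<in> {x. v * w * x \<in> V}"
        using www that x mpoly.subspace_scale[OF V] by simp
    qed
    then show ?thesis by simp
  qed
  have 2: "v * g \<in> V" if "v \<in> W" "form (Suc (Suc 0)) g" for v g
    using form_Suc_in_subspace_span[OF sub W _ that(2), of v] 1[OF that(1)]
    by (simp add: mult.assoc)
  show ?thesis
    using form_Suc_in_subspace_span[OF V W _ , of "Suc (Suc 0)" f] 2 f
    by (simp add: numeral_3_eq_3)
qed

text \<open>Multiplying up from the triple products of \<open>W\<close> shows that
  \<open>U t\<close> spans the quotient in every degree \<open>t >= 3\<close>, and in large degree
  the dimension of the quotient is \<open>r\<close>.\<close>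

lemma degree_le_card_generators:
  fixes I :: "('n::finite, 'a::field) mpoly set"
  assumes Z: "zero_dim_subscheme_ideal r I" and W: "\<And>k. Var k \<in> mpoly.span W"
    and U: "\<And>t. finite (U t)" "\<And>t e. e \<in> U t \<Longrightarrow> form t e" "\<And>t. card (U t) \<le> m"
    and www: "\<And>v w x. v \<in> W \<Longrightarrow> w \<in> W \<Longrightarrow> x \<in> W \<Longrightarrow> v * w * x \<in> mpoly.span (I \<union> U 3)"
    and step: "\<And>t w e. 3 \<le> t \<Longrightarrow> w \<in> W \<Longrightarrow> e \<in> U t \<Longrightarrow> w * e \<in> mpoly.span (I \<union> U (Suc t))"
  shows "r \<le> m"
proof -
  from Z have I: "is_ideal I" and ev: "\<forall>\<^sub>F t in sequentially. hilbert_function I t = r"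
    by (auto simp: zero_dim_subscheme_ideal_def homogeneous_ideal_def)
  have all: "f \<in> mpoly.span (I \<union> U t)" if "3 \<le> t" "form t f" for t f
    using that
  proof (induction t arbitrary: f rule: dec_induct)
    case base
    show ?case by (rule cubic_in_subspace[OF mpoly.subspace_span W www base])
  next
    case (step t)
    show ?case
    proof (rule form_Suc_in_subspace_span[OF mpoly.subspace_span W _ step.prems])
      fix w and g :: "('n, 'a) mpoly" assume w: "w \<in> W" and "form t g"
      then have g: "g \<in> mpoly.span (I \<union> U t)" using step by blast
      have "mpoly.subspace {x. w * x \<in> mpoly.span (I \<union> U (Suc t))}"
        using mpoly.subspace_span[of "I \<union> U (Suc t)"]
        by (auto simp: mpoly.subspace_def distrib_left scale_def mult.left_commute[of w])
      moreover have "w * x \<in> mpoly.span (I \<union> U (Suc t))" if "x \<in> I \<union> U t" for x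
      proof (cases "x \<in> I")
        case True
        then show ?thesis using is_idealD(3)[OF I] by (intro mpoly.span_base) simp
      next
        case False
        then show ?thesis using that assms(7)[OF step.hyps(1) w] by blast
      qed
      ultimately have "mpoly.span (I \<union> U t) \<subseteq> {x. w * x \<in> mpoly.span (I \<union> U (Suc t))}"
        by (intro mpoly.span_minimal) auto
      with g show "w * g \<in> mpoly.span (I \<union> U (Suc t))" by blast
    qed
  qed
  obtain T where "\<And>t. t \<ge> T \<Longrightarrow> hilbert_function I t = r"
    using ev by (auto simp: eventually_sequentially)
  from this[of "T + 3"] have "r = hilbert_function I (T + 3)" by simp
  also have "\<dots> \<le> card (U (T + 3))"
    using U(1,2) all by (intro hilbert_function_le_card[OF I]) auto
  finally show ?thesis using U(3)[of "T + 3"] by simp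
qed

lemma span_ideal_congI:
  assumes "f - scale c e \<in> I" "e \<in> U"
  shows "f \<in> mpoly.span (I \<union> U)"
proof -
  have "(f - scale c e) + scale c e \<in> mpoly.span (I \<union> U)"
    using assms by (intro mpoly.span_add mpoly.span_scale mpoly.span_base) auto
  then show ?thesis by simp
qed

text \<open>All products of two \<open>w i\<close> with distinct indices agree modulo
  \<open>I\<close>. With three indices available, triple products can be regrouped, so all of them
  except the pure cubes agree with one element \<open>y\<close>; the relation for the sum of squares
  makes the cubes multiples of \<open>y\<close>. Since \<open>w0\<close> kills every
  \<open>w i\<close>, only \<open>y * w a ^ (t - 3)\<close> and \<open>w0 ^ t\<close> survive in
  degree \<open>t\<close>.\<close>

lemma fermat_relations_degree_le:
  fixes I :: "('n::finite, 'a::field) mpoly set" and w :: "'n \<Rightarrow> ('n, 'a) mpoly"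
  assumes Z: "zero_dim_subscheme_ideal r I" and A: "3 \<le> card A"
    and wf: "\<And>i. form (Suc 0) (w i)" and w0: "form (Suc 0) w0"
    and span: "\<And>k. Var k \<in> mpoly.span (insert w0 (w ` A))"
    and rel1: "\<And>i j k l. i \<in> A \<Longrightarrow> j \<in> A \<Longrightarrow> k \<in> A \<Longrightarrow> l \<in> A \<Longrightarrow> i \<noteq> j \<Longrightarrow> k \<noteq> l \<Longrightarrow>
      w i * w j - w k * w l \<in> I"
    and rel2: "\<And>k l. k \<in> A \<Longrightarrow> l \<in> A \<Longrightarrow> k \<noteq> l \<Longrightarrow>
      (\<Sum>j\<in>A. w j * w j) - scale \<kappa> (w k * w l) \<in> I"
    and rel0: "\<And>i. i \<in> A \<Longrightarrow> w0 * w i \<in> I"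
  shows "r \<le> 2"
proof -
  have I: "is_ideal I"
    using Z by (auto simp: zero_dim_subscheme_ideal_def homogeneous_ideal_def)
  have fin: "finite A" using A by (simp add: card_ge_0_finite)
  note D = is_idealD[OF I]
  have third: "\<exists>l\<in>A. l \<noteq> i \<and> l \<noteq> j" for i j
  proof (rule ccontr)
    assume "\<not> ?thesis"
    then have "A \<subseteq> {i, j}" by blast
    then have "card A \<le> card {i, j}" by (rule card_mono[rotated]) simp
    also have "\<dots> \<le> 2" by (simp add: card_insert_if)
    finally show False using A by simp
  qed
  obtain a where a: "a \<in> A" using third by blast
  obtain b where b: "b \<in> A" "b \<noteq> a" using third by blast
  define e where "e = w a * w b"
  define y where "y = e * w a"
  have E: "w i * w j - e \<in> I" if "i \<in> A" "j \<in> A" "i \<noteq> j" for i j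
    unfolding e_def using rel1 that a b by blast
  \<comment> \<open>For \<open>k \<noteq> a\<close> the product of \<open>w a\<close>,
    \<open>w l\<close> and \<open>w k\<close> is congruent both to \<open>e * w a\<close> and to
    \<open>e * w k\<close>.\<close>
  have Y: "e * w k - y \<in> I" if k: "k \<in> A" for k
  proof (cases "k = a")
    case True
    then show ?thesis by (simp add: y_def D)
  next
    case False
    obtain l where l: "l \<in> A" "l \<noteq> k" "l \<noteq> a" using third by blast
    have "w k * (w a * w l - e) \<in> I" "w a * (w l * w k - e) \<in> I"
      using E[of a l] E[of l k] a k l by (auto intro: D(3))
    then have "w a * (w l * w k - e) - w k * (w a * w l - e) \<in> I" using D(6) by blast
    also have "w a * (w l * w k - e) - w k * (w a * w l - e) = e * w k - y"
      by (simp add: y_def algebra_simps)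
    finally show ?thesis .
  qed
  have W3: "w i * w j * w k - y \<in> I" if "i \<in> A" "j \<in> A" "k \<in> A" "i \<noteq> j" for i j k
  proof -
    have "w k * (w i * w j - e) + (e * w k - y) \<in> I"
      using E[of i j] Y[of k] that by (intro D(2) D(3)) auto
    also have "w k * (w i * w j - e) + (e * w k - y) = w i * w j * w k - y"
      by (simp add: algebra_simps)
    finally show ?thesis .
  qed
  have W3': "\<exists>c. w i * w i * w i - scale c y \<in> I" if i: "i \<in> A" for i
  proof -
    obtain l where l: "l \<in> A" "l \<noteq> i" using third by blast
    have 1: "w i * ((\<Sum>j\<in>A. w j * w j) - scale \<kappa> (w i * w l)) \<in> I"
      using rel2 i l by (intro D(3)) auto
    have 2: "scale \<kappa> (w i * w l * w i - y) \<in> I"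
      unfolding scale_def using W3 i l by (intro D(3)) auto
    have 3: "(\<Sum>j\<in>A - {i}. w i * w j * w j - y) \<in> I"
      using W3 i by (intro is_ideal_sum[OF I]) auto
    have "w i * ((\<Sum>j\<in>A. w j * w j) - scale \<kappa> (w i * w l)) + scale \<kappa> (w i * w l * w i - y)
        - (\<Sum>j\<in>A - {i}. w i * w j * w j - y) \<in> I"
      by (rule D(6)[OF D(2)[OF 1 2] 3])
    also have "w i * ((\<Sum>j\<in>A. w j * w j) - scale \<kappa> (w i * w l)) + scale \<kappa> (w i * w l * w i - y)
        - (\<Sum>j\<in>A - {i}. w i * w j * w j - y) =
        w i * w i * w i - scale (\<kappa> - of_nat (card (A - {i}))) y"
    proof -
      have "(\<Sum>j\<in>A. w j * w j) = w i * w i + (\<Sum>j\<in>A - {i}. w j * w j)"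
        using fin i by (rule sum.remove)
      moreover have "scale (of_nat (card (A - {i}))) y = of_nat (card (A - {i})) * y"
        by (simp add: scale_def Const_def single_of_nat)
      ultimately show ?thesis
        by (simp add: sum_subtractf sum_distrib_left Const_diff scale_def algebra_simps)
    qed
    finally show ?thesis by blast
  qed
  define U where "U t = {y * w a ^ (t - 3), w0 ^ t}" for t :: nat
  have yform: "form 3 y"
    unfolding y_def e_def using form_mult[OF form_mult[OF wf wf] wf] by (simp add: numeral_3_eq_3)
  \<comment> \<open>\<open>U t\<close> consists of forms of degree \<open>t\<close> only from 3 on;
    below, the truncated exponent would leave \<open>y\<close>, which has degree 3.\<close>
  define U' where "U' t = (if t < 3 then {} else U t)" for t
  show ?thesis
  proof (rule degree_le_card_generators[OF Z span, where U = U' and m = 2])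
    show "finite (U' t)" for t by (simp add: U'_def U_def)
    show "card (U' t) \<le> 2" for t by (simp add: U'_def U_def card_insert_if)
    show "form t f" if f: "f \<in> U' t" for t f
    proof -
      from f have t: "3 \<le> t" by (auto simp: U'_def split: if_splits)
      have "form (3 + (t - 3)) (y * w a ^ (t - 3))"
        using form_mult[OF yform form_power[OF wf, of "t - 3"]] by simp
      moreover have "form t (w0 ^ t)" using form_power[OF w0, of t] by simp
      ultimately show ?thesis using f t by (auto simp: U'_def U_def split: if_splits)
    qed
    show "v * x * z \<in> mpoly.span (I \<union> U' 3)"
      if vxz: "v \<in> insert w0 (w ` A)" "x \<in> insert w0 (w ` A)" "z \<in> insert w0 (w ` A)" for v x z
    proof -
      let ?S = "mpoly.span (I \<union> U' 3)"
      have U3: "U' 3 = {y, w0 ^ 3}" by (simp add: U'_def U_def)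
      have w0w: "w0 * w i * f \<in> ?S" if "i \<in> A" for i f
        using D(4)[OF rel0[OF that]] by (intro mpoly.span_base) simp
      have mixed: "w0 * f * w i \<in> ?S" "w i * w0 * f \<in> ?S" "w i * f * w0 \<in> ?S" "f * w0 * w i \<in> ?S"
        if "i \<in> A" for i f
        using w0w[OF that, of f] by (simp_all add: mult_ac)
      have www: "w i * w j * w k \<in> ?S" if ijk: "i \<in> A" "j \<in> A" "k \<in> A" for i j k
      proof -
        have y: "f - y \<in> I \<Longrightarrow> f \<in> ?S" for f using span_ideal_congI[of f 1 y I "U' 3"] by (simp add: U3)
        consider "i \<noteq> j" | "j \<noteq> k" | "i = j" "j = k" by blast
        then show ?thesis
        proof cases
          case 1
          then show ?thesis using y W3 ijk by blast
        next
          case 2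
          then have "w j * w k * w i \<in> ?S" using y W3 ijk by blast
          then show ?thesis by (simp add: mult_ac)
        next
          case 3
          then show ?thesis using W3'[OF ijk(1)] span_ideal_congI[of _ _ y I "U' 3"] by (auto simp: U3)
        qed
      qed
      have w000: "w0 * w0 * w0 \<in> ?S" by (intro mpoly.span_base) (simp add: U3 power3_eq_cube)
      from vxz have "v = w0 \<or> (\<exists>i\<in>A. v = w i)" "x = w0 \<or> (\<exists>i\<in>A. x = w i)" "z = w0 \<or> (\<exists>i\<in>A. z = w i)"
        by auto
      then show ?thesis
        by (elim disjE bexE) (simp_all add: www w000 w0w mixed)
    qed
    show "v * f \<in> mpoly.span (I \<union> U' (Suc t))"
      if t: "3 \<le> t" and v: "v \<in> insert w0 (w ` A)" and f: "f \<in> U' t" for t v f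
    proof -
      have mem: "g \<in> I \<Longrightarrow> g \<in> mpoly.span (I \<union> U' (Suc t))" for g by (rule mpoly.span_base) simp
      have US: "U' (Suc t) = {y * w a ^ (t - 2), w0 ^ Suc t}" using t by (simp add: U'_def U_def)
      have Suc: "t - 2 = Suc (t - 3)" using t by simp
      from f t consider "f = y * w a ^ (t - 3)" | "f = w0 ^ t" by (auto simp: U'_def U_def)
      then show ?thesis
      proof cases
        case f: 1
        show ?thesis
        proof (cases "v = w0")
          case True
          have "w0 * w a * (e * w a ^ (t - 3)) \<in> I" using rel0[OF a] by (rule D(4))
          then show ?thesis using True f by (intro mem) (simp add: y_def mult_ac)
        next
          case False
          with v obtain i where i: "i \<in> A" "v = w i" by blast
          have "(w a * w a ^ (t - 3)) * (e * w i - y) \<in> I" using Y[OF i(1)] by (rule D(3))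
          also have "(w a * w a ^ (t - 3)) * (e * w i - y) = v * f - scale 1 (y * w a ^ (t - 2))"
            by (simp add: Suc i f y_def algebra_simps)
          finally show ?thesis by (rule span_ideal_congI) (simp add: US)
        qed
      next
        case f: 2
        show ?thesis
        proof (cases "v = w0")
          case True
          with f show ?thesis by (intro mpoly.span_base) (simp add: US)
        next
          case False
          with v obtain i where i: "i \<in> A" "v = w i" by blast
          have "w0 * w i * w0 ^ (t - 1) \<in> I" using rel0[OF i(1)] by (rule D(4))
          also have "w0 * w i * w0 ^ (t - 1) = w i * (w0 * w0 ^ (t - 1))" by (simp add: mult_ac)
          also have "w0 * w0 ^ (t - 1) = w0 ^ t" using t by (cases t) simp_all
          finally show ?thesis using i f by (intro mem) simp
        qed
      qed
    qed
  qed
qed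

text \<open>Grouping \<open>w i * w i * w k\<close> in two ways relates \<open>E * w k\<close> to
  \<open>E * w i\<close>. With the roles of \<open>i\<close> and \<open>k\<close> exchanged this is
  a linear system of determinant (n - 2) / n, so \<open>E\<close> kills every \<open>w i\<close>,
  and in degree \<open>t >= 3\<close> only \<open>E * s ^ (t - 2)\<close> survives.\<close>

lemma line_quadric_relations_degree_le:
  fixes I :: "('n::finite, 'a::field_char_0) mpoly set" and w :: "'n \<Rightarrow> ('n, 'a) mpoly"
  assumes Z: "zero_dim_subscheme_ideal r I" and n: "3 \<le> CARD('n)"
    and sf: "form (Suc 0) s" and Ef: "form 2 E"
    and span: "\<And>k. Var k \<in> mpoly.span (insert s (range w))"
    and rel1: "\<And>i j. w i * w j - scale ((if i = j then 1 else 0) - 1 / of_nat CARD('n)) E \<in> I"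
    and rel2: "s * s - scale \<kappa> E \<in> I"
  shows "r \<le> 1"
proof -
  have I: "is_ideal I"
    using Z by (auto simp: zero_dim_subscheme_ideal_def homogeneous_ideal_def)
  note D = is_idealD[OF I]
  let ?n = "of_nat CARD('n) :: 'a"
  have n0: "?n \<noteq> 0" by simp
  have scaleI: "scale c f \<in> I" if "f \<in> I" for c f
    unfolding scale_def using that by (rule D(3))
  have X: "scale (1 - 1 / ?n) (E * w k) + scale (1 / ?n) (E * w i) \<in> I" if "i \<noteq> k" for i k
  proof -
    have "w i * w k - scale (0 - 1 / ?n) E \<in> I" "w i * w i - scale (1 - 1 / ?n) E \<in> I"
      using rel1[of i k] rel1[of i i] that by simp_all
    then have "w i * (w i * w k - scale (0 - 1 / ?n) E) - w k * (w i * w i - scale (1 - 1 / ?n) E) \<in> I"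
      by (rule D(6)[OF D(3) D(3)])
    also have "w i * (w i * w k - scale (0 - 1 / ?n) E) - w k * (w i * w i - scale (1 - 1 / ?n) E) =
        scale (1 - 1 / ?n) (E * w k) + scale (1 / ?n) (E * w i)"
      by (simp add: scale_def Const_diff Const_uminus algebra_simps)
    finally show ?thesis .
  qed
  have EW: "E * w k \<in> I" for k
  proof -
    have "\<not> (UNIV :: 'n set) \<subseteq> {k}"
      using n card_mono[of "{k}" "UNIV :: 'n set"] by auto
    then obtain i where i: "i \<noteq> k" by blast
    have comb: "scale c (scale c x + scale d z) - scale d (scale c z + scale d x) = scale (c * c - d * d) x"
      for c d and x z :: "('n, 'a) mpoly"
      by (simp add: mpoly.scale_right_distrib mpoly.scale_left_diff_distrib mult.commute)
    have "scale (1 - 1 / ?n) (scale (1 - 1 / ?n) (E * w k) + scale (1 / ?n) (E * w i))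
        - scale (1 / ?n) (scale (1 - 1 / ?n) (E * w i) + scale (1 / ?n) (E * w k)) \<in> I"
      using X[OF i] X[OF i[symmetric]] by (intro D(6) scaleI)
    also have "scale (1 - 1 / ?n) (scale (1 - 1 / ?n) (E * w k) + scale (1 / ?n) (E * w i))
        - scale (1 / ?n) (scale (1 - 1 / ?n) (E * w i) + scale (1 / ?n) (E * w k)) =
        scale ((1 - 1 / ?n) * (1 - 1 / ?n) - 1 / ?n * (1 / ?n)) (E * w k)"
      by (rule comb)
    also have "(1 - 1 / ?n) * (1 - 1 / ?n) - 1 / ?n * (1 / ?n) = (?n - 2) / ?n"
      using n0 by (simp add: field_simps)
    finally have "scale (?n / (?n - 2)) (scale ((?n - 2) / ?n) (E * w k)) \<in> I"
      by (rule scaleI)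
    moreover have "?n - 2 \<noteq> 0"
    proof
      assume "?n - 2 = 0"
      then have "?n = of_nat 2" by simp
      then have "CARD('n) = 2" unfolding of_nat_eq_iff .
      with n show False by simp
    qed
    ultimately show ?thesis using n0 by simp
  qed
  have ww: "w i * w j * f \<in> I" if "E * f \<in> I" for i j f
  proof -
    have "f * (w i * w j - scale ((if i = j then 1 else 0) - 1 / ?n) E)
        + scale ((if i = j then 1 else 0) - 1 / ?n) (E * f) \<in> I"
      by (rule D(2)[OF D(3)[OF rel1] scaleI[OF that]])
    then show ?thesis by (simp add: scale_def algebra_simps)
  qed
  define U where "U t = (if t < 2 then {} else {E * s ^ (t - 2)})" for t :: nat
  have U3: "U 3 = {E * s}" by (simp add: U_def)
  have mem: "f \<in> I \<Longrightarrow> f \<in> mpoly.span (I \<union> U t)" for f t by (rule mpoly.span_base) simp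
  have ssf: "s * s * f - scale \<kappa> (E * f) \<in> I" for f
  proof -
    have "f * (s * s - scale \<kappa> E) \<in> I" using rel2 by (rule D(3))
    then show ?thesis by (simp add: scale_def algebra_simps)
  qed
  have "s * s * w i \<in> I" for i
  proof -
    have "s * s * w i - scale \<kappa> (E * w i) + scale \<kappa> (E * w i) \<in> I"
      using ssf EW by (intro D(2) scaleI)
    then show ?thesis by simp
  qed
  note ssw = this
  have sww: "s * w i * w j \<in> mpoly.span (I \<union> U 3)" for i j
  proof (rule span_ideal_congI)
    have "s * (w i * w j - scale ((if i = j then 1 else 0) - 1 / ?n) E) \<in> I"
      using rel1 by (rule D(3))
    then show "s * w i * w j - scale ((if i = j then 1 else 0) - 1 / ?n) (E * s) \<in> I"
      by (simp add: scale_def algebra_simps)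
  qed (simp add: U3)
  show ?thesis
  proof (rule degree_le_card_generators[OF Z span, where U = U and m = 1])
    show "finite (U t)" for t by (simp add: U_def)
    show "card (U t) \<le> 1" for t by (simp add: U_def)
    show "form t f" if "f \<in> U t" for t f
    proof -
      from that have t: "2 \<le> t" and f: "f = E * s ^ (t - 2)" by (auto simp: U_def split: if_splits)
      have "form (2 + (t - 2) * Suc 0) (E * s ^ (t - 2))"
        by (rule form_mult[OF Ef form_power[OF sf]])
      also have "2 + (t - 2) * Suc 0 = t" using t by simp
      finally show ?thesis using f by simp
    qed
    show "u * v * x \<in> mpoly.span (I \<union> U 3)"
      if uvx: "u \<in> insert s (range w)" "v \<in> insert s (range w)" "x \<in> insert s (range w)" for u v x
    proof -
      have u: "u = s \<or> (\<exists>i. u = w i)" and v: "v = s \<or> (\<exists>i. v = w i)" and x: "x = s \<or> (\<exists>i. x = w i)"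
        using uvx by auto
      have www: "w i * w j * w k \<in> mpoly.span (I \<union> U 3)" for i j k
        using ww[OF EW] by (rule mem)
      have sss: "s * s * s \<in> mpoly.span (I \<union> U 3)"
        by (rule span_ideal_congI[OF ssf]) (simp add: U3)
      have 1: "w i * s * w j \<in> mpoly.span (I \<union> U 3)" "w i * w j * s \<in> mpoly.span (I \<union> U 3)" for i j
        using sww[of i j] by (simp_all add: mult_ac)
      have 2: "s * s * w i \<in> mpoly.span (I \<union> U 3)" "s * w i * s \<in> mpoly.span (I \<union> U 3)"
        "w i * s * s \<in> mpoly.span (I \<union> U 3)" for i
        using mem[OF ssw[of i], of 3] by (simp_all add: mult_ac)
      from u v x show ?thesis using www sss 1 2 sww by (elim disjE exE) simp_all
    qed
    show "v * f \<in> mpoly.span (I \<union> U (Suc t))"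
      if t: "3 \<le> t" and v: "v \<in> insert s (range w)" and f: "f \<in> U t" for t v f
    proof -
      have f: "f = E * s ^ (t - 2)" using f t by (simp add: U_def)
      have US: "U (Suc t) = {E * s ^ (t - 1)}" using t by (simp add: U_def)
      have Suc: "t - 1 = Suc (t - 2)" using t by simp
      show ?thesis
      proof (cases "v = s")
        case True
        have "s ^ (t - 1) = s * s ^ (t - 2)" by (simp only: Suc power_Suc)
        with True show ?thesis
          by (intro mpoly.span_base) (simp only: US f, simp add: mult.left_commute)
      next
        case False
        with v obtain i where i: "v = w i" by blast
        have "E * w i * s ^ (t - 2) \<in> I" using EW by (rule D(4))
        then show ?thesis by (intro mem) (simp add: i f mult_ac)
      qed
    qed
  qed
qed

section \<open>Symmetric tensors\<close>

definition symmetric_tensor :: "'a \<Rightarrow> 'a \<Rightarrow> 'a \<Rightarrow> ('n::finite, 'a::field_char_0) mpoly \<Rightarrow> bool" where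
  "symmetric_tensor \<alpha> \<beta> \<gamma> F \<longleftrightarrow> form 3 F \<and> (\<forall>x y z. coef3 F x y z =
     \<alpha> + \<beta> * ((if x = y then 1 else 0) + (if y = z then 1 else 0) + (if x = z then 1 else 0))
       + \<gamma> * (if x = y \<and> y = z then 1 else 0))"

lemma polar_lin:
  "polar F (lin f * lin g) k = (\<Sum>x\<in>UNIV. \<Sum>y\<in>UNIV. f x * g y * coef3 F x y k)"
proof -
  have *: "polar F (Var x * Var y) k = coef3 F x y k" for x y
    by (simp add: polar_def coef3_def Var_def mult_single add_ac)
  have "lin f * lin g = (\<Sum>x\<in>UNIV. \<Sum>y\<in>UNIV. scale (f x) (scale (g y) (Var x * Var y)))"
    unfolding lin_def sum_product
    by (intro sum.cong) (simp_all add: scale_def mult_ac)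
  then show ?thesis by (simp add: polar_sum polar_scale * mult.assoc)
qed

lemma polar_symmetric:
  fixes F :: "('n::finite, 'a::field_char_0) mpoly"
  assumes "symmetric_tensor \<alpha> \<beta> \<gamma> F"
  shows "polar F (lin f * lin g) k =
    \<alpha> * (sum f UNIV * sum g UNIV)
    + \<beta> * ((\<Sum>x\<in>UNIV. f x * g x) + g k * sum f UNIV + f k * sum g UNIV) + \<gamma> * (f k * g k)"
proof -
  have inner: "(\<Sum>y\<in>UNIV. f x * g y * coef3 F x y k) =
      \<alpha> * (f x * sum g UNIV) + \<beta> * (f x * g x) + \<beta> * (g k * f x)
      + (if x = k then \<beta> * (f k * sum g UNIV) else 0) + (if x = k then \<gamma> * (f k * g k) else 0)" for x
  proof -
    have "(\<Sum>y\<in>UNIV. f x * g y * coef3 F x y k) =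
        (\<Sum>y\<in>UNIV. \<alpha> * f x * g y + (if x = y then \<beta> * (f x * g y) else 0)
          + (if y = k then \<beta> * (f x * g y) else 0) + (if x = k then \<beta> * f x else 0) * g y
          + (if x = y then if x = k then \<gamma> * (f x * g y) else 0 else 0))"
      using assms by (intro sum.cong) (auto simp: symmetric_tensor_def algebra_simps)
    also have "\<dots> = \<alpha> * f x * sum g UNIV + \<beta> * (f x * g x) + \<beta> * (f x * g k)
        + (if x = k then \<beta> * f x else 0) * sum g UNIV + (if x = k then \<gamma> * (f x * g x) else 0)"
      by (simp only: sum.distrib sum_distrib_left sum.delta sum.delta' finite UNIV_I if_True)
    finally show ?thesis by (simp add: algebra_simps)
  qed
  show ?thesis
    unfolding polar_lin inner
    by (simp add: sum.distrib distrib_left flip: sum_distrib_left sum_distrib_right)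
qed

lemma form_lin_mult_lin [simp]: "form 2 (lin f * lin g)"
  using form_mult[OF form_lin form_lin, of f g] by (simp add: numeral_2_eq_2)

lemma lin_add: "lin (\<lambda>k. f k + g k) = lin f + lin g"
  by (simp add: lin_def mpoly.scale_left_distrib sum.distrib)

lemma lin_diff: "lin (\<lambda>k. f k - g k) = lin f - lin g"
  by (simp add: lin_def mpoly.scale_left_diff_distrib sum_subtractf)

lemma lin_cmult: "lin (\<lambda>k. c * f k) = scale c (lin f)"
  by (simp add: lin_def mpoly.scale_sum_right)

lemma lin_delta: "lin (\<lambda>k. if k = i then 1 else 0) = Var i"
proof -
  have "lin (\<lambda>k. if k = i then 1 else 0) = (\<Sum>k\<in>UNIV. if k = i then Var k else 0)"
    unfolding lin_def by (intro sum.cong) auto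
  then show ?thesis by simp
qed

lemma of_nat_mult_eq_scale: "of_nat m * f = scale (of_nat m) f"
  by (simp add: scale_def Const_def)

lemma lin_one: "lin (\<lambda>_. 1) = (\<Sum>k\<in>UNIV. Var k)"
  by (simp add: lin_def)

lemma sum_delta_minus:
  fixes i :: "'n::finite" and \<nu> :: "'a::field"
  shows "(\<Sum>k\<in>UNIV. (if k = i then 1 else 0) - \<nu>) = 1 - of_nat CARD('n) * \<nu>"
  by (simp add: sum_subtractf)

lemma sum_delta_minus_mult:
  fixes i j :: "'n::finite" and \<nu> :: "'a::field"
  shows "(\<Sum>k\<in>UNIV. ((if k = i then 1 else 0) - \<nu>) * ((if k = j then 1 else 0) - \<nu>)) =
     (if i = j then 1 else 0) - 2 * \<nu> + of_nat CARD('n) * \<nu>\<^sup>2"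
proof -
  have "(\<Sum>k\<in>UNIV. ((if k = i then 1 else 0) - \<nu>) * ((if k = j then 1 else 0) - \<nu>)) =
      (\<Sum>k\<in>UNIV. (if k = i then if i = j then 1 else 0 else 0) - (if k = i then \<nu> else 0)
        - (if k = j then \<nu> else 0) + \<nu>\<^sup>2)"
    by (intro sum.cong) (auto simp: algebra_simps power2_eq_square)
  then show ?thesis by (simp add: sum.distrib sum_subtractf)
qed

lemma exists_two_distinct:
  fixes c :: "'n::finite"
  assumes "3 \<le> CARD('n)"
  obtains a b :: 'n where "a \<noteq> b" "a \<noteq> c" "b \<noteq> c"
proof -
  have "2 \<le> card (UNIV - {c})" using assms by (simp add: card_Diff_subset)
  then obtain B where "B \<subseteq> UNIV - {c}" "card B = 2"
    by (metis obtain_subset_with_card_n)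
  then show ?thesis using that by (auto simp: card_2_iff)
qed

text \<open>
  For \<open>\<gamma> (\<gamma> + n \<beta>) \<noteq> 0\<close> the linear forms \<open>w i\<close> below are, up to a common factor, dual to the forms
  \<open>\<gamma> X\<^sub>i + \<beta> p\<^sub>1\<close> whose cubes sum to \<open>F\<close> up to a multiple of \<open>p\<^sub>1\<^sup>3\<close>.  That multiple vanishes
  iff \<open>\<alpha> \<gamma>\<^sup>2 = 3 \<gamma> \<beta>\<^sup>2 + n \<beta>\<^sup>3\<close>.
\<close>

lemma cactus_lower_bound_generic:
  fixes F :: "('n::finite, 'a::field_char_0) mpoly"
  assumes T: "symmetric_tensor \<alpha> \<beta> \<gamma> F" and n: "3 \<le> CARD('n)"
    and \<gamma>: "\<gamma> \<noteq> 0" and \<gamma>\<beta>: "\<gamma> + of_nat CARD('n) * \<beta> \<noteq> 0"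
    and Z: "zero_dim_subscheme_ideal r I" and sub: "I \<subseteq> annihilator F"
  shows "CARD('n) \<le> r"
    and "\<alpha> * \<gamma>\<^sup>2 \<noteq> 3 * \<gamma> * \<beta>\<^sup>2 + of_nat CARD('n) * \<beta> ^ 3 \<Longrightarrow> CARD('n) + 1 \<le> r"
proof -
  define N :: 'a where "N = of_nat CARD('n)"
  define D where "D = \<gamma> + N * \<beta>"
  define \<nu> where "\<nu> = \<beta> / D"
  define \<tau> where "\<tau> = 1 - N * \<nu>"
  have D0: "D \<noteq> 0" using \<gamma>\<beta> by (simp add: D_def N_def)
  have \<nu>D: "\<nu> * D = \<beta>" using D0 by (simp add: \<nu>_def)
  have "\<tau> * D = D - N * (\<nu> * D)" by (simp add: \<tau>_def algebra_simps)
  then have \<tau>D: "\<tau> * D = \<gamma>" unfolding \<nu>D by (simp add: D_def)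
  have "(\<beta> * \<tau>) * D = (\<gamma> * \<nu>) * D" 
    unfolding mult.assoc \<nu>D \<tau>D by (rule mult.commute)
  then have \<beta>\<tau>: "\<beta> * \<tau> = \<gamma> * \<nu>" using D0 by simp
  have \<tau>0: "\<tau> \<noteq> 0" using \<tau>D \<gamma> by auto
  define w where "w i = lin (\<lambda>k. (if k = i then 1 else 0) - \<nu>)" for i :: 'n
  \<comment> \<open>Each \<open>w i\<close> pairs to \<gamma> with \<gamma> X_i + \<beta> p_1, to 0
    with the other such forms and to \<tau> with p_1. So \<epsilon> is the square of \<tau> times
    the coefficient of the cube of p_1 in the tensor, and vanishes exactly with that
    coefficient.\<close>
  define \<epsilon> where "\<epsilon> = \<alpha> * \<tau>\<^sup>2 + \<beta> * (N * \<nu>\<^sup>2 - 2 * \<nu> - 2 * \<nu> * \<tau>) + \<gamma> * \<nu>\<^sup>2"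
  have "\<epsilon> * D\<^sup>2 = \<alpha> * (\<tau> * D)\<^sup>2 + \<beta> * (N * (\<nu> * D)\<^sup>2 - 2 * (\<nu> * D) * D - 2 * (\<nu> * D) * (\<tau> * D))
      + \<gamma> * (\<nu> * D)\<^sup>2"
    by (simp add: \<epsilon>_def algebra_simps power2_eq_square)
  also have "\<dots> = \<alpha> * \<gamma>\<^sup>2 - (3 * \<gamma> * \<beta>\<^sup>2 + N * \<beta> ^ 3)"
    unfolding \<nu>D \<tau>D by (simp add: D_def algebra_simps power2_eq_square power3_eq_cube)
  finally have \<epsilon>: "\<epsilon> * D\<^sup>2 = \<alpha> * \<gamma>\<^sup>2 - (3 * \<gamma> * \<beta>\<^sup>2 + N * \<beta> ^ 3)" .
  have polar_ww: "polar F (w i * w j) k = \<epsilon> + (if i = j then \<beta> + (if k = i then \<gamma> else 0) else 0)"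
    for i j k
  proof -
    have "polar F (w i * w j) k = \<alpha> * (\<tau> * \<tau>)
        + \<beta> * ((if i = j then 1 else 0) - 2 * \<nu> + N * \<nu>\<^sup>2 + ((if k = j then 1 else 0) - \<nu>) * \<tau>
          + ((if k = i then 1 else 0) - \<nu>) * \<tau>)
        + \<gamma> * (((if k = i then 1 else 0) - \<nu>) * ((if k = j then 1 else 0) - \<nu>))"
      unfolding w_def polar_symmetric[OF T] sum_delta_minus sum_delta_minus_mult \<tau>_def N_def
      by (simp add: mult.commute)
    also have "\<dots> = \<epsilon> + (if i = j then \<beta> + (if k = i then \<gamma> else 0) else 0)"
    proof -
      define d where "d = \<beta> * \<tau> - \<gamma> * \<nu>"
      have "\<alpha> * (\<tau> * \<tau>)
          + \<beta> * ((if i = j then 1 else 0) - 2 * \<nu> + N * \<nu>\<^sup>2 + ((if k = j then 1 else 0) - \<nu>) * \<tau>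
            + ((if k = i then 1 else 0) - \<nu>) * \<tau>)
          + \<gamma> * (((if k = i then 1 else 0) - \<nu>) * ((if k = j then 1 else 0) - \<nu>)) =
          \<epsilon> + (if i = j then \<beta> + (if k = i then \<gamma> else 0) else 0)
            + (if k = i then d else 0) + (if k = j then d else 0)"
        by (cases "k = i"; cases "k = j"; cases "i = j")
           (simp_all add: \<epsilon>_def d_def algebra_simps power2_eq_square)
      then show ?thesis using \<beta>\<tau> by (simp add: d_def)
    qed
    finally show ?thesis .
  qed
  obtain a b :: 'n where ab: "a \<noteq> b" using exists_two_distinct[OF n] by metis
  \<comment> \<open>If \<open>\<epsilon> = 0\<close> then also \<open>\<theta> = 0\<close>, as \<open>x / 0 = 0\<close>.\<close>
  define \<theta> where "\<theta> = (\<beta> + \<epsilon>) / \<epsilon>"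
  define \<beta>' where "\<beta>' = (if \<epsilon> = 0 then \<beta> else 0)"
  \<comment> \<open>For \<epsilon> \<noteq> 0 the subtracted multiple cancels the constant part
    \<beta> + \<epsilon> and leaves \<gamma> times a unit vector. For \<epsilon> = 0 the constant
    part \<beta> stays, and independence follows from \<gamma> + n \<beta> \<noteq> 0.\<close>
  define Q where "Q i = w i * w i - scale \<theta> (w a * w b)" for i
  have polar_Q: "polar F (Q i) k = \<beta>' + (if k = i then \<gamma> else 0)" for i k
    by (cases "\<epsilon> = 0") (simp_all add: Q_def polar_diff polar_scale polar_ww ab \<theta>_def \<beta>'_def)
  have formQ: "form 2 (Q i)" for i
    unfolding Q_def w_def by (intro form_diff form_scale form_lin_mult_lin)
  have ind: "c i = 0" if c: "\<And>k. (\<Sum>i\<in>UNIV. c i * polar F (Q i) k) = 0" for c i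
  proof -
    have *: "\<beta>' * sum c UNIV + \<gamma> * c k = 0" for k
    proof -
      have "(\<Sum>i\<in>UNIV. c i * polar F (Q i) k) = (\<Sum>i\<in>UNIV. \<beta>' * c i + (if i = k then \<gamma> * c i else 0))"
        by (intro sum.cong) (auto simp: polar_Q algebra_simps)
      also have "\<dots> = \<beta>' * sum c UNIV + \<gamma> * c k" by (simp add: sum.distrib sum_distrib_left)
      finally show ?thesis using c by simp
    qed
    have "0 = (\<Sum>k::'n\<in>UNIV. \<beta>' * sum c UNIV + \<gamma> * c k)" using * by simp
    also have "\<dots> = N * (\<beta>' * sum c UNIV) + \<gamma> * sum c UNIV"
      by (simp add: sum.distrib N_def flip: sum_distrib_left)
    also have "\<dots> = (\<gamma> + N * \<beta>') * sum c UNIV" by (simp add: algebra_simps)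
    finally have "sum c UNIV = 0" using D0 \<gamma> by (auto simp: \<beta>'_def D_def split: if_splits)
    with *[of i] \<gamma> show ?thesis by simp
  qed
  have independent: "\<forall>c. (\<forall>k. (\<Sum>i\<in>UNIV. c i * polar F (Q i) k) = 0) \<longrightarrow> (\<forall>i\<in>UNIV. c i = 0)"
    using ind by blast
  note quadrics = cactus_scheme_quadrics[OF Z sub finite formQ independent]
  show le: "CARD('n) \<le> r" by (rule quadrics(1))
  assume "\<alpha> * \<gamma>\<^sup>2 \<noteq> 3 * \<gamma> * \<beta>\<^sup>2 + of_nat CARD('n) * \<beta> ^ 3"
  then have \<epsilon>0: "\<epsilon> \<noteq> 0" using \<epsilon> by (auto simp: N_def)
  have "CARD('n) \<noteq> r"
  proof
    assume r: "CARD('n) = r"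
    have mem: "q \<in> I" if "form 2 q" "\<And>k. polar F q k = 0" for q
      using quadrics(2)[OF r that] .
    have "r \<le> 2"
    proof (rule fermat_relations_degree_le[OF Z, where A = UNIV and w = w and ?w0.0 = 0
          and \<kappa> = "(N * \<epsilon> + N * \<beta> + \<gamma>) / \<epsilon>"])
      show "3 \<le> card (UNIV :: 'n set)" by (rule n)
      show "form (Suc 0) (w i)" for i by (simp add: w_def)
      show "w i * w j - w k * w l \<in> I" if "i \<noteq> j" "k \<noteq> l" for i j k l
      proof (rule mem)
        show "form 2 (w i * w j - w k * w l)" unfolding w_def by (intro form_diff form_lin_mult_lin)
        show "polar F (w i * w j - w k * w l) m = 0" for m
          using that by (simp add: polar_diff polar_ww)
      qed
      show "(\<Sum>j\<in>UNIV. w j * w j) - scale ((N * \<epsilon> + N * \<beta> + \<gamma>) / \<epsilon>) (w k * w l) \<in> I"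
        if "k \<noteq> l" for k l
      proof (rule mem)
        show "form 2 ((\<Sum>j\<in>UNIV. w j * w j) - scale ((N * \<epsilon> + N * \<beta> + \<gamma>) / \<epsilon>) (w k * w l))"
          unfolding w_def by (intro form_diff form_sum form_scale form_lin_mult_lin)
        show "polar F ((\<Sum>j\<in>UNIV. w j * w j) - scale ((N * \<epsilon> + N * \<beta> + \<gamma>) / \<epsilon>) (w k * w l)) m = 0" for m
          using that \<epsilon>0 by (simp add: polar_diff polar_sum polar_scale polar_ww sum.distrib N_def
              distrib_left)
      qed
      show "0 * w i \<in> I" for i
        using mem[of 0] by (simp add: polar_def)
      show "Var k \<in> mpoly.span (insert 0 (range w))" for k
      proof -
        have w: "w i = Var i - scale \<nu> (lin (\<lambda>_. 1))" for i
        proof -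
          have "w i = lin (\<lambda>k. if k = i then 1 else 0) - lin (\<lambda>k. \<nu> * 1)"
            unfolding w_def by (subst lin_diff[symmetric]) simp
          then show ?thesis by (simp only: lin_delta lin_cmult)
        qed
        have "(\<Sum>i\<in>UNIV. w i) = lin (\<lambda>_. 1) - scale (N * \<nu>) (lin (\<lambda>_. 1))"
          by (simp add: w sum_subtractf lin_one N_def of_nat_mult_eq_scale)
        also have "\<dots> = scale \<tau> (lin (\<lambda>_. 1))"
          by (simp add: \<tau>_def mpoly.scale_left_diff_distrib)
        finally have "scale (\<nu> / \<tau>) (\<Sum>i\<in>UNIV. w i) = scale \<nu> (lin (\<lambda>_. 1))"
          using \<tau>0 by simp
        then have "Var k = w k + scale (\<nu> / \<tau>) (\<Sum>i\<in>UNIV. w i)" by (simp add: w)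
        also have "\<dots> \<in> mpoly.span (insert 0 (range w))"
          by (intro mpoly.span_add mpoly.span_scale mpoly.span_sum mpoly.span_base) auto
        finally show ?thesis .
      qed
    qed simp
    with r n show False by simp
  qed
  with le show "CARD('n) + 1 \<le> r" by simp
qed

text \<open>For \<gamma> = - n \<beta> the form F is a multiple of the cube of p_1 plus a cubic in n
  - 1 further variables; the sum \<open>s\<close> and the differences \<open>w i\<close> separate
  the two parts. The multiple vanishes iff \<alpha> n + 2 \<beta> = 0, whence the two values of
  \<open>m\<close>. If \<open>m\<close> were attained, the ideal would contain relations of Fermat
  type with \<open>s\<close> as the extra form; exploiting them takes three differences, hence four
  variables.\<close>

lemma cactus_lower_bound_degenerate:
  fixes F :: "('n::finite, 'a::field_char_0) mpoly"
  assumes T: "symmetric_tensor \<alpha> \<beta> \<gamma> F" and n: "3 \<le> CARD('n)"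
    and \<beta>: "\<beta> \<noteq> 0" and \<gamma>\<beta>: "\<gamma> + of_nat CARD('n) * \<beta> = 0"
    and Z: "zero_dim_subscheme_ideal r I" and sub: "I \<subseteq> annihilator F"
  defines "m \<equiv> if \<alpha> * of_nat CARD('n) + 2 * \<beta> = 0 then CARD('n) - 1 else CARD('n)"
  shows "m \<le> r" and "4 \<le> CARD('n) \<Longrightarrow> m + 1 \<le> r"
proof -
  define N :: 'a where "N = of_nat CARD('n)"
  define M where "M = \<alpha> * N + 2 * \<beta>"
  have N0: "N \<noteq> 0" by (simp add: N_def)
  have \<gamma>: "\<gamma> = - (N * \<beta>)" using \<gamma>\<beta> by (simp add: N_def add_eq_0_iff)
  have \<gamma>0: "\<gamma> \<noteq> 0" using \<gamma> N0 \<beta> by simp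
  obtain o' :: 'n where True by blast
  define A where "A = UNIV - {o'}"
  have cardA: "card A = CARD('n) - 1" by (simp add: A_def card_Diff_subset)
  define s :: "('n, 'a) mpoly" where "s = lin (\<lambda>_. 1)"
  define wv :: "'n \<Rightarrow> 'n \<Rightarrow> 'a" where
    "wv i k = (if k = i then 1 else 0) - (if k = o' then 1 else 0)" for i k
  define w where "w i = lin (wv i)" for i
  have sum_wv: "sum (wv i) UNIV = 0" for i by (simp add: wv_def sum_subtractf)
  have polar_ww: "polar F (w i * w j) k =
      \<beta> * (if i = j then 2 else 1) + \<gamma> * (if k = o' then 1 else if k = i \<and> i = j then 1 else 0)"
    if "i \<in> A" "j \<in> A" for i j k
  proof -
    have "(\<Sum>x\<in>UNIV. wv i x * wv j x) =
        (\<Sum>x\<in>UNIV. (if x = i then if i = j then 1 else 0 else 0) + (if x = o' then 1 else 0))"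
      using that by (intro sum.cong) (auto simp: wv_def A_def)
    also have "\<dots> = (if i = j then 2 else 1)" by (simp add: sum.distrib)
    finally have "polar F (w i * w j) k = \<beta> * (if i = j then 2 else 1) + \<gamma> * (wv i k * wv j k)"
      unfolding w_def polar_symmetric[OF T] sum_wv by simp
    then show ?thesis using that by (auto simp: wv_def A_def)
  qed
  have polar_sw: "polar F (s * w i) k = 0" for i k
  proof -
    have "polar F (s * w i) k = (N * \<beta> + \<gamma>) * wv i k"
      unfolding w_def s_def polar_symmetric[OF T] sum_wv
      by (simp add: sum_wv N_def algebra_simps)
    then show ?thesis by (simp add: \<gamma>)
  qed
  have polar_ss: "polar F (s * s) k = N * M" for k
    unfolding s_def polar_symmetric[OF T] by (simp add: N_def[symmetric] \<gamma> M_def algebra_simps)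
  obtain a b where "a \<noteq> b" "a \<noteq> o'" "b \<noteq> o'"
    by (rule exists_two_distinct[OF n])
  then have ab: "a \<in> A" "b \<in> A" "a \<noteq> b" by (auto simp: A_def)
  define Q where "Q i = (if i = o' then s * s else w i * w i - w a * w b)" for i
  have formQ: "form 2 (Q i)" for i
    unfolding Q_def w_def s_def by (auto intro!: form_diff form_lin_mult_lin)
  define J where "J = (if M = 0 then A else UNIV)"
  have cardJ: "card J = m"
    by (simp add: J_def m_def cardA M_def N_def)
  have polar_Q: "polar F (Q i) k = \<beta> + (if k = i then \<gamma> else 0)" if "i \<in> A" for i k
  proof -
    have "i \<noteq> o'" using that by (simp add: A_def)
    then show ?thesis using that ab by (auto simp: Q_def polar_diff polar_ww)
  qed
  have ind: "c i = 0" if c: "\<And>k. (\<Sum>i\<in>J. c i * polar F (Q i) k) = 0" and i: "i \<in> J" for c i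
  proof -
    define c0 where "c0 = (if M = 0 then 0 else c o')"
    have split: "(\<Sum>i\<in>J. c i * polar F (Q i) k) = c0 * (N * M) + (\<Sum>i\<in>A. c i * polar F (Q i) k)" for k
    proof (cases "M = 0")
      case True
      then show ?thesis by (simp add: J_def c0_def)
    next
      case False
      have "(\<Sum>i\<in>UNIV. c i * polar F (Q i) k) = c o' * polar F (Q o') k + (\<Sum>i\<in>A. c i * polar F (Q i) k)"
        unfolding A_def by (rule sum.remove) auto
      then show ?thesis using False by (simp add: J_def c0_def Q_def polar_ss)
    qed
    have *: "c0 * (N * M) + \<beta> * sum c A + (if k \<in> A then \<gamma> * c k else 0) = 0" for k
    proof -
      have "(\<Sum>i\<in>A. c i * polar F (Q i) k) = (\<Sum>i\<in>A. \<beta> * c i + (if i = k then \<gamma> * c i else 0))"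
        by (intro sum.cong) (auto simp: polar_Q algebra_simps)
      also have "\<dots> = \<beta> * sum c A + (if k \<in> A then \<gamma> * c k else 0)"
        by (simp add: sum.distrib sum_distrib_left A_def)
      finally show ?thesis using c[of k] unfolding split by (simp add: add.assoc)
    qed
    have "c0 * (N * M) + \<beta> * sum c A = 0" using *[of o'] by (simp add: A_def)
    then have cA: "c k = 0" if "k \<in> A" for k using *[of k] that \<gamma>0 by simp
    then have "sum c A = 0" by (rule sum.neutral[OF ballI])
    with *[of o'] have "c0 * (N * M) = 0" by (simp add: A_def)
    then have "M \<noteq> 0 \<Longrightarrow> c o' = 0" using N0 by (simp add: c0_def)
    with cA i show "c i = 0" by (cases "i = o'") (auto simp: J_def A_def split: if_splits)
  qed
  have independent: "\<forall>c. (\<forall>k. (\<Sum>i\<in>J. c i * polar F (Q i) k) = 0) \<longrightarrow> (\<forall>i\<in>J. c i = 0)"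
    using ind by blast
  note quadrics = cactus_scheme_quadrics[OF Z sub finite formQ independent]
  show le: "m \<le> r" using quadrics(1) cardJ by simp
  assume n4: "4 \<le> CARD('n)"
  have "m \<noteq> r"
  proof
    assume r: "m = r"
    have mem: "q \<in> I" if "form 2 q" "\<And>k. polar F q k = 0" for q
      using quadrics(2)[OF _ that] r cardJ by simp
    have "r \<le> 2"
    proof (rule fermat_relations_degree_le[OF Z, where A = A and w = w and ?w0.0 = s and \<kappa> = "N - 2"])
      show "3 \<le> card A" using n4 cardA by simp
      show "form (Suc 0) (w i)" "form (Suc 0) s" for i by (simp_all add: w_def s_def)
      show "w i * w j - w k * w l \<in> I"
        if "i \<in> A" "j \<in> A" "k \<in> A" "l \<in> A" "i \<noteq> j" "k \<noteq> l" for i j k l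
      proof (rule mem)
        show "form 2 (w i * w j - w k * w l)" unfolding w_def by (intro form_diff form_lin_mult_lin)
        show "polar F (w i * w j - w k * w l) h = 0" for h
          using that by (simp add: polar_diff polar_ww)
      qed
      show "(\<Sum>j\<in>A. w j * w j) - scale (N - 2) (w k * w l) \<in> I"
        if kl: "k \<in> A" "l \<in> A" "k \<noteq> l" for k l
      proof (rule mem)
        show "form 2 ((\<Sum>j\<in>A. w j * w j) - scale (N - 2) (w k * w l))"
          unfolding w_def by (intro form_diff form_sum form_scale form_lin_mult_lin)
        have cA: "of_nat (card A) = N - 1"
          using n by (simp add: cardA N_def of_nat_diff)
        show "polar F ((\<Sum>j\<in>A. w j * w j) - scale (N - 2) (w k * w l)) h = 0" for h
        proof -
          have "(\<Sum>j\<in>A. polar F (w j * w j) h) =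
              (\<Sum>j\<in>A. 2 * \<beta> + (if h = o' then \<gamma> else 0) + (if j = h then \<gamma> else 0))"
            by (intro sum.cong) (auto simp: polar_ww A_def)
          also have "\<dots> = (N - 1) * (2 * \<beta> + (if h = o' then \<gamma> else 0)) + (if h \<in> A then \<gamma> else 0)"
            by (simp add: sum.distrib cA A_def[THEN arg_cong[of _ _ finite]] distrib_left)
          finally show ?thesis
            using kl by (simp add: polar_diff polar_sum polar_scale polar_ww) (simp add: A_def \<gamma> algebra_simps)
        qed
      qed
      show "s * w i \<in> I" for i
      proof (rule mem)
        show "form 2 (s * w i)" unfolding w_def s_def by (rule form_lin_mult_lin)
      qed (rule polar_sw)
      show "Var k \<in> mpoly.span (insert s (w ` A))" for k
      proof -
        let ?S = "mpoly.span (insert s (w ` A))"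
        have w: "w i = Var i - Var o'" for i
          unfolding w_def wv_def[abs_def] lin_diff lin_delta ..
        have wS: "w i \<in> ?S" if "i \<in> A" for i using that by (intro mpoly.span_base) simp
        have "s = Var o' + (\<Sum>i\<in>A. Var i)"
          unfolding s_def lin_one A_def by (rule sum.remove) auto
        also have "(\<Sum>i\<in>A. Var i) = (\<Sum>i\<in>A. w i + scale 1 (Var o'))" by (simp add: w)
        also have "\<dots> = (\<Sum>i\<in>A. w i) + scale (of_nat (card A)) (Var o')"
          by (simp add: sum.distrib of_nat_mult_eq_scale)
        also have "of_nat (card A) = N - 1" using n by (simp add: cardA N_def of_nat_diff)
        finally have "s - (\<Sum>i\<in>A. w i) = scale N (Var o')"
          by (simp add: mpoly.scale_left_diff_distrib)
        then have "scale (1 / N) (s - (\<Sum>i\<in>A. w i)) = Var o'" using N0 by simp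
        moreover have "scale (1 / N) (s - (\<Sum>i\<in>A. w i)) \<in> ?S"
          using wS by (intro mpoly.span_scale mpoly.span_diff mpoly.span_sum) (auto intro: mpoly.span_base)
        ultimately have o: "Var o' \<in> ?S" by simp
        show ?thesis
        proof (cases "k = o'")
          case False
          then have "w k + Var o' \<in> ?S" using wS o by (intro mpoly.span_add) (auto simp: A_def)
          then show ?thesis by (simp add: w)
        qed (use o in simp)
      qed
    qed
    moreover have "3 \<le> m" using n4 unfolding m_def by auto
    ultimately show False using r by simp
  qed
  with le show "m + 1 \<le> r" by simp
qed

text \<open>The \<open>w i\<close> are the variables projected to the forms with coefficient sum 0,
  and F sees a product of two of them only through their scalar product. The quadric
  \<open>E\<close> is scaled to have all polars \<beta>; subtracting a multiple of it from
  \<open>s * Var i\<close> leaves a multiple of a unit vector, so the catalecticant has full rank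
  n.\<close>

lemma cactus_lower_bound_line_quadric:
  fixes F :: "('n::finite, 'a::field_char_0) mpoly"
  assumes T: "symmetric_tensor \<alpha> \<beta> 0 F" and n: "3 \<le> CARD('n)" and \<beta>: "\<beta> \<noteq> 0"
    and Z: "zero_dim_subscheme_ideal r I" and sub: "I \<subseteq> annihilator F"
  shows "CARD('n) + 1 \<le> r"
proof -
  define N :: 'a where "N = of_nat CARD('n)"
  have N0: "N \<noteq> 0" by (simp add: N_def)
  have N1: "N \<noteq> 1"
  proof
    assume "N = 1"
    then have "of_nat CARD('n) = (of_nat 1 :: 'a)" by (simp add: N_def)
    then have "CARD('n) = 1" unfolding of_nat_eq_iff .
    with n show False by simp
  qed
  define s :: "('n, 'a) mpoly" where "s = lin (\<lambda>_. 1)"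
  define w where "w i = lin (\<lambda>k. (if k = i then 1 else 0) - 1 / N)" for i :: 'n
  have sum0: "(\<Sum>k\<in>UNIV. (if k = i then 1 else 0) - 1 / N) = 0" for i :: 'n
    unfolding sum_delta_minus by (simp add: N_def)
  have polar_ww: "polar F (w i * w j) k = \<beta> * ((if i = j then 1 else 0) - 1 / N)" for i j k
  proof -
    have "polar F (w i * w j) k = \<beta> * ((if i = j then 1 else 0) - 2 * (1 / N) + N * (1 / N)\<^sup>2)"
      unfolding w_def polar_symmetric[OF T] sum0 sum_delta_minus_mult by (simp add: N_def)
    also have "(if i = j then 1 else 0) - 2 * (1 / N) + N * (1 / N)\<^sup>2 = (if i = j then 1 else 0) - 1 / N"
      using N0 by (simp add: power2_eq_square)
    finally show ?thesis .
  qed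
  have polar_ss: "polar F (s * s) k = \<alpha> * N * N + 3 * N * \<beta>" for k
    unfolding s_def polar_symmetric[OF T] by (simp add: N_def algebra_simps)
  have polar_sx: "polar F (s * Var i) k = \<alpha> * N + 2 * \<beta> + (if k = i then N * \<beta> else 0)" for i k
    unfolding s_def lin_delta[symmetric] polar_symmetric[OF T] by (simp add: N_def algebra_simps)
  obtain a :: 'n where True by blast
  define E where "E = scale (N / (N - 1)) (w a * w a)"
  have formE: "form 2 E" unfolding E_def w_def by (intro form_scale form_lin_mult_lin)
  have polar_E: "polar F E k = \<beta>" for k
    using N0 N1 by (simp add: E_def polar_scale polar_ww field_simps)
  define Q where "Q i = s * Var i - scale ((\<alpha> * N + 2 * \<beta>) / \<beta>) E" for i
  have formQ: "form 2 (Q i)" for i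
    unfolding Q_def s_def lin_delta[symmetric] using formE by (intro form_diff form_scale form_lin_mult_lin)
  have polar_Q: "polar F (Q i) k = (if i = k then N * \<beta> else 0)" for i k
    using \<beta> by (simp add: Q_def polar_diff polar_scale polar_sx polar_E)
  have ind: "c i = 0" if c: "\<And>k. (\<Sum>i\<in>UNIV. c i * polar F (Q i) k) = 0" for c i
  proof -
    have "(\<Sum>j\<in>UNIV. c j * polar F (Q j) i) = (\<Sum>j\<in>UNIV. if j = i then c j * (N * \<beta>) else 0)"
      by (intro sum.cong) (auto simp: polar_Q)
    then have "c i * (N * \<beta>) = 0" using c[of i] by simp
    then show ?thesis using N0 \<beta> by simp
  qed
  have independent: "\<forall>c. (\<forall>k. (\<Sum>i\<in>UNIV. c i * polar F (Q i) k) = 0) \<longrightarrow> (\<forall>i\<in>UNIV. c i = 0)"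
    using ind by blast
  note quadrics = cactus_scheme_quadrics[OF Z sub finite formQ independent]
  have le: "CARD('n) \<le> r" by (rule quadrics(1))
  have "CARD('n) \<noteq> r"
  proof
    assume r: "CARD('n) = r"
    have mem: "q \<in> I" if "form 2 q" "\<And>k. polar F q k = 0" for q
      using quadrics(2)[OF r that] .
    have "r \<le> 1"
    proof (rule line_quadric_relations_degree_le[OF Z n, where s = s and E = E and w = w
          and \<kappa> = "(\<alpha> * N * N + 3 * N * \<beta>) / \<beta>"])
      show "form (Suc 0) s" by (simp add: s_def)
      show "form 2 E" by (rule formE)
      show "w i * w j - scale ((if i = j then 1 else 0) - 1 / of_nat CARD('n)) E \<in> I" for i j
      proof (rule mem)
        show "form 2 (w i * w j - scale ((if i = j then 1 else 0) - 1 / of_nat CARD('n)) E)"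
          unfolding w_def using formE by (intro form_diff form_scale form_lin_mult_lin)
        show "polar F (w i * w j - scale ((if i = j then 1 else 0) - 1 / of_nat CARD('n)) E) k = 0" for k
          by (simp add: polar_diff polar_scale polar_ww polar_E flip: N_def)
      qed
      show "s * s - scale ((\<alpha> * N * N + 3 * N * \<beta>) / \<beta>) E \<in> I"
      proof (rule mem)
        show "form 2 (s * s - scale ((\<alpha> * N * N + 3 * N * \<beta>) / \<beta>) E)"
          unfolding s_def using formE by (intro form_diff form_scale form_lin_mult_lin)
        show "polar F (s * s - scale ((\<alpha> * N * N + 3 * N * \<beta>) / \<beta>) E) k = 0" for k
          using \<beta> by (simp add: polar_diff polar_scale polar_ss polar_E)
      qed
      show "Var k \<in> mpoly.span (insert s (range w))" for k
      proof -
        have "w k = lin (\<lambda>l. if l = k then 1 else 0) - lin (\<lambda>l. (1 / N) * 1)"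
          unfolding w_def by (subst lin_diff[symmetric]) simp
        then have "w k = Var k - scale (1 / N) s" by (simp only: lin_delta lin_cmult s_def)
        then have "Var k = w k + scale (1 / N) s" by simp
        also have "\<dots> \<in> mpoly.span (insert s (range w))"
          by (intro mpoly.span_add mpoly.span_scale mpoly.span_base) auto
        finally show ?thesis .
      qed
    qed
    with r n show False by simp
  qed
  with le show ?thesis by simp
qed

section \<open>Upper bounds\<close>

lemma sum_square_unit_add:
  fixes a :: "'n::finite monomial"
  shows "(\<Sum>i\<in>UNIV. (of_nat (coef (unit_exp k + a) i))\<^sup>2 :: 'a::comm_ring_1) =
     (\<Sum>i\<in>UNIV. (of_nat (coef a i))\<^sup>2) + 2 * of_nat (coef a k) + 1"
proof -
  have "(\<Sum>i\<in>UNIV. (of_nat (coef (unit_exp k + a) i))\<^sup>2 :: 'a) =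
      (\<Sum>i\<in>UNIV. (of_nat (coef a i))\<^sup>2 + (if i = k then 2 * of_nat (coef a i) + 1 else 0))"
    by (intro sum.cong)
       (auto simp: lookup_add lookup_single when_def power2_eq_square algebra_simps)
  then show ?thesis by (simp add: sum.distrib add.assoc)
qed

text \<open>
  The scheme of degree \<open>n + 1\<close> is supported at the point \<open>(1, \<dots>, 1)\<close> and defined by the apolar
  algebra of the dehomogenised cubic, a nondegenerate quadric: a form \<open>f\<close> lies in its ideal iff
  \<open>f\<close>, all first derivatives of \<open>f\<close>, and the Laplacian of \<open>f\<close> along the hyperplane
  \<open>\<Sum> x\<^sub>i = const\<close> vanish at that point.
\<close>

lemma has_apolar_scheme_line_quadric:
  fixes F :: "('n::finite, 'a::field_char_0) mpoly"
  assumes T: "symmetric_tensor \<alpha> \<beta> 0 F" and n: "2 \<le> CARD('n)"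
  shows "has_apolar_scheme (CARD('n) + 1) F"
proof -
  define N :: 'a where "N = of_nat CARD('n)"
  have N0: "N \<noteq> 0" by (simp add: N_def)
  have N1: "N \<noteq> 1"
  proof
    assume "N = 1"
    then have "of_nat CARD('n) = (of_nat 1 :: 'a)" by (simp add: N_def)
    then have "CARD('n) = 1" unfolding of_nat_eq_iff .
    with n show False by simp
  qed
  obtain o' :: 'n where True by blast
  \<comment> \<open>The weights are derivatives of the monomial x^a at (1, ..., 1):
    \<open>xc i\<close> is a first derivative, \<open>q a - S a\<close> the Laplacian, and
    \<open>((S a)\<^sup>2 - S a) / N\<close> the second derivative along the unit normal (1, ...,
    1). Their difference \<open>L\<close> is the Laplacian along the hyperplane.\<close>
  define xc :: "'n \<Rightarrow> 'n monomial \<Rightarrow> 'a" where "xc i a = of_nat (coef a i)" for i a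
  define S where "S a = (\<Sum>i\<in>UNIV. xc i a)" for a
  define q where "q a = (\<Sum>i\<in>UNIV. (xc i a)\<^sup>2)" for a
  define L where "L a = q a - S a - ((S a)\<^sup>2 - S a) / N" for a
  define w where "w j a = (case j of None \<Rightarrow> L a | Some i \<Rightarrow> if i = o' then 1 else xc i a - xc o' a)" for j a
  have w_P: "w (Some o') = (\<lambda>_. 1)"
    and w_i: "\<And>i. i \<noteq> o' \<Longrightarrow> w (Some i) = (\<lambda>a. xc i a - xc o' a)" and w_N: "w None = L"
    by (simp_all add: w_def fun_eq_iff)
  have xc_add: "xc i (unit_exp k + a) = (if i = k then 1 else 0) + xc i a" for i k a
    by (simp add: xc_def lookup_add lookup_single when_def)
  have S_add: "S (unit_exp k + a) = S a + 1" for k a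
    unfolding S_def xc_add by (simp add: sum.distrib)
  have q_add: "q (unit_exp k + a) = q a + 2 * xc k a + 1" for k a
    unfolding q_def xc_def by (rule sum_square_unit_add)
  have L_add: "L (unit_exp k + a) = L a + 2 * xc k a - 2 / N * S a" for k a
    unfolding L_def q_add S_add by (simp add: power2_eq_square field_simps N0)
  have at0: "xc i 0 = 0" "S 0 = 0" "q 0 = 0" for i by (simp_all add: xc_def S_def q_def)
  have at1: "xc i (Poly_Mapping.single k (Suc 0)) = (if i = k then 1 else 0)"
    "L (Poly_Mapping.single k (Suc 0)) = 0" for i k
    using xc_add[of i k 0, simplified] L_add[of k 0, simplified] by (simp_all add: at0 L_def)
  have L0: "L 0 = 0" by (simp add: L_def at0)
  have Z: "zero_dim_subscheme_ideal (card (UNIV :: 'n option set)) (scheme_ideal w UNIV)"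
  proof (rule zero_dim_scheme_ideal[where u = "\<lambda>_. 1 / N"])
    fix f :: "('n, 'a) mpoly" and k i
    assume all: "\<And>j. j \<in> UNIV \<Longrightarrow> pairing (w j) f = 0"
    have P: "pairing (\<lambda>_. 1) f = 0" using all[of "Some o'"] by (simp add: w_P)
    have c0: "pairing (\<lambda>_. c) f = 0" for c
      using pairing_weight_cmult[of c "\<lambda>_. 1" f] P by simp
    \<comment> \<open>On the common kernel all first derivatives agree, so the two terms by which
      multiplication by a variable changes \<open>L\<close> cancel.\<close>
    have A: "pairing (xc j) f = pairing (xc o') f" for j
      using all[of "Some j"] by (cases "j = o'") (simp_all add: w_i pairing_weight_diff)
    have "pairing S f = (\<Sum>i\<in>UNIV. pairing (xc i) f)"
      using pairing_weight_sum[where A = UNIV and c = "\<lambda>_. 1" and w = xc and f = f]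
      by (simp add: S_def[abs_def])
    also have "\<dots> = (\<Sum>i::'n\<in>UNIV. pairing (xc o') f)" by (intro sum.cong refl A)
    finally have "pairing S f = N * pairing (xc o') f" by (simp add: N_def)
    then have S: "pairing (\<lambda>a. 2 / N * S a) f = 2 * pairing (xc o') f"
      using N0 unfolding pairing_weight_cmult by simp
    show "pairing (w i) (Var k * f) = 0"
    proof (cases i)
      case None
      have "pairing (w i) (Var k * f) = pairing (\<lambda>a. L a + 2 * xc k a - 2 / N * S a) f"
        unfolding pairing_Var_mult None w_def option.case L_add ..
      also have "\<dots> = pairing (w None) f"
        unfolding pairing_weight_diff pairing_weight_add S by (simp add: pairing_weight_cmult A[of k] w_N)
      finally show ?thesis using all by simp
    next
      case (Some j)
      show ?thesis
      proof (cases "j = o'")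
        case True
        then show ?thesis using P by (simp add: Some pairing_Var_mult w_P)
      next
        case False
        define c :: 'a where "c = (if j = k then 1 else 0) - (if o' = k then 1 else 0)"
        have "pairing (w i) (Var k * f) = pairing (\<lambda>a. (xc j a - xc o' a) + c) f"
          unfolding pairing_Var_mult Some w_def option.case xc_add c_def using False
          by (simp add: algebra_simps)
        also have "\<dots> = 0"
          using all[of "Some j"] False by (simp only: pairing_weight_add c0) (simp add: w_i)
        finally show ?thesis .
      qed
    qed
  next
    fix i a
    show "(\<Sum>k\<in>UNIV. 1 / N * w i (unit_exp k + a)) = w i a"
    proof (cases i)
      case None
      have "(\<Sum>k\<in>UNIV. 1 / N * w i (unit_exp k + a)) =
          1 / N * (\<Sum>k\<in>UNIV. L a + 2 * xc k a - 2 / N * S a)"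
        by (simp only: w_def None option.case L_add sum_distrib_left)
      also have "(\<Sum>k\<in>UNIV. L a + 2 * xc k a - 2 / N * S a) = N * L a + 2 * S a - N * (2 / N * S a)"
        by (simp add: sum_subtractf sum.distrib S_def N_def flip: sum_distrib_left)
      finally show ?thesis using N0 by (simp add: None w_def)
    next
      case (Some j)
      have "(\<Sum>k\<in>UNIV. w i (unit_exp k + a)) = N * w i a"
        unfolding w_def Some option.case xc_add
        by (simp add: sum.distrib sum_subtractf N_def algebra_simps)
      then show ?thesis using N0 unfolding sum_distrib_left[symmetric] by simp
    qed
  next
    fix i
    show "\<exists>f. \<forall>j\<in>UNIV. pairing (w j) f = (if j = i then 1 else 0)"
    proof (cases i)
      case None
      \<comment> \<open>The polynomial dual to \<open>L\<close> is a multiple of (x - 1)^2 with x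
        the variable at \<open>o'\<close>: it kills the value and the first derivatives at the
        point, and \<open>L\<close> takes the value 2 - 2 / N on it.\<close>
      define c where "c = 1 / (2 - 2 / N)"
      have "2 - 2 / N = 2 * ((N - 1) / N)" using N0 by (simp add: field_simps)
      then have c: "c * (2 - 2 / N) = 1" using N0 N1 by (simp add: c_def)
      have X2: "xc i (unit_exp o' + unit_exp o') = (if i = o' then 2 else 0)"
        "L (unit_exp o' + unit_exp o') = 2 - 2 / N" for i
        using xc_add[of i o' "unit_exp o'"] L_add[of o' "unit_exp o'"] S_add[of o' 0]
        by (simp_all add: at0 at1)
      have "pairing (w j) (scale c (xpow (unit_exp o' + unit_exp o') - Poly_Mapping.single (unit_exp o') 2 + 1))
          = (if j = None then 1 else 0)" for j
        unfolding pairing_scale pairing_add pairing_diff pairing_single single_one[symmetric]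
        by (cases j) (auto simp: w_def X2[simplified] at0 at1 L0 c)
      then show ?thesis using None by blast
    next
      case (Some k)
      show ?thesis
      proof (cases "k = o'")
        case True
        have "pairing (w j) 1 = (if j = i then 1 else 0)" for j
          unfolding single_one[symmetric] pairing_single
          by (cases j) (auto simp: w_def at0 L0 Some True)
        then show ?thesis by blast
      next
        case False
        have "pairing (w j) (Var k - 1) = (if j = i then 1 else 0)" for j
          unfolding single_one[symmetric] pairing_diff pairing_single Var_def
          using False by (cases j) (auto simp: w_def at0 at1 L0 Some)
        then show ?thesis by blast
      qed
    qed
  qed simp
  have form: "form 3 F" using T by (simp add: symmetric_tensor_def)
  have "scheme_ideal w UNIV \<subseteq> annihilator F"
  proof (rule ideal_subset_annihilatorI[OF zero_dim_imp_homogeneous_ideal[OF Z] form])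
    fix f assume f: "f \<in> scheme_ideal w UNIV" "form 3 f"
    have w0: "pairing (w j) f = 0" for j
      using f by (auto simp: scheme_ideal_def homogeneous_component_form dest!: spec[of _ 3])
    \<comment> \<open>In degree 3 the weight \<open>L\<close> is twice the number of equal pairs
      among x, y, z, minus 6 / N. So \<beta> / 2 times \<open>L\<close> supplies the \<beta> part
      and the constant 3 \<beta> / N has to be restored.\<close>
    have "pairing (dp F) f = pairing (\<lambda>a. (\<alpha> + 3 * \<beta> / N) * w (Some o') a + \<beta> / 2 * w None a) f"
    proof (rule pairing_dp_cubic[OF f(2)])
      fix x y z
      have "L (unit_exp x + (unit_exp y + (unit_exp z + 0))) =
          2 * ((if x = y then 1 else 0) + (if y = z then 1 else 0) + (if x = z then 1 else 0)) - 6 / N"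
        unfolding L_add xc_add S_add by (simp add: at0 L0 field_simps N0)
      then have "w None (unit_exp x + unit_exp y + unit_exp z) =
          2 * ((if x = y then 1 else 0) + (if y = z then 1 else 0) + (if x = z then 1 else 0)) - 6 / N"
        by (simp add: w_def add.assoc)
      then show "coef3 F x y z = (\<alpha> + 3 * \<beta> / N) * w (Some o') (unit_exp x + unit_exp y + unit_exp z)
          + \<beta> / 2 * w None (unit_exp x + unit_exp y + unit_exp z)"
        using T by (simp only: symmetric_tensor_def) (simp add: w_def algebra_simps)
    qed
    also have "\<dots> = 0" unfolding pairing_weight_add pairing_weight_cmult w0 by simp
    finally show "pairing (dp F) f = 0" .
  qed
  with Z have "has_apolar_scheme (card (UNIV :: 'n option set)) F" by (rule has_apolar_schemeI)
  then show ?thesis by (simp add: card_UNIV_option)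
qed

text \<open>
  In three variables with \<open>\<gamma> + 3 \<beta> = 0\<close> the cubic is a combination of \<open>p\<^sub>1\<^sup>3\<close> and of the cubes of
  \<open>X\<^sub>1 + \<omega>X\<^sub>2 + \<omega>\<^sup>2X\<^sub>3\<close> and its conjugate, \<open>\<omega>\<close> a primitive cube root of unity.  The point
  \<open>(1, 1, 1)\<close> and the two conjugate points are defined over the ground field by means of the sums
  of the coefficients at monomials \<open>x\<^sup>a\<close> with \<open>a\<^sub>2 + 2 a\<^sub>3\<close> in a given residue class modulo 3.
\<close>

lemma coef3_ternary:
  fixes F :: "('n::finite, 'a::field_char_0) mpoly" and rho :: "'n \<Rightarrow> nat"
  assumes pqr: "UNIV = {p, q, r}" "p \<noteq> q" "p \<noteq> r" "q \<noteq> r"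
    and rho: "rho p = 0" "rho q = 1" "rho r = 2"
    and T: "symmetric_tensor \<alpha> \<beta> (- (3 * \<beta>)) F"
  shows "coef3 F x y z = (if (rho x + rho y + rho z) mod 3 = 0 then \<alpha> else \<alpha> + \<beta>)"
proof -
  have c: "coef3 F x y z =
     \<alpha> + \<beta> * ((if x = y then 1 else 0) + (if y = z then 1 else 0) + (if x = z then 1 else 0))
       - 3 * \<beta> * (if x = y \<and> y = z then 1 else 0)"
    using T by (simp add: symmetric_tensor_def)
  have "x = p \<or> x = q \<or> x = r" "y = p \<or> y = q \<or> y = r" "z = p \<or> z = q \<or> z = r"
    using pqr(1) by auto
  then show ?thesis
    unfolding c using pqr(2-4) pqr(2-4)[symmetric] rho by (elim disjE) simp_all
qed

context
  fixes p q r :: "'n::finite" and res :: "'n monomial \<Rightarrow> nat" and rho :: "'n \<Rightarrow> nat"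
  assumes pqr: "UNIV = {p, q, r}" "p \<noteq> q" "p \<noteq> r" "q \<noteq> r"
  defines "rho k \<equiv> if k = p then 0 else if k = q then 1 else 2"
    and "res a \<equiv> (coef a q + 2 * coef a r) mod 3"
begin

private lemma res_add: "res (unit_exp k + a) = (rho k + res a) mod 3"
proof -
  have "k = p \<or> k = q \<or> k = r" using pqr(1) by auto
  then show ?thesis
    using pqr(2-4) by (auto simp: res_def rho_def lookup_add lookup_single when_def mod_simps)
qed

private definition class_weight :: "nat \<Rightarrow> 'n monomial \<Rightarrow> 'a::field" where
  "class_weight j a = (if res a = j then 1 else 0)"

text \<open>Multiplication by x_k adds \<open>rho k\<close> to the residue and so permutes the three
  functionals; the summand 3 keeps the subtraction of natural numbers from truncating.\<close>

private lemma class_weight_add: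
  "j < 3 \<Longrightarrow> class_weight j (unit_exp k + a) = class_weight ((j + 3 - rho k) mod 3) a"
proof -
  assume j: "j < 3"
  have "res a < 3" by (simp add: res_def)
  then have "res a = 0 \<or> res a = 1 \<or> res a = 2" by auto
  moreover have "rho k = 0 \<or> rho k = 1 \<or> rho k = 2" by (auto simp: rho_def)
  moreover have "j = 0 \<or> j = 1 \<or> j = 2" using j by auto
  ultimately show ?thesis unfolding class_weight_def res_add by (elim disjE) simp_all
qed

private lemma class_weight_values:
  "class_weight j 0 = (if j = 0 then 1 else 0)"
  "class_weight j (Poly_Mapping.single q (Suc 0)) = (if j = 1 then 1 else 0)"
  "class_weight j (Poly_Mapping.single r (Suc 0)) = (if j = 2 then 1 else 0)"
  using pqr(2-4) by (auto simp: class_weight_def res_def lookup_single)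

private lemma class_weight_unit: "j < 3 \<Longrightarrow>
    (\<Sum>k\<in>UNIV. (if k = p then 1 else 0) * class_weight j (unit_exp k + a)) = class_weight j a"
proof -
  assume j: "j < 3"
  have "(\<Sum>k\<in>UNIV. (if k = p then 1 else 0) * class_weight j (unit_exp k + a)) =
      (\<Sum>k\<in>UNIV. if k = p then class_weight j (unit_exp k + a) else 0)"
    by (intro sum.cong) auto
  also have "\<dots> = class_weight j (unit_exp p + a)" by simp
  also have "\<dots> = class_weight j a" using class_weight_add[OF j, of p a] j by (simp add: rho_def)
  finally show ?thesis .
qed

private lemma coef3_class_weight:
  fixes F :: "('n, 'a::field_char_0) mpoly"
  assumes T: "symmetric_tensor \<alpha> \<beta> (- (3 * \<beta>)) F"
  shows "coef3 F x y z = (let a = unit_exp x + unit_exp y + unit_exp z in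
    \<Sum>j\<in>{0, 1, 2}. (if j = 0 then \<alpha> else \<alpha> + \<beta>) * class_weight j a)"
proof -
  have "res (unit_exp x + (unit_exp y + (unit_exp z + 0))) = (rho x + (rho y + (rho z + res 0) mod 3) mod 3) mod 3"
    unfolding res_add ..
  then have res: "res (unit_exp x + unit_exp y + unit_exp z) = (rho x + rho y + rho z) mod 3"
    by (simp add: res_def mod_simps add.assoc)
  have rho: "rho p = 0" "rho q = 1" "rho r = 2" using pqr(2-4) by (simp_all add: rho_def)
  have "m mod 3 = 0 \<or> m mod 3 = 1 \<or> m mod 3 = 2" for m :: nat by presburger
  then show ?thesis
    unfolding coef3_ternary[OF pqr rho T] Let_def class_weight_def res by auto
qed

lemma has_apolar_scheme_ternary_3:
  fixes F :: "('n, 'a::field_char_0) mpoly"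
  assumes T: "symmetric_tensor \<alpha> \<beta> (- (3 * \<beta>)) F"
  shows "has_apolar_scheme 3 F"
proof -
  have form: "form 3 F" using T by (simp add: symmetric_tensor_def)
  have Z: "zero_dim_subscheme_ideal (card {0, 1, 2::nat})
      (scheme_ideal (class_weight :: _ \<Rightarrow> _ \<Rightarrow> 'a) {0, 1, 2})"
  proof (rule zero_dim_scheme_ideal[where u = "\<lambda>k. if k = p then 1 else 0"])
    fix f :: "('n, 'a) mpoly" and k and i :: nat
    assume all: "\<And>j. j \<in> {0, 1, 2::nat} \<Longrightarrow> pairing (class_weight j) f = 0" and i: "i \<in> {0, 1, 2}"
    have "i < 3" using i by auto
    moreover have "(i + 3 - rho k) mod 3 \<in> {0, 1, 2}"
    proof -
      have "m \<in> {0, 1, 2}" if "m < 3" for m :: nat using that by auto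
      then show ?thesis by simp
    qed
    ultimately show "pairing (class_weight i) (Var k * f) = 0"
      unfolding pairing_Var_mult class_weight_add[OF \<open>i < 3\<close>] by (intro all)
  next
    fix i :: nat and a assume "i \<in> {0, 1, 2}"
    then show "(\<Sum>k\<in>UNIV. (if k = p then 1 else 0) * class_weight i (unit_exp k + a)) = (class_weight i a :: 'a)"
      by (intro class_weight_unit) auto
  next
    fix i :: nat assume "i \<in> {0, 1, 2}"
    then consider "i = 0" | "i = 1" | "i = 2" by auto
    then show "\<exists>f. \<forall>j\<in>{0, 1, 2}. pairing (class_weight j) f = (if j = i then 1 else 0 :: 'a)"
    proof cases
      case 1
      then show ?thesis by (intro exI[of _ "xpow 0"]) (simp add: class_weight_values del: single_one)
    next
      case 2
      then show ?thesis by (intro exI[of _ "Var q"]) (simp add: Var_def class_weight_values)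
    next
      case 3
      then show ?thesis by (intro exI[of _ "Var r"]) (simp add: Var_def class_weight_values)
    qed
  qed simp
  have "scheme_ideal class_weight {0, 1, 2} \<subseteq> annihilator F"
  proof (rule ideal_subset_annihilatorI[OF zero_dim_imp_homogeneous_ideal[OF Z] form])
    fix f :: "('n, 'a) mpoly" assume f: "f \<in> scheme_ideal class_weight {0, 1, 2}" "form 3 f"
    have w0: "pairing (class_weight j) f = 0" if "j \<in> {0, 1, 2}" for j
      using f that by (auto simp: scheme_ideal_def homogeneous_component_form dest!: spec[of _ 3])
    have "pairing (dp F) f =
        pairing (\<lambda>a. \<Sum>j\<in>{0, 1, 2}. (if j = 0 then \<alpha> else \<alpha> + \<beta>) * class_weight j a) f"
      by (rule pairing_dp_cubic[OF f(2)]) (simp only: coef3_class_weight[OF T] Let_def)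
    also have "\<dots> = 0" unfolding pairing_weight_sum by (intro sum.neutral) (simp add: w0)
    finally show "pairing (dp F) f = 0" .
  qed
  with Z have "has_apolar_scheme (card {0, 1, 2::nat}) F" by (rule has_apolar_schemeI)
  then show ?thesis by (simp add: numeral_eq_Suc)
qed

text \<open>The tensor of F has the coefficients \<alpha>, \<alpha> + \<beta>, \<alpha> + \<beta> at
  the three class functionals. If they sum to 0, differences of class functionals suffice, and these
  vanish on constant functions of the class: the point (1, 1, 1) drops out and the two conjugate
  points remain.\<close>

lemma has_apolar_scheme_ternary_2:
  fixes F :: "('n, 'a::field_char_0) mpoly"
  assumes T: "symmetric_tensor \<alpha> \<beta> (- (3 * \<beta>)) F" and M: "3 * \<alpha> + 2 * \<beta> = 0"
  shows "has_apolar_scheme 2 F"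
proof -
  have form: "form 3 F" using T by (simp add: symmetric_tensor_def)
  define w :: "nat \<Rightarrow> 'n monomial \<Rightarrow> 'a" where "w j a = class_weight 0 a - class_weight j a" for j a
  have w0: "pairing (class_weight j) f = pairing (class_weight 0) f"
    if "\<And>j. j \<in> {1, 2} \<Longrightarrow> pairing (w j) f = 0" "j < 3" for j f
  proof (cases "j = 0")
    case False
    then have "j \<in> {1, 2}" using that(2) by auto
    from that(1)[OF this] show ?thesis by (simp add: w_def[abs_def] pairing_weight_diff)
  qed simp
  have Z: "zero_dim_subscheme_ideal (card {1, 2::nat}) (scheme_ideal w {1, 2})"
  proof (rule zero_dim_scheme_ideal[where u = "\<lambda>k. if k = p then 1 else 0"])
    fix f :: "('n, 'a) mpoly" and k and i :: nat
    assume all: "\<And>j. j \<in> {1, 2::nat} \<Longrightarrow> pairing (w j) f = 0" and i: "i \<in> {1, 2}"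
    have "i < 3" using i by auto
    have "pairing (w i) (Var k * f) =
        pairing (class_weight ((0 + 3 - rho k) mod 3)) f - pairing (class_weight ((i + 3 - rho k) mod 3)) f"
      unfolding pairing_Var_mult w_def pairing_weight_diff class_weight_add[OF \<open>i < 3\<close>]
        class_weight_add[of 0, OF zero_less_numeral] ..
    also have "\<dots> = 0"
      using w0[OF all, of "(0 + 3 - rho k) mod 3"] w0[OF all, of "(i + 3 - rho k) mod 3"] by simp
    finally show "pairing (w i) (Var k * f) = 0" .
  next
    fix i :: nat and a assume "i \<in> {1, 2}"
    then show "(\<Sum>k\<in>UNIV. (if k = p then 1 else 0) * w i (unit_exp k + a)) = w i a"
      unfolding w_def right_diff_distrib sum_subtractf
      by (subst (1 2) class_weight_unit) auto
  next
    fix i :: nat assume "i \<in> {1, 2}"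
    then consider "i = 1" | "i = 2" by auto
    then show "\<exists>f. \<forall>j\<in>{1, 2}. pairing (w j) f = (if j = i then 1 else 0)"
    proof cases
      case 1
      then show ?thesis
        by (intro exI[of _ "Poly_Mapping.single (unit_exp q) (- 1)"]) (simp add: w_def class_weight_values)
    next
      case 2
      then show ?thesis
        by (intro exI[of _ "Poly_Mapping.single (unit_exp r) (- 1)"]) (simp add: w_def class_weight_values)
    qed
  qed simp
  have "scheme_ideal w {1, 2} \<subseteq> annihilator F"
  proof (rule ideal_subset_annihilatorI[OF zero_dim_imp_homogeneous_ideal[OF Z] form])
    fix f assume f: "f \<in> scheme_ideal w {1, 2}" "form 3 f"
    have all: "pairing (w j) f = 0" if "j \<in> {1, 2}" for j
      using f that by (auto simp: scheme_ideal_def homogeneous_component_form dest!: spec[of _ 3])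
    have "pairing (dp F) f =
        pairing (\<lambda>a. \<Sum>j\<in>{0, 1, 2}. (if j = 0 then \<alpha> else \<alpha> + \<beta>) * class_weight j a) f"
      by (rule pairing_dp_cubic[OF f(2)]) (simp only: coef3_class_weight[OF T] Let_def)
    also have "\<dots> = (\<Sum>j\<in>{0, 1, 2::nat}. (if j = 0 then \<alpha> else \<alpha> + \<beta>) * pairing (class_weight 0) f)"
      unfolding pairing_weight_sum
    proof (intro sum.cong refl arg_cong[of _ _ "(*) _"])
      fix j :: nat assume "j \<in> {0, 1, 2}"
      then have "j < 3" by auto
      with all show "pairing (class_weight j) f = pairing (class_weight 0) f" by (rule w0)
    qed
    also have "\<dots> = (3 * \<alpha> + 2 * \<beta>) * pairing (class_weight 0) f" by (simp add: algebra_simps)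
    finally show "pairing (dp F) f = 0" using M by simp
  qed
  with Z have "has_apolar_scheme (card {1, 2::nat}) F" by (rule has_apolar_schemeI)
  then show ?thesis by (simp add: numeral_eq_Suc)
qed

end

section \<open>Waring decompositions\<close>

text \<open>Coefficients make this usable over k, where cubes cannot absorb scalars; over the
  closure they are absorbed by cube roots. An honest sum of cubes has all coefficients 6, the factor
  in the tensor of a cube.\<close>

definition decomposes ::
    "('n::finite, 'a::field_char_0) mpoly \<Rightarrow> 'i set \<Rightarrow> ('i \<Rightarrow> 'a) \<Rightarrow> ('i \<Rightarrow> 'n \<Rightarrow> 'a) \<Rightarrow> bool" where
  "decomposes F A c p \<longleftrightarrow> (\<forall>x y z. coef3 F x y z = (\<Sum>i\<in>A. c i * (p i x * p i y * p i z)))"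

lemma waring_decomposition_imp_decomposes:
  fixes F :: "('n::finite, 'a::field_char_0) mpoly"
  assumes "\<And>i. i < r \<Longrightarrow> form 1 (L i)" "F = (\<Sum>i<r. L i ^ 3)"
  shows "decomposes F {..<r} (\<lambda>_. 6) (\<lambda>i k. coef (L i) (unit_exp k))"
  unfolding decomposes_def
proof (intro allI)
  fix x y z
  have "coef3 F x y z = (\<Sum>i<r. coef3 (lin (\<lambda>k. coef (L i) (unit_exp k)) ^ 3) x y z)"
    unfolding assms(2) coef3_sum using assms(1) form_1_eq_lin by (intro sum.cong) force+
  then show "coef3 F x y z = (\<Sum>i\<in>{..<r}. 6 *
      (coef (L i) (unit_exp x) * coef (L i) (unit_exp y) * coef (L i) (unit_exp z)))"
    by (simp add: coef3_lin_cube mult.assoc)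
qed

lemma waring_decomposition_exists:
  fixes F :: "('n::finite, 'a::{field_char_0, alg_closed_field}) mpoly"
  assumes F: "form 3 F" and fin: "finite A" and dec: "decomposes F A c p"
  shows "\<exists>L. (\<forall>i<card A. form 1 (L i)) \<and> F = (\<Sum>i<card A. L i ^ 3)"
proof -
  obtain h where h: "bij_betw h {..<card A} A"
    using ex_bij_betw_nat_finite[OF fin] by (auto simp: atLeast0LessThan)
  have "\<exists>y. y ^ 3 = c i / 6" for i
    using nth_root_exists[where n = 3 and x = "c i / 6"] by auto
  then obtain t where t: "\<And>i. t i ^ 3 = c i / 6" by metis
  define L where "L j = lin (\<lambda>k. t (h j) * p (h j) k)" for j
  have cL: "coef3 (L j ^ 3) x y z = c (h j) * (p (h j) x * p (h j) y * p (h j) z)" for j x y z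
  proof -
    have "coef3 (L j ^ 3) x y z = 6 * t (h j) ^ 3 * (p (h j) x * p (h j) y * p (h j) z)"
      unfolding L_def coef3_lin_cube by (simp add: power3_eq_cube mult_ac)
    then show ?thesis by (simp add: t)
  qed
  have "F = (\<Sum>j<card A. L j ^ 3)"
  proof (rule cubic_eqI[OF F])
    have "form 3 (L j ^ 3)" for j
      using form_power[OF form_lin, of 3] by (simp add: L_def)
    then show "form 3 (\<Sum>j<card A. L j ^ 3)" by (intro form_sum)
    fix x y z
    have "coef3 F x y z = (\<Sum>i\<in>A. c i * (p i x * p i y * p i z))"
      using dec by (simp add: decomposes_def)
    also have "\<dots> = (\<Sum>j<card A. c (h j) * (p (h j) x * p (h j) y * p (h j) z))"
      by (rule sum.reindex_bij_betw[OF h, symmetric])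
    finally show "coef3 F x y z = coef3 (\<Sum>j<card A. L j ^ 3) x y z"
      by (simp add: coef3_sum cL)
  qed
  then show ?thesis by (intro exI[of _ L]) (simp add: L_def)
qed

lemma waring_rank_eqI:
  fixes F :: "('n::finite, 'a::{field_char_0, alg_closed_field}) mpoly"
  assumes F: "form 3 F" and fin: "finite A" and dec: "decomposes F A c p"
    and low: "\<And>(r::nat) l. decomposes F {..<r} (\<lambda>_. 6) l \<Longrightarrow> card A \<le> r"
  shows "waring_rank 3 F = card A"
  unfolding waring_rank_def
proof (rule Least_equality)
  show "\<exists>L. (\<forall>i<card A. form 1 (L i)) \<and> F = (\<Sum>i<card A. L i ^ 3)"
    by (rule waring_decomposition_exists[OF F fin dec])
  fix r :: nat assume "\<exists>L. (\<forall>i<r. form 1 (L i)) \<and> F = (\<Sum>i<r. L i ^ 3)"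
  then show "card A \<le> r"
    using waring_decomposition_imp_decomposes low by metis
qed

lemma has_apolar_scheme_decomposes:
  "form 3 F \<Longrightarrow> finite A \<Longrightarrow> decomposes F A c p \<Longrightarrow> has_apolar_scheme (card A) F"
  using has_apolar_scheme_decomposition unfolding decomposes_def by blast

section \<open>The Waring rank of a hyperplane together with a quadric\<close>

text \<open>Gaussian elimination: the equation \<open>e\<close> is solved for an unknown
  \<open>k\<close> with nonzero coefficient, and the result is substituted into the others.\<close>

lemma homogeneous_system_solution:
  fixes \<phi> :: "'e \<Rightarrow> 'j \<Rightarrow> 'a::field"
  assumes "finite E" "finite J" "card E < card J"
  shows "\<exists>c. (\<exists>j\<in>J. c j \<noteq> 0) \<and> (\<forall>e\<in>E. (\<Sum>j\<in>J. c j * \<phi> e j) = 0)"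
  using assms
proof (induction E arbitrary: J \<phi> rule: finite_induct)
  case empty
  then have "J \<noteq> {}" by auto
  then show ?case by (intro exI[of _ "\<lambda>_. 1"]) auto
next
  case (insert e E)
  show ?case
  proof (cases "\<exists>k\<in>J. \<phi> e k \<noteq> 0")
    case False
    have "card E < card J" using insert by simp
    from insert.IH[OF insert.prems(1) this, of \<phi>] False show ?thesis by auto
  next
    case True
    then obtain k where k: "k \<in> J" "\<phi> e k \<noteq> 0" by blast
    let ?J = "J - {k}"
    have "card E < card ?J" using insert k by (simp add: card_Diff_singleton)
    from insert.IH[OF _ this, of "\<lambda>d j. \<phi> d j - \<phi> e j / \<phi> e k * \<phi> d k"] insert.prems(1)
    obtain c where c: "\<exists>j\<in>?J. c j \<noteq> 0"
      "\<And>d. d \<in> E \<Longrightarrow> (\<Sum>j\<in>?J. c j * (\<phi> d j - \<phi> e j / \<phi> e k * \<phi> d k)) = 0" by auto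
    define c' where "c' j = (if j = k then - (\<Sum>j\<in>?J. c j * \<phi> e j) / \<phi> e k else c j)" for j
    have sum: "(\<Sum>j\<in>J. c' j * \<phi> d j) =
        (\<Sum>j\<in>?J. c j * \<phi> d j) - (\<Sum>j\<in>?J. c j * \<phi> e j) / \<phi> e k * \<phi> d k" for d
    proof -
      have "(\<Sum>j\<in>J. c' j * \<phi> d j) = c' k * \<phi> d k + (\<Sum>j\<in>?J. c' j * \<phi> d j)"
        using insert.prems(1) k(1) by (rule sum.remove)
      also have "(\<Sum>j\<in>?J. c' j * \<phi> d j) = (\<Sum>j\<in>?J. c j * \<phi> d j)"
        by (intro sum.cong) (auto simp: c'_def)
      finally show ?thesis by (simp add: c'_def)
    qed
    have "(\<Sum>j\<in>J. c' j * \<phi> d j) = 0" if "d \<in> insert e E" for d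
    proof (cases "d = e")
      case True
      then show ?thesis using k by (simp add: sum)
    next
      case False
      then have "d \<in> E" using that by simp
      from c(2)[OF this] show ?thesis
        unfolding sum right_diff_distrib sum_subtractf sum_divide_distrib sum_distrib_right
        by (simp add: mult.assoc)
    qed
    moreover have "\<exists>j\<in>J. c' j \<noteq> 0" using c(1) by (auto simp: c'_def)
    ultimately show ?thesis by blast
  qed
qed

text \<open>\<open>B\<close> is a nondegenerate subfamily of least size: a linear dependence would
  make one functional redundant, and fewer than n functionals have a common nonzero zero.\<close>

lemma exists_basis_of_functionals:
  fixes l :: "'i \<Rightarrow> 'n::finite \<Rightarrow> 'a::field"
  assumes fin: "finite A" and nondeg: "\<And>v. (\<And>i. i \<in> A \<Longrightarrow> (\<Sum>x\<in>UNIV. l i x * v x) = 0) \<Longrightarrow> v = (\<lambda>_. 0)"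
  obtains B where "B \<subseteq> A" "CARD('n) \<le> card B"
    "\<forall>v. (\<forall>i\<in>B. (\<Sum>x\<in>UNIV. l i x * v x) = 0) \<longrightarrow> v = (\<lambda>_. 0)"
    "\<forall>c. (\<forall>x. (\<Sum>i\<in>B. c i * l i x) = 0) \<longrightarrow> (\<forall>i\<in>B. c i = 0)"
proof -
  let ?P = "\<lambda>B. B \<subseteq> A \<and> (\<forall>v. (\<forall>i\<in>B. (\<Sum>x\<in>UNIV. l i x * v x) = 0) \<longrightarrow> v = (\<lambda>_. 0))"
  have PA: "?P A" using nondeg by blast
  obtain B where B: "?P B" and min: "\<And>C. ?P C \<Longrightarrow> card B \<le> card C"
    using arg_min_natI[of ?P A card] PA arg_min_nat_le[of ?P _ card] by blast
  have finB: "finite B" using B fin finite_subset by blast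
  have nd: "v = (\<lambda>_. 0)" if "\<And>i. i \<in> B \<Longrightarrow> (\<Sum>x\<in>UNIV. l i x * v x) = 0" for v
    using B that by blast
  have basis: "c j = 0" if c: "\<And>x. (\<Sum>i\<in>B. c i * l i x) = 0" and j: "j \<in> B" for c j
  proof (rule ccontr)
    assume cj: "c j \<noteq> 0"
    have "?P (B - {j})"
    proof (intro conjI allI impI)
      show "B - {j} \<subseteq> A" using B by blast
      fix v assume v: "\<forall>i\<in>B - {j}. (\<Sum>x\<in>UNIV. l i x * v x) = 0"
      have "0 = (\<Sum>x\<in>UNIV. (\<Sum>i\<in>B. c i * l i x) * v x)" by (simp add: c)
      also have "\<dots> = (\<Sum>i\<in>B. c i * (\<Sum>x\<in>UNIV. l i x * v x))"
        unfolding sum_distrib_left sum_distrib_right mult.assoc by (rule sum.swap)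
      also have "\<dots> = c j * (\<Sum>x\<in>UNIV. l j x * v x) + (\<Sum>i\<in>B - {j}. c i * (\<Sum>x\<in>UNIV. l i x * v x))"
        using finB j by (rule sum.remove)
      also have "(\<Sum>i\<in>B - {j}. c i * (\<Sum>x\<in>UNIV. l i x * v x)) = 0"
        using v by (intro sum.neutral) simp
      finally have "(\<Sum>x\<in>UNIV. l j x * v x) = 0" using cj by simp
      with v show "v = (\<lambda>_. 0)" by (intro nd) auto
    qed
    then have "card B \<le> card (B - {j})" by (rule min)
    with card_Diff1_less[OF finB j] show False by simp
  qed
  show ?thesis
  proof (rule that)
    show "B \<subseteq> A" "\<forall>v. (\<forall>i\<in>B. (\<Sum>x\<in>UNIV. l i x * v x) = 0) \<longrightarrow> v = (\<lambda>_. 0)"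
      using B by blast+
    show "\<forall>c. (\<forall>x. (\<Sum>i\<in>B. c i * l i x) = 0) \<longrightarrow> (\<forall>i\<in>B. c i = 0)" using basis by blast
    show "CARD('n) \<le> card B"
    proof (rule ccontr)
      assume "\<not> ?thesis"
      then have "\<exists>v. (\<exists>x\<in>UNIV. v x \<noteq> 0) \<and> (\<forall>i\<in>B. (\<Sum>x\<in>UNIV. v x * l i x) = 0)"
        by (intro homogeneous_system_solution[OF finB]) auto
      then obtain v where v: "\<exists>x. v x \<noteq> 0" "\<And>i. i \<in> B \<Longrightarrow> (\<Sum>x\<in>UNIV. v x * l i x) = 0" by auto
      from v(2) have "v = (\<lambda>_. 0)" by (intro nd) (simp add: mult.commute)
      with v(1) show False by auto
    qed
  qed
qed

text \<open>
  Among the \<open>r\<close> linear forms choose \<open>n\<close> independent ones.  If \<open>r \<le> 2n - 3\<close>, the vectors killed by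
  \<open>p\<^sub>1\<close> and by the remaining forms make up a space of dimension at least 2, which contains an
  isotropic vector \<open>v \<noteq> 0\<close>.  Since \<open>p\<^sub>1\<close> and the quadric vanish at \<open>v\<close>, the gradient of \<open>F\<close> at \<open>v\<close>
  vanishes, and by independence all the chosen forms vanish at \<open>v\<close>.
\<close>

lemma waring_lower_bound_line_quadric:
  fixes F :: "('n::finite, 'a::{field_char_0, alg_closed_field}) mpoly"
  assumes T: "symmetric_tensor \<alpha> \<beta> 0 F" and n: "3 \<le> CARD('n)" and \<beta>: "\<beta> \<noteq> 0"
    and dec: "decomposes F {..<r::nat} (\<lambda>_. 6) l"
  shows "2 * (CARD('n) - 1) \<le> r"
proof (rule ccontr)
  assume less: "\<not> ?thesis"
  define N :: 'a where "N = of_nat CARD('n)"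
  have N0: "N \<noteq> 0" by (simp add: N_def)
  have c3: "coef3 F x y z = \<alpha> + \<beta> * ((if x = y then 1 else 0) + (if y = z then 1 else 0) + (if x = z then 1 else 0))"
    for x y z using T by (simp add: symmetric_tensor_def)
  have d3: "coef3 F x y z = (\<Sum>i<r. 6 * (l i x * l i y * l i z))" for x y z
    using dec by (simp add: decomposes_def)
  \<comment> \<open>F is concise: if all linear forms of the decomposition kill \<open>v\<close>,
    the derivative of F in direction \<open>v\<close> vanishes identically, which forces
    \<open>v\<close> to be 0.\<close>
  have nondeg: "v = (\<lambda>_. 0)" if v: "\<And>i. i \<in> {..<r} \<Longrightarrow> (\<Sum>x\<in>UNIV. l i x * v x) = 0" for v
  proof -
    have "(\<Sum>x\<in>UNIV. v x * coef3 F x y z) = (\<Sum>i<r. 6 * (\<Sum>x\<in>UNIV. l i x * v x) * (l i y * l i z))" for y z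
      unfolding d3 sum_distrib_left sum_distrib_right by (subst sum.swap) (simp add: mult_ac)
    then have z0: "(\<Sum>x\<in>UNIV. v x * coef3 F x y z) = 0" for y z by (simp add: v)
    have ex: "(\<Sum>x\<in>UNIV. v x * coef3 F x y z) =
        \<alpha> * sum v UNIV + \<beta> * (v y + (if y = z then sum v UNIV else 0) + v z)" for y z
    proof -
      have "(\<Sum>x\<in>UNIV. v x * coef3 F x y z) = (\<Sum>x\<in>UNIV. \<alpha> * v x + (if x = y then \<beta> * v x else 0)
          + (if y = z then \<beta> else 0) * v x + (if x = z then \<beta> * v x else 0))"
        by (intro sum.cong) (auto simp: c3 algebra_simps)
      also have "\<dots> = \<alpha> * sum v UNIV + \<beta> * v y + (if y = z then \<beta> else 0) * sum v UNIV + \<beta> * v z"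
        by (simp only: sum.distrib sum_distrib_left sum.delta finite UNIV_I if_True)
      finally show ?thesis by (simp add: algebra_simps)
    qed
    have diag: "2 * \<beta> * v y = - ((\<alpha> + \<beta>) * sum v UNIV)" for y
    proof -
      have "2 * \<beta> * v y + (\<alpha> + \<beta>) * sum v UNIV = 0"
        using z0[of y y] unfolding ex by (simp add: algebra_simps)
      then show ?thesis by (simp only: eq_neg_iff_add_eq_0)
    qed
    have const: "v y = v z" for y z
    proof -
      have "2 * \<beta> * v y = 2 * \<beta> * v z" by (simp add: diag)
      then show ?thesis using \<beta> by simp
    qed
    obtain y z :: 'n where yz: "y \<noteq> z" using exists_two_distinct[OF n] by metis
    have "\<alpha> * sum v UNIV + \<beta> * (2 * v y) = 0"
      using z0[of y z] yz const[of y z] unfolding ex by simp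
    moreover have "\<alpha> * sum v UNIV + \<beta> * (2 * v y) + \<beta> * sum v UNIV = 0"
      using z0[of y y] unfolding ex by (simp add: algebra_simps)
    ultimately have s0: "sum v UNIV = 0" using \<beta> by simp
    have "2 * \<beta> * v y = 0" for y using diag[of y] s0 by simp
    then show ?thesis using \<beta> by (auto simp: fun_eq_iff)
  qed
  obtain B where B: "B \<subseteq> {..<r}" "CARD('n) \<le> card B"
    "\<forall>v. (\<forall>i\<in>B. (\<Sum>x\<in>UNIV. l i x * v x) = 0) \<longrightarrow> v = (\<lambda>_. 0)"
    "\<forall>c. (\<forall>x. (\<Sum>i\<in>B. c i * l i x) = 0) \<longrightarrow> (\<forall>i\<in>B. c i = 0)"
    by (rule exists_basis_of_functionals[OF finite_lessThan nondeg])
  have finB: "finite B" using B(1) finite_subset by blast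
  define A where "A = {..<r} - B"
  have cardA: "card A + 3 \<le> CARD('n)"
  proof -
    have "card A = r - card B" using B(1) finB by (simp add: A_def card_Diff_subset)
    moreover have "card B \<le> r" using card_mono[OF _ B(1)] by simp
    ultimately show ?thesis using B(2) less n by simp
  qed
  define \<phi> where "\<phi> e x = (case e of None \<Rightarrow> 1 | Some i \<Rightarrow> l i x)" for e :: "nat option" and x :: 'n
  define E where "E = insert None (Some ` A)"
  have finE: "finite E" by (simp add: E_def A_def)
  have cardE: "card E + 2 \<le> CARD('n)"
    using cardA by (simp add: E_def card_image A_def card_insert_if image_iff)
  have "\<exists>u. (\<exists>x\<in>UNIV. u x \<noteq> 0) \<and> (\<forall>e\<in>E. (\<Sum>x\<in>UNIV. u x * \<phi> e x) = 0)"
    by (rule homogeneous_system_solution[OF finE]) (use cardE in auto)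
  then obtain u x0 where u: "u x0 \<noteq> 0" "\<And>e. e \<in> E \<Longrightarrow> (\<Sum>x\<in>UNIV. u x * \<phi> e x) = 0" by auto
  \<comment> \<open>Dropping the coordinate \<open>x0\<close>, where \<open>u\<close> is nonzero,
    makes the second solution independent of \<open>u\<close>; at most n - 2 equations leave room
    for one unknown less.\<close>
  have "\<exists>w. (\<exists>x\<in>UNIV - {x0}. w x \<noteq> 0) \<and> (\<forall>e\<in>E. (\<Sum>x\<in>UNIV - {x0}. w x * \<phi> e x) = 0)"
    by (rule homogeneous_system_solution[OF finE]) (use cardE in \<open>auto simp: card_Diff_singleton\<close>)
  then obtain w' where w': "\<exists>x\<in>UNIV - {x0}. w' x \<noteq> 0" "\<And>e. e \<in> E \<Longrightarrow> (\<Sum>x\<in>UNIV - {x0}. w' x * \<phi> e x) = 0"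
    by auto
  define w where "w x = (if x = x0 then 0 else w' x)" for x
  have w: "\<exists>x. w x \<noteq> 0" "w x0 = 0" using w'(1) by (auto simp: w_def)
  have wE: "(\<Sum>x\<in>UNIV. w x * \<phi> e x) = 0" if "e \<in> E" for e
  proof -
    have "(\<Sum>x\<in>UNIV. w x * \<phi> e x) = w x0 * \<phi> e x0 + (\<Sum>x\<in>UNIV - {x0}. w x * \<phi> e x)"
      by (rule sum.remove) auto
    also have "(\<Sum>x\<in>UNIV - {x0}. w x * \<phi> e x) = (\<Sum>x\<in>UNIV - {x0}. w' x * \<phi> e x)"
      by (intro sum.cong) (auto simp: w_def)
    finally show ?thesis using w'(2)[OF that] w(2) by simp
  qed
  define q where "q v = (\<Sum>x\<in>UNIV. (v x)\<^sup>2)" for v :: "'n \<Rightarrow> 'a"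
  \<comment> \<open>On the plane spanned by \<open>u\<close> and \<open>w\<close> the quadric is a
    binary form, which has a nontrivial zero over an algebraically closed field.\<close>
  have "\<exists>s t. q (\<lambda>x. s * u x + t * w x) = 0 \<and> (\<exists>x. s * u x + t * w x \<noteq> 0)"
  proof (cases "q u = 0")
    case True
    then show ?thesis using u(1) by (intro exI[of _ 1] exI[of _ 0]) auto
  next
    case False
    let ?p = "[:q w, 2 * (\<Sum>x\<in>UNIV. u x * w x), q u:]"
    have "degree ?p > 0" using False by simp
    then obtain s where s: "poly ?p s = 0" using alg_closed_imp_poly_has_root by blast
    have "q (\<lambda>x. s * u x + 1 * w x) = (\<Sum>x\<in>UNIV. s\<^sup>2 * (u x)\<^sup>2 + 2 * s * (u x * w x) + (w x)\<^sup>2)"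
      unfolding q_def by (intro sum.cong) (simp_all add: power2_eq_square algebra_simps)
    also have "\<dots> = s\<^sup>2 * q u + 2 * s * (\<Sum>x\<in>UNIV. u x * w x) + q w"
      by (simp only: sum.distrib q_def sum_distrib_left)
    also have "\<dots> = poly ?p s" by (simp add: power2_eq_square algebra_simps)
    finally have "q (\<lambda>x. s * u x + 1 * w x) = 0" using s by simp
    moreover have "\<exists>x. s * u x + 1 * w x \<noteq> 0"
    proof (cases "s = 0")
      case True
      then show ?thesis using w(1) by simp
    next
      case False
      then show ?thesis using u(1) w(2) by (intro exI[of _ x0]) simp
    qed
    ultimately show ?thesis by blast
  qed
  then obtain s t where st: "q (\<lambda>x. s * u x + t * w x) = 0" "\<exists>x. s * u x + t * w x \<noteq> 0" by blast
  define v where "v x = s * u x + t * w x" for x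
  have qv: "q v = 0" and v0: "v \<noteq> (\<lambda>_. 0)" using st by (auto simp: v_def[abs_def] fun_eq_iff)
  have vE: "(\<Sum>x\<in>UNIV. v x * \<phi> e x) = 0" if "e \<in> E" for e
  proof -
    have "(\<Sum>x\<in>UNIV. v x * \<phi> e x) = s * (\<Sum>x\<in>UNIV. u x * \<phi> e x) + t * (\<Sum>x\<in>UNIV. w x * \<phi> e x)"
      by (simp add: v_def distrib_right sum.distrib sum_distrib_left mult.assoc)
    then show ?thesis using u(2)[OF that] wE[OF that] by simp
  qed
  have sv: "sum v UNIV = 0" using vE[of None] by (simp add: E_def \<phi>_def)
  define m where "m i = (\<Sum>x\<in>UNIV. l i x * v x)" for i
  have mA: "m i = 0" if "i \<in> A" for i
    using vE[of "Some i"] that by (simp add: E_def \<phi>_def m_def mult.commute)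
  have grad: "(\<Sum>i\<in>B. 6 * (m i)\<^sup>2 * l i z) = 0" for z
  proof -
    have "(\<Sum>x\<in>UNIV. \<Sum>y\<in>UNIV. v x * v y * coef3 F x y z) = 0"
      unfolding polar_lin[symmetric] polar_symmetric[OF T] sv using qv by (simp add: q_def power2_eq_square)
    moreover have "(\<Sum>x\<in>UNIV. \<Sum>y\<in>UNIV. v x * v y * coef3 F x y z) = (\<Sum>i<r. 6 * (m i)\<^sup>2 * l i z)"
    proof -
      have "(\<Sum>x\<in>UNIV. \<Sum>y\<in>UNIV. v x * v y * coef3 F x y z) =
          (\<Sum>x\<in>UNIV. \<Sum>y\<in>UNIV. \<Sum>i<r. 6 * (l i x * v x * (l i y * v y)) * l i z)"
        unfolding d3 sum_distrib_left by (intro sum.cong) (simp_all add: mult_ac)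
      also have "\<dots> = (\<Sum>i<r. \<Sum>x\<in>UNIV. \<Sum>y\<in>UNIV. 6 * (l i x * v x * (l i y * v y)) * l i z)"
        by (subst (2) sum.swap, subst sum.swap) (rule refl)
      also have "\<dots> = (\<Sum>i<r. 6 * (m i)\<^sup>2 * l i z)"
        unfolding m_def power2_eq_square sum_product sum_distrib_left sum_distrib_right
        by (intro sum.cong) (simp_all add: mult_ac)
      finally show ?thesis .
    qed
    moreover have "(\<Sum>i<r. 6 * (m i)\<^sup>2 * l i z) = (\<Sum>i\<in>B. 6 * (m i)\<^sup>2 * l i z)"
      using B(1) mA by (intro sum.mono_neutral_right) (auto simp: A_def)
    ultimately show ?thesis by simp
  qed
  have "m i = 0" if "i \<in> B" for i
    using spec[OF B(4), of "\<lambda>i. 6 * (m i)\<^sup>2"] grad that by simp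
  then have "v = (\<lambda>_. 0)" using spec[OF B(3), of v] by (simp add: m_def)
  with v0 show False by contradiction
qed

text \<open>In (p_1 + b v)^3 + (p_1 - b v)^3 the odd powers of v cancel. Over an orthonormal basis
  v_k of the hyperplane, with weights satisfying 2 a_k b_k^2 = \<beta>, the parts quadratic in v add
  up to the \<beta> part of F up to a constant, and the constant only prescribes the sum of the a_k.
  Each of the n - 1 basis vectors costs two cubes.\<close>

lemma line_quadric_decomposition:
  fixes F :: "('n::finite, 'a::{field_char_0, alg_closed_field}) mpoly"
  assumes T: "symmetric_tensor \<alpha> \<beta> 0 F" and n: "3 \<le> CARD('n)"
  obtains A :: "('n \<times> bool) set" and c p
  where "finite A" "card A = 2 * (CARD('n) - 1)" "decomposes F A c p"
proof -
  define N :: 'a where "N = of_nat CARD('n)"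
  have N0: "N \<noteq> 0" by (simp add: N_def)
  have Nneq: "N \<noteq> of_nat m" if "m < 3" for m
  proof
    assume "N = of_nat m"
    then have "CARD('n) = m" by (simp add: N_def)
    with n that show False by simp
  qed
  have N1: "N - 1 \<noteq> 0" and N2: "N - 2 \<noteq> 0" using Nneq[of 1] Nneq[of 2] by auto
  obtain o' :: 'n where True by blast
  define K where "K = UNIV - {o'}"
  have cK: "of_nat (card K) = N - 1" using n by (simp add: K_def card_Diff_singleton N_def of_nat_diff)
  obtain k0 :: 'n where k0: "k0 \<noteq> o'" using exists_two_distinct[OF n, of o'] by metis
  obtain \<nu> where \<nu>: "\<nu>\<^sup>2 = N" using nth_root_exists[where n = 2 and x = N] by auto
  have \<nu>0: "\<nu> \<noteq> 0" using \<nu> N0 by auto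
  \<comment> \<open>Orthogonality of the rows \<open>v k\<close> below to (1, ..., 1) demands 1 + (n
    - 1) s = 1 / \<nu>. They are the images of the unit vectors under the Householder reflection
    that takes the unit vector at \<open>o'\<close> to - (1, ..., 1) / \<nu>.\<close>
  define s where "s = (1 / \<nu> - 1) / (N - 1)"
  have s1: "1 + (N - 1) * s = 1 / \<nu>" using N1 by (simp add: s_def)
  have inv: "(1 / \<nu>) * (1 / \<nu>) = 1 / N" using \<nu> by (simp add: power2_eq_square)
  have s2: "2 * s + (N - 1) * s\<^sup>2 = - (1 / N)"
  proof -
    have "(N - 1) * (2 * s + (N - 1) * s\<^sup>2) = (1 + (N - 1) * s) * (1 + (N - 1) * s) - 1"
      by (simp add: power2_eq_square algebra_simps)
    also have "\<dots> = (N - 1) * (- (1 / N))" unfolding s1 inv using N0 by (simp add: field_simps)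
    finally show ?thesis unfolding mult_left_cancel[OF N1] .
  qed
  define v where "v k x = (if x = o' then - (1 / \<nu>) else (if k = x then 1 else 0) + s)" for k x
  \<comment> \<open>the rows \<open>v k\<close>, \<open>k \<noteq> o'\<close>, form an orthonormal basis of the hyperplane orthogonal to \<open>(1, \<dots>, 1)\<close>\<close>
  have vv: "(\<Sum>k\<in>K. v k x * v k y) = (if x = y then 1 else 0) - 1 / N" for x y
  proof -
    have finK: "finite K" by (simp add: K_def)
    have one: "(\<Sum>k\<in>K. (if k = x then 1 else 0) + s) = 1 / \<nu>" if "x \<noteq> o'" for x
      using that finK by (simp add: sum.distrib cK s1) (simp add: K_def s1)
    show ?thesis
    proof (cases "x = o'"; cases "y = o'")
      assume "x = o'" "y = o'"
      then show ?thesis using N0 by (simp add: v_def cK inv[simplified]) (simp add: field_simps)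
    next
      assume xy: "x = o'" "y \<noteq> o'"
      have "(\<Sum>k\<in>K. v k x * v k y) = - (1 / \<nu>) * (\<Sum>k\<in>K. (if k = y then 1 else 0) + s)"
        using xy by (simp add: v_def sum_distrib_left)
      then show ?thesis using xy one inv by auto
    next
      assume xy: "x \<noteq> o'" "y = o'"
      have "(\<Sum>k\<in>K. v k x * v k y) = - (1 / \<nu>) * (\<Sum>k\<in>K. (if k = x then 1 else 0) + s)"
        using xy by (simp add: v_def sum_distrib_left mult.commute)
      then show ?thesis using xy one inv by auto
    next
      assume xy: "x \<noteq> o'" "y \<noteq> o'"
      have "(\<Sum>k\<in>K. v k x * v k y) = (\<Sum>k\<in>K. (if k = x then if x = y then 1 else 0 else 0)
          + (if k = x then s else 0) + (if k = y then s else 0) + s\<^sup>2)"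
        using xy by (intro sum.cong) (auto simp: v_def power2_eq_square algebra_simps)
      also have "\<dots> = (if x = y then 1 else 0) + (2 * s + (N - 1) * s\<^sup>2)"
        using xy finK by (simp add: sum.distrib cK) (simp add: K_def)
      finally show ?thesis by (simp add: s2)
    qed
  qed
  define \<sigma> where "\<sigma> = (\<alpha> + 3 * \<beta> / N) / 2"
  \<comment> \<open>The weights \<open>a k\<close> have to be nonzero, since \<open>b k\<close>
    arises by dividing by them, and have to sum to \<sigma>. All but one of them are
    \<open>t\<close>; of the choices 1 and 2 for \<open>t\<close> at least one keeps the last weight
    nonzero, as N - 2 is not 0.\<close>
  obtain t where t: "t \<noteq> 0" "\<sigma> - (N - 2) * t \<noteq> 0"
  proof (cases "\<sigma> - (N - 2) * 1 = 0")
    case True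
    have "\<sigma> - (N - 2) * 2 = (\<sigma> - (N - 2) * 1) - (N - 2)" by (simp add: algebra_simps)
    with True N2 that[of 2] show thesis by simp
  next
    case False
    with that[of 1] show thesis by simp
  qed
  define a where "a k = (if k = k0 then \<sigma> - (N - 2) * t else t)" for k
  have a0: "a k \<noteq> 0" for k using t by (simp add: a_def)
  have suma: "(\<Sum>k\<in>K. a k) = \<sigma>"
  proof -
    have "(\<Sum>k\<in>K. a k) = (\<Sum>k\<in>K. t + (if k = k0 then \<sigma> - (N - 2) * t - t else 0))"
      by (intro sum.cong) (auto simp: a_def)
    also have "\<dots> = (N - 1) * t + (\<sigma> - (N - 2) * t - t)"
      using k0 by (simp add: sum.distrib cK) (simp add: K_def)
    finally show ?thesis by (simp add: algebra_simps)
  qed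
  have "\<exists>b. b\<^sup>2 = \<beta> / (2 * a k)" for k using nth_root_exists[of 2 "\<beta> / (2 * a k)"] by auto
  then obtain b where b: "\<And>k. (b k)\<^sup>2 = \<beta> / (2 * a k)" by metis
  define p where "p kb x = 1 + (if snd kb then b (fst kb) else - b (fst kb)) * v (fst kb) x" for kb x
  define A where "A = K \<times> (UNIV :: bool set)"
  have "decomposes F A (\<lambda>kb. a (fst kb)) p"
    unfolding decomposes_def
  proof (intro allI)
    fix x y z
    have "(\<Sum>kb\<in>A. a (fst kb) * (p kb x * p kb y * p kb z)) =
        (\<Sum>k\<in>K. \<Sum>c\<in>UNIV. a k * (p (k, c) x * p (k, c) y * p (k, c) z))"
      unfolding A_def by (subst sum.cartesian_product) (simp add: case_prod_unfold)
    also have "\<dots> = (\<Sum>k\<in>K. 2 * a k + \<beta> * (v k x * v k y + v k y * v k z + v k x * v k z))"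
    proof (intro sum.cong refl)
      fix k
      have "(\<Sum>c\<in>UNIV. a k * (p (k, c) x * p (k, c) y * p (k, c) z)) =
          2 * a k + 2 * a k * (b k)\<^sup>2 * (v k x * v k y + v k y * v k z + v k x * v k z)"
        by (simp add: UNIV_bool p_def power2_eq_square algebra_simps)
      also have "2 * a k * (b k)\<^sup>2 = \<beta>" using a0[of k] by (simp add: b)
      finally show "(\<Sum>c\<in>UNIV. a k * (p (k, c) x * p (k, c) y * p (k, c) z)) =
          2 * a k + \<beta> * (v k x * v k y + v k y * v k z + v k x * v k z)" .
    qed
    also have "\<dots> = 2 * \<sigma> + \<beta> * ((\<Sum>k\<in>K. v k x * v k y) + (\<Sum>k\<in>K. v k y * v k z) + (\<Sum>k\<in>K. v k x * v k z))"
      by (simp only: sum.distrib suma flip: sum_distrib_left)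
    also have "\<dots> = \<alpha> + \<beta> * ((if x = y then 1 else 0) + (if y = z then 1 else 0) + (if x = z then 1 else 0))"
      unfolding vv \<sigma>_def by (simp add: algebra_simps)
    finally show "coef3 F x y z = (\<Sum>kb\<in>A. a (fst kb) * (p kb x * p kb y * p kb z))"
      using T by (simp add: symmetric_tensor_def)
  qed
  moreover have "card A = 2 * (CARD('n) - 1)"
    by (simp add: A_def K_def card_cartesian_product card_Diff_singleton)
  ultimately show thesis using that[of A] by (simp add: A_def K_def)
qed

section \<open>Symmetric cubics\<close>

lemma bij_extending_inj_on:
  fixes f :: "'n::finite \<Rightarrow> 'n"
  assumes "inj_on f A"
  obtains \<pi> where "bij \<pi>" "\<forall>x\<in>A. \<pi> x = f x"
proof -
  have f: "bij_betw f A (f ` A)" using assms by (rule inj_on_imp_bij_betw)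
  have "card (- A) = card (- (f ` A))"
    using assms by (simp add: Compl_eq_Diff_UNIV card_Diff_subset card_image)
  then obtain g where g: "bij_betw g (- A) (- (f ` A))"
    using finite_same_card_bij[of "- A" "- (f ` A)"] by auto
  have "bij_betw (\<lambda>x. if x \<in> A then f x else g x) (A \<union> - A) (f ` A \<union> - (f ` A))"
    using f g by (rule bij_betw_disjoint_Un) auto
  then show ?thesis by (intro that[of "\<lambda>x. if x \<in> A then f x else g x"]) auto
qed

lemma coef3_permute:
  fixes F :: "('n::finite, 'a::field_char_0) mpoly"
  assumes F: "symmetric F" and \<pi>: "bij \<pi>"
  shows "coef3 F (\<pi> x) (\<pi> y) (\<pi> z) = coef3 F x y z"
proof -
  let ?m = "unit_exp (\<pi> x) + unit_exp (\<pi> y) + unit_exp (\<pi> z)"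
  have inj: "inj \<pi>" using \<pi> by (rule bij_is_inj)
  have m: "Poly_Mapping.map_key \<pi> ?m = unit_exp x + unit_exp y + unit_exp z"
    using inj by (simp add: map_key_plus)
  have "exp_fact (Poly_Mapping.map_key \<pi> ?m) = (\<Prod>i\<in>UNIV. fact (coef ?m (\<pi> i)) :: 'a)"
    unfolding exp_fact_def using inj by (simp add: map_key.rep_eq)
  also have "\<dots> = exp_fact ?m"
    unfolding exp_fact_def by (rule prod.reindex_bij_betw[OF \<pi>])
  finally have "exp_fact (unit_exp x + unit_exp y + unit_exp z) = (exp_fact ?m :: 'a)"
    unfolding m .
  moreover have "coef F (unit_exp x + unit_exp y + unit_exp z) = coef F ?m"
    using F \<pi> unfolding symmetric_def m[symmetric] by blast
  ultimately show ?thesis by (simp add: coef3_def dp_def)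
qed

lemma coef3_commute: "coef3 F x y z = coef3 F y x z" "coef3 F x y z = coef3 F x z y"
  by (simp_all add: coef3_def add_ac)

text \<open>Partial injections extend to permutations, so the tensor is constant on index triples of
  each equality type: all distinct, exactly two equal, all equal. These three values determine
  \<alpha>, \<beta> and \<gamma> successively.\<close>

lemma symmetric_imp_symmetric_tensor:
  fixes F :: "('n::finite, 'a::field_char_0) mpoly"
  assumes n: "3 \<le> CARD('n)" and F: "form 3 F" "symmetric F"
  obtains \<alpha> \<beta> \<gamma> where "symmetric_tensor \<alpha> \<beta> \<gamma> F"
proof -
  obtain c :: 'n where True by blast
  obtain a b where abc: "a \<noteq> b" "a \<noteq> c" "b \<noteq> c" by (rule exists_two_distinct[OF n])
  have distinct3: "coef3 F x y z = coef3 F a b c" if "x \<noteq> y" "x \<noteq> z" "y \<noteq> z" for x y z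
  proof -
    let ?f = "\<lambda>i. if i = a then x else if i = b then y else z"
    have "inj_on ?f {a, b, c}" using abc that by (auto simp: inj_on_def)
    then obtain \<pi> where "bij \<pi>" "\<forall>i\<in>{a, b, c}. \<pi> i = ?f i"
      by (rule bij_extending_inj_on)
    with coef3_permute[OF F(2), of \<pi> a b c] abc show ?thesis by simp
  qed
  have two: "coef3 F x x y = coef3 F a a b" if "x \<noteq> y" for x y
  proof -
    let ?f = "\<lambda>i. if i = a then x else y"
    have "inj_on ?f {a, b}" using abc that by (auto simp: inj_on_def)
    then obtain \<pi> where "bij \<pi>" "\<forall>i\<in>{a, b}. \<pi> i = ?f i"
      by (rule bij_extending_inj_on)
    with coef3_permute[OF F(2), of \<pi> a a b] abc show ?thesis by simp
  qed
  have one: "coef3 F x x x = coef3 F a a a" for x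
  proof -
    have "inj_on (\<lambda>_. x) {a}" by simp
    then obtain \<pi> where "bij \<pi>" "\<forall>i\<in>{a}. \<pi> i = x"
      by (rule bij_extending_inj_on)
    with coef3_permute[OF F(2), of \<pi> a a a] show ?thesis by simp
  qed
  define \<alpha> where "\<alpha> = coef3 F a b c"
  define \<beta> where "\<beta> = coef3 F a a b - \<alpha>"
  define \<gamma> where "\<gamma> = coef3 F a a a - \<alpha> - 3 * \<beta>"
  have "symmetric_tensor \<alpha> \<beta> \<gamma> F"
    unfolding symmetric_tensor_def
  proof (intro conjI allI)
    fix x y z :: 'n
    consider "x = y" "y = z" | "x = y" "y \<noteq> z" | "x = z" "y \<noteq> z" | "y = z" "x \<noteq> y"
      | "x \<noteq> y" "x \<noteq> z" "y \<noteq> z" by blast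
    then show "coef3 F x y z =
        \<alpha> + \<beta> * ((if x = y then 1 else 0) + (if y = z then 1 else 0) + (if x = z then 1 else 0))
        + \<gamma> * (if x = y \<and> y = z then 1 else 0)"
    proof cases
      case 1
      then show ?thesis using one[of z] by (simp add: \<gamma>_def)
    next
      case 2
      then show ?thesis using two[of y z] by (simp add: \<beta>_def)
    next
      case 3
      then have "coef3 F x y z = coef3 F z z y" by (simp add: coef3_commute(2))
      with 3 two[of z y] show ?thesis by (auto simp: \<beta>_def)
    next
      case 4
      then have "coef3 F x y z = coef3 F z z x" using coef3_commute by metis
      with 4 two[of z x] show ?thesis by (auto simp: \<beta>_def)
    next
      case 5
      then show ?thesis using distinct3[of x y z] by (simp add: \<alpha>_def)
    qed
  qed (rule F(1))
  then show ?thesis by (rule that)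
qed

lemma symmetric_tensor_unique:
  fixes F :: "('n::finite, 'a::field_char_0) mpoly"
  assumes n: "3 \<le> CARD('n)" and "symmetric_tensor \<alpha> \<beta> \<gamma> F" "symmetric_tensor \<alpha>' \<beta>' \<gamma>' F"
  shows "\<beta> = \<beta>'" "\<gamma> = \<gamma>'"
proof -
  have eq: "\<alpha> + \<beta> * ((if x = y then 1 else 0) + (if y = z then 1 else 0) + (if x = z then 1 else 0))
        + \<gamma> * (if x = y \<and> y = z then 1 else 0) =
      \<alpha>' + \<beta>' * ((if x = y then 1 else 0) + (if y = z then 1 else 0) + (if x = z then 1 else 0))
        + \<gamma>' * (if x = y \<and> y = z then 1 else 0)" for x y z :: 'n
    using assms(2,3) unfolding symmetric_tensor_def by metis
  obtain c :: 'n where True by blast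
  obtain a b where abc: "a \<noteq> b" "a \<noteq> c" "b \<noteq> c" by (rule exists_two_distinct[OF n])
  have 1: "\<alpha> = \<alpha>'" using eq[of a b c] abc by simp
  then show 2: "\<beta> = \<beta>'" using eq[of a a b] abc by simp
  show "\<gamma> = \<gamma>'" using eq[of a a a] 1 2 by simp
qed

section \<open>The exceptional forms in terms of power sums\<close>

lemma power_sum_1_eq: "power_sum 1 = lin (\<lambda>_. 1)"
  by (simp add: power_sum_def lin_one)

text \<open>The identity (p + v)^3 + (p - v)^3 - 2 p^3 = 6 p v^2, summed over the variables v, turns
  the product into a combination of cubes, whose tensors are known.\<close>

lemma coef3_p1p2:
  "coef3 (power_sum 1 * power_sum 2 :: ('n::finite, 'a::field_char_0) mpoly) x y z =
     2 * ((if x = y then 1 else 0) + (if y = z then 1 else 0) + (if x = z then 1 else 0))"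
proof -
  let ?p = "lin (\<lambda>_. 1) :: ('n, 'a) mpoly"
  let ?e = "\<lambda>i k. if k = i then 1 else 0 :: 'a"
  have polarised: "(p + v) ^ 3 + (p - v) ^ 3 - 2 * p ^ 3 = 6 * (p * v\<^sup>2)" for p v :: "('n, 'a) mpoly"
    by (simp add: power3_eq_cube power2_eq_square algebra_simps)
  have "6 * (power_sum 1 * power_sum 2) = (\<Sum>i\<in>UNIV. 6 * (?p * Var i ^ 2))"
    unfolding power_sum_1_eq by (simp add: power_sum_def sum_distrib_left)
  also have "\<dots> = (\<Sum>i\<in>UNIV. lin (\<lambda>k. 1 + ?e i k) ^ 3 + lin (\<lambda>k. 1 - ?e i k) ^ 3 - 2 * ?p ^ 3)"
    unfolding lin_add lin_diff lin_delta polarised ..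
  finally have eq: "scale 6 (power_sum 1 * power_sum 2) =
      (\<Sum>i\<in>UNIV. lin (\<lambda>k. 1 + ?e i k) ^ 3 + lin (\<lambda>k. 1 - ?e i k) ^ 3 + scale (- 2) (?p ^ 3))"
    using of_nat_mult_eq_scale[of 6 "power_sum 1 * power_sum 2 :: ('n, 'a) mpoly"]
      of_nat_mult_eq_scale[of 2 "?p ^ 3"] by simp
  have "6 * coef3 (power_sum 1 * power_sum 2 :: ('n, 'a) mpoly) x y z =
      coef3 (scale 6 (power_sum 1 * power_sum 2 :: ('n, 'a) mpoly)) x y z" by (simp add: coef3_scale)
  also have "\<dots> = (\<Sum>i\<in>UNIV. 6 * (1 + ?e i x) * (1 + ?e i y) * (1 + ?e i z)
      + 6 * (1 - ?e i x) * (1 - ?e i y) * (1 - ?e i z) - 12)"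
    unfolding eq coef3_sum coef3_add coef3_scale coef3_lin_cube by simp
  also have "\<dots> = (\<Sum>i\<in>UNIV. 12 * ((if i = x then ?e y x else 0) + (if i = y then ?e z y else 0)
      + (if i = x then ?e z x else 0)))"
    by (intro sum.cong) auto
  also have "\<dots> = 12 * (?e y x + ?e z y + ?e z x)"
    by (simp add: sum.distrib flip: sum_distrib_left)
  also have "\<dots> = 6 * (2 * (?e y x + ?e z y + ?e z x))"
    by (simp only: mult.assoc[symmetric]) simp
  finally show ?thesis by (rule mult_left_cancel[THEN iffD1, rotated]) simp
qed

lemma symmetric_tensor_cubic_p1p2:
  "symmetric_tensor (6 * a0) (2 * (a1 * of_nat CARD('n))) 0
     (cubic_p1p2 a0 a1 :: ('n::finite, 'a::field_char_0) mpoly)"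
proof -
  have "form 1 (power_sum 1 :: ('n, 'a) mpoly)" unfolding power_sum_1_eq by simp
  moreover have "form 2 (power_sum 2 :: ('n, 'a) mpoly)"
    unfolding power_sum_def using form_power[OF form_Var, of 2] by (intro form_sum) simp
  ultimately have "form 3 (power_sum 1 ^ 3 :: ('n, 'a) mpoly)"
    "form 3 (power_sum 1 * power_sum 2 :: ('n, 'a) mpoly)"
    using form_power[of 1 "power_sum 1 :: ('n, 'a) mpoly" 3]
      form_mult[of 1 "power_sum 1 :: ('n, 'a) mpoly" 2 "power_sum 2"] by (simp_all add: numeral_3_eq_3)
  moreover have eq: "cubic_p1p2 a0 a1 = scale a0 (power_sum 1 ^ 3)
      + scale (a1 * of_nat CARD('n)) (power_sum 1 * power_sum 2 :: ('n, 'a) mpoly)"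
    by (simp add: cubic_p1p2_def scale_def mult.assoc)
  ultimately have "form 3 (cubic_p1p2 a0 a1 :: ('n, 'a) mpoly)"
    unfolding eq by (intro form_add form_scale)
  moreover have "coef3 (power_sum 1 ^ 3 :: ('n, 'a) mpoly) x y z = 6" for x y z
    unfolding power_sum_1_eq coef3_lin_cube by simp
  ultimately show ?thesis
    unfolding symmetric_tensor_def unfolding eq coef3_add coef3_scale coef3_p1p2
    by (simp add: mult_ac)
qed

lemma exceptional_iff:
  fixes F :: "('n::finite, 'a::field_char_0) mpoly"
  assumes n: "3 \<le> CARD('n)" and T: "symmetric_tensor \<alpha> \<beta> \<gamma> F"
  shows "(\<exists>a0 a1. a1 \<noteq> 0 \<and> F = cubic_p1p2 a0 a1) \<longleftrightarrow> \<gamma> = 0 \<and> \<beta> \<noteq> 0"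
proof
  assume "\<exists>a0 a1. a1 \<noteq> 0 \<and> F = cubic_p1p2 a0 a1"
  then obtain a0 a1 where a1: "a1 \<noteq> 0" and F: "F = cubic_p1p2 a0 a1" by blast
  from symmetric_tensor_cubic_p1p2[of a0 a1] T[unfolded F]
  have "\<beta> = 2 * (a1 * of_nat CARD('n))" "\<gamma> = 0"
    using symmetric_tensor_unique[OF n] by blast+
  with a1 show "\<gamma> = 0 \<and> \<beta> \<noteq> 0" by simp
next
  assume \<beta>\<gamma>: "\<gamma> = 0 \<and> \<beta> \<noteq> 0"
  define a1 where "a1 = \<beta> / (2 * of_nat CARD('n))"
  have "2 * (a1 * of_nat CARD('n)) = \<beta>" by (simp add: a1_def)
  with symmetric_tensor_cubic_p1p2[of "\<alpha> / 6" a1, where ?'n = 'n]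
  have C: "symmetric_tensor \<alpha> \<beta> 0 (cubic_p1p2 (\<alpha> / 6) a1 :: ('n, 'a) mpoly)" by simp
  have "F = cubic_p1p2 (\<alpha> / 6) a1"
    by (rule cubic_eqI) (use T C \<beta>\<gamma> in \<open>simp_all add: symmetric_tensor_def\<close>)
  moreover have "a1 \<noteq> 0" using \<beta>\<gamma> by (simp add: a1_def)
  ultimately show "\<exists>a0 a1. a1 \<noteq> 0 \<and> F = cubic_p1p2 a0 a1" by blast
qed

section \<open>Comparison of the ranks over the ground field and its closure\<close>

lemma symmetric_tensor_to_closure:
  fixes F :: "('n::finite, 'a::field_char_0) mpoly"
  assumes "symmetric_tensor \<alpha> \<beta> \<gamma> F"
  shows "symmetric_tensor (to_ac \<alpha>) (to_ac \<beta>) (to_ac \<gamma>) (to_closure F)"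
proof -
  have coef: "coef (to_closure F) a = to_ac (coef F a)" for a
    by (simp add: to_closure_def map.rep_eq when_def)
  have fact: "to_ac (fact m :: 'a) = fact m" for m
    using to_ac_of_nat[of "fact m", where ?'a = 'a] by (simp del: to_ac_of_nat)
  have "coef3 (to_closure F) x y z = to_ac (coef3 F x y z)" for x y z
    by (simp add: coef3_def dp_def coef exp_fact_def to_ac_prod fact)
  moreover have "form 3 (to_closure F)"
    using assms by (simp add: symmetric_tensor_def form_iff coef)
  ultimately show ?thesis using assms unfolding symmetric_tensor_def by (simp add: if_distrib)
qed

text \<open>Expanding the cubes of \<gamma> X_i + \<beta> p_1 and dividing by the square of \<gamma>
  reproduces the \<beta> and \<gamma> parts of the tensor. The constant part misses \<alpha> by
  \<open>M\<close>, which becomes the coefficient of the cube of p_1.\<close>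

lemma fermat_decomposition:
  fixes F :: "('n::finite, 'a::field_char_0) mpoly"
  assumes T: "symmetric_tensor \<alpha> \<beta> \<gamma> F" and \<gamma>: "\<gamma> \<noteq> 0"
  obtains A :: "'n option set" and c p where "decomposes F A c p"
    "card A = (if \<alpha> * \<gamma>\<^sup>2 = 3 * \<gamma> * \<beta>\<^sup>2 + of_nat CARD('n) * \<beta> ^ 3 then CARD('n) else CARD('n) + 1)"
proof -
  define N :: 'a where "N = of_nat CARD('n)"
  define M where "M = (\<alpha> * \<gamma>\<^sup>2 - (3 * \<gamma> * \<beta>\<^sup>2 + N * \<beta> ^ 3)) / \<gamma>\<^sup>2"
  define A :: "'n option set" where "A = (if M = 0 then range Some else UNIV)"
  define c where "c j = (case j of None \<Rightarrow> M | Some i \<Rightarrow> 1 / \<gamma>\<^sup>2)" for j :: "'n option"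
  define p where "p j k = (case j of None \<Rightarrow> 1 | Some i \<Rightarrow> (if k = i then \<gamma> else 0) + \<beta>)" for j and k :: 'n
  have cubes: "(\<Sum>i\<in>UNIV. p (Some i) x * p (Some i) y * p (Some i) z) =
      \<gamma> ^ 3 * (if x = y \<and> y = z then 1 else 0)
      + \<gamma>\<^sup>2 * \<beta> * ((if x = y then 1 else 0) + (if y = z then 1 else 0) + (if x = z then 1 else 0))
      + 3 * \<gamma> * \<beta>\<^sup>2 + N * \<beta> ^ 3" for x y z
  proof -
    have "(\<Sum>i\<in>UNIV. p (Some i) x * p (Some i) y * p (Some i) z) =
        (\<Sum>i\<in>UNIV. (if i = x then if x = y \<and> y = z then \<gamma> ^ 3 else 0 else 0)
          + (if i = x then if x = y then \<gamma>\<^sup>2 * \<beta> else 0 else 0)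
          + (if i = y then if y = z then \<gamma>\<^sup>2 * \<beta> else 0 else 0)
          + (if i = x then if x = z then \<gamma>\<^sup>2 * \<beta> else 0 else 0)
          + (if i = x then \<gamma> * \<beta>\<^sup>2 else 0) + (if i = y then \<gamma> * \<beta>\<^sup>2 else 0)
          + (if i = z then \<gamma> * \<beta>\<^sup>2 else 0) + \<beta> ^ 3)"
      by (intro sum.cong) (auto simp: p_def power2_eq_square power3_eq_cube algebra_simps)
    then show ?thesis by (simp add: sum.distrib N_def) 
  qed
  have "decomposes F A c p"
    unfolding decomposes_def
  proof (intro allI)
    fix x y z
    have "(\<Sum>j\<in>A. c j * (p j x * p j y * p j z)) = (\<Sum>j\<in>UNIV. c j * (p j x * p j y * p j z))"
    proof (rule sum.mono_neutral_left)
      show "\<forall>j\<in>UNIV - A. c j * (p j x * p j y * p j z) = 0"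
      proof
        fix j assume "j \<in> UNIV - A"
        then have "j = None \<and> M = 0" by (cases j) (auto simp: A_def split: if_splits)
        then show "c j * (p j x * p j y * p j z) = 0" by (simp add: c_def)
      qed
    qed auto
    also have "\<dots> = M + 1 / \<gamma>\<^sup>2 * (\<Sum>i\<in>UNIV. p (Some i) x * p (Some i) y * p (Some i) z)"
      unfolding UNIV_option_conv
      by (subst sum.insert) (auto simp: sum.reindex c_def sum_distrib_left p_def)
    also have "\<dots> = coef3 F x y z"
      using T \<gamma> unfolding cubes symmetric_tensor_def M_def
      by (simp add: field_simps power2_eq_square power3_eq_cube)
    finally show "coef3 F x y z = (\<Sum>j\<in>A. c j * (p j x * p j y * p j z))" by simp
  qed
  moreover have "M = 0 \<longleftrightarrow> \<alpha> * \<gamma>\<^sup>2 = 3 * \<gamma> * \<beta>\<^sup>2 + of_nat CARD('n) * \<beta> ^ 3"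
    using \<gamma> by (simp add: M_def N_def)
  then have "card A = (if \<alpha> * \<gamma>\<^sup>2 = 3 * \<gamma> * \<beta>\<^sup>2 + of_nat CARD('n) * \<beta> ^ 3 then CARD('n) else CARD('n) + 1)"
    by (simp add: A_def card_image card_UNIV_option)
  ultimately show thesis by (rule that)
qed

lemma cactus_lower_bound_fermat:
  fixes F :: "('n::finite, 'a::field_char_0) mpoly"
  assumes T: "symmetric_tensor \<alpha> \<beta> \<gamma> F" and n: "3 \<le> CARD('n)" and \<gamma>: "\<gamma> \<noteq> 0"
    and n_\<gamma>: "4 \<le> CARD('n) \<or> \<gamma> + of_nat CARD('n) * \<beta> \<noteq> 0"
    and Z: "zero_dim_subscheme_ideal r I" "I \<subseteq> annihilator F"
  shows "(if \<alpha> * \<gamma>\<^sup>2 = 3 * \<gamma> * \<beta>\<^sup>2 + of_nat CARD('n) * \<beta> ^ 3 then CARD('n) else CARD('n) + 1) \<le> r"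
proof (cases "\<gamma> + of_nat CARD('n) * \<beta> = 0")
  case False
  then show ?thesis using cactus_lower_bound_generic[OF T n \<gamma> False Z] by simp
next
  case True
  define N :: 'a where "N = of_nat CARD('n)"
  have n4: "4 \<le> CARD('n)" using n_\<gamma> True by blast
  have N0: "N \<noteq> 0" by (simp add: N_def)
  have \<gamma>_eq: "\<gamma> = - (N * \<beta>)" using True by (simp add: N_def add_eq_0_iff)
  then have \<beta>: "\<beta> \<noteq> 0" using \<gamma> by auto
  \<comment> \<open>Substituting \<gamma> = - n \<beta> factors the condition, so the two values of
    \<open>m + 1\<close> in the degenerate bound match the two numbers of cubes.\<close>
  have "\<alpha> * \<gamma>\<^sup>2 - (3 * \<gamma> * \<beta>\<^sup>2 + N * \<beta> ^ 3) = N * \<beta>\<^sup>2 * (\<alpha> * N + 2 * \<beta>)"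
    unfolding \<gamma>_eq by (simp add: power2_eq_square power3_eq_cube algebra_simps)
  then have "\<alpha> * \<gamma>\<^sup>2 = 3 * \<gamma> * \<beta>\<^sup>2 + N * \<beta> ^ 3 \<longleftrightarrow> \<alpha> * N + 2 * \<beta> = 0"
    using N0 \<beta> by (metis (no_types, lifting) eq_iff_diff_eq_0 mult_eq_0_iff power_eq_0_iff)
  with cactus_lower_bound_degenerate(2)[OF T n \<beta> True Z n4] n show ?thesis
    by (auto simp: N_def split: if_splits)
qed

text \<open>The bound on schemes over the closure yields the Waring lower bound, because every
  decomposition there gives an apolar scheme; the cactus rank itself is computed over k.\<close>

lemma cactus_waring_eqI:
  fixes F :: "('n::finite, 'a::field_char_0) mpoly"
  assumes F: "form 3 (to_closure F)" and up: "has_apolar_scheme m F"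
    and low: "\<And>r I. zero_dim_subscheme_ideal r I \<Longrightarrow> I \<subseteq> annihilator F \<Longrightarrow> m \<le> r"
    and low': "\<And>r I. zero_dim_subscheme_ideal r I \<Longrightarrow> I \<subseteq> annihilator (to_closure F) \<Longrightarrow> m \<le> r"
    and dec: "decomposes (to_closure F) A c p" "finite A" "card A = m"
  shows "cactus_rank F = waring_rank 3 (to_closure F)"
proof -
  have "cactus_rank F = m" using up low by (rule cactus_rank_eqI)
  moreover have "waring_rank 3 (to_closure F) = card A"
  proof (rule waring_rank_eqI[OF F dec(2,1)])
    fix r :: nat and l assume "decomposes (to_closure F) {..<r} (\<lambda>_. 6) l"
    then have "has_apolar_scheme r (to_closure F)"
      using has_apolar_scheme_decomposes[OF F, of "{..<r}"] by simp
    then obtain r' I where "r' \<le> r" "zero_dim_subscheme_ideal r' I" "I \<subseteq> annihilator (to_closure F)"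
      by (auto simp: has_apolar_scheme_def)
    with low' show "card A \<le> r" using dec(3) le_trans by blast
  qed
  ultimately show ?thesis using dec(3) by simp
qed

text \<open>A scheme of degree 0 has Hilbert function 0 in degree 3, so its ideal would contain all
  cubic forms, although one of them does not annihilate F.\<close>

lemma cactus_lower_bound_nonzero:
  fixes F :: "('n::finite, 'a::field_char_0) mpoly"
  assumes Z: "zero_dim_subscheme_ideal r I" "I \<subseteq> annihilator F" and "coef3 F x y z \<noteq> 0"
  shows "1 \<le> r"
proof (rule ccontr)
  assume "\<not> 1 \<le> r"
  then have "hilbert_function I 3 \<le> card {}" using hilbert_function_le_degree[OF Z(1), of 3] by simp
  moreover have I: "is_ideal I"
    using Z by (auto simp: zero_dim_subscheme_ideal_def homogeneous_ideal_def)
  then have "indep_at I 3 {}" by (simp add: indep_at_def)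
  moreover have "form 3 (Var z * (Var x * Var y) :: ('n, 'a) mpoly)"
    using form_mult[OF form_Var form_mult[OF form_Var form_Var], of z x y]
    by (simp add: numeral_3_eq_3)
  ultimately have "Var z * (Var x * Var y) \<in> I"
    using spanning_at[OF I, of 3 "{}"] by auto
  then have "Var z * (Var x * Var y) \<in> annihilator F" using Z(2) by blast
  then have "pairing (dp F) (xpow 0 * (Var z * (Var x * Var y))) = 0"
    unfolding annihilator_iff by blast
  then show False using assms(3) by (simp add: Var_def mult_single coef3_def add_ac)
qed

text \<open>The tensor depends only on \<open>rho x + rho y + rho z\<close> modulo 3. Its discrete
  Fourier expansion in powers of \<omega> is a combination of cubes, as a character of the sum is a
  product of characters; the trivial character has coefficient (3 \<alpha> + 2 \<beta>) / 3.\<close>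

lemma ternary_decomposition:
  fixes F :: "('n::finite, 'a::{field_char_0, alg_closed_field}) mpoly"
  assumes T: "symmetric_tensor \<alpha> \<beta> (- (3 * \<beta>)) F" and n: "CARD('n) = 3"
  obtains A :: "nat set" and c p where "decomposes F A c p" "finite A"
    "card A = (if 3 * \<alpha> + 2 * \<beta> = 0 then 2 else 3)"
proof -
  obtain p0 q0 r0 :: 'n where pqr: "UNIV = {p0, q0, r0}" "p0 \<noteq> q0" "p0 \<noteq> r0" "q0 \<noteq> r0"
    using n by (auto simp: card_3_iff)
  define rho :: "'n \<Rightarrow> nat" where "rho x = (if x = p0 then 0 else if x = q0 then 1 else 2)" for x
  have rho: "rho p0 = 0" "rho q0 = 1" "rho r0 = 2" using pqr by (simp_all add: rho_def)
  have "degree [:1, 1, 1 :: 'a:] > 0" by simp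
  then obtain \<omega> :: 'a where "poly [:1, 1, 1:] \<omega> = 0" using alg_closed_imp_poly_has_root by blast
  then have \<omega>: "1 + \<omega> + \<omega>\<^sup>2 = 0" by (simp add: power2_eq_square algebra_simps)
  have "\<omega> ^ 3 - 1 = (\<omega> - 1) * (1 + \<omega> + \<omega>\<^sup>2)"
    by (simp add: power2_eq_square power3_eq_cube algebra_simps)
  then have \<omega>3: "\<omega> ^ 3 = 1" using \<omega> by simp
  have \<omega>mod: "\<omega> ^ k = \<omega> ^ (k mod 3)" for k
  proof -
    have "\<omega> ^ (3 * (k div 3) + k mod 3) = \<omega> ^ (k mod 3)"
      by (simp only: power_add power_mult \<omega>3) simp
    then show ?thesis by simp
  qed
  have \<omega>sum: "\<omega> ^ k + \<omega> ^ (2 * k) = (if k mod 3 = 0 then 2 else - 1)" for k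
  proof -
    have "\<omega> ^ (2 * k) = (\<omega> ^ k)\<^sup>2" by (simp add: power_mult mult.commute flip: power_mult)
    then have e: "\<omega> ^ k + \<omega> ^ (2 * k) = \<omega> ^ (k mod 3) + (\<omega> ^ (k mod 3))\<^sup>2"
      using \<omega>mod[of k] by simp
    have s: "\<omega> + \<omega>\<^sup>2 = - 1" using \<omega> by (metis add.assoc eq_neg_iff_add_eq_0 add.commute)
    have "\<omega> ^ 4 = \<omega>" using \<omega>mod[of 4] by simp
    then have s': "\<omega>\<^sup>2 + (\<omega>\<^sup>2)\<^sup>2 = - 1" using s by (simp add: add.commute flip: power_mult)
    have "k mod 3 = 0 \<or> k mod 3 = 1 \<or> k mod 3 = 2" by presburger
    then show ?thesis unfolding e using s s' by auto
  qed
  define A :: "nat set" where "A = (if 3 * \<alpha> + 2 * \<beta> = 0 then {1, 2} else {0, 1, 2})"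
  define c where "c i = (if i = 0 then (3 * \<alpha> + 2 * \<beta>) / 3 else - \<beta> / 3)" for i :: nat
  define p where "p i x = \<omega> ^ (i * rho x)" for i x
  have "decomposes F A c p"
    unfolding decomposes_def
  proof (intro allI)
    fix x y z
    define k where "k = rho x + rho y + rho z"
    have pk: "p i x * p i y * p i z = \<omega> ^ (i * k)" for i
      by (simp add: p_def k_def power_add distrib_left)
    have "(\<Sum>i\<in>A. c i * (p i x * p i y * p i z)) = c 0 + c 1 * \<omega> ^ k + c 2 * \<omega> ^ (2 * k)"
      by (simp add: A_def pk) (simp add: c_def)
    also have "\<dots> = c 0 - \<beta> / 3 * (\<omega> ^ k + \<omega> ^ (2 * k))" by (simp add: c_def algebra_simps)
    also have "\<dots> = coef3 F x y z"
      unfolding coef3_ternary[OF pqr rho T] \<omega>sum by (simp add: c_def k_def field_simps)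
    finally show "coef3 F x y z = (\<Sum>i\<in>A. c i * (p i x * p i y * p i z))" by simp
  qed
  then show thesis by (rule that) (simp_all add: A_def)
qed

lemma cactus_lower_bound_ternary:
  fixes F :: "('n::finite, 'a::field_char_0) mpoly"
  assumes T: "symmetric_tensor \<alpha> \<beta> (- (3 * \<beta>)) F" and n: "CARD('n) = 3" and \<beta>: "\<beta> \<noteq> 0"
    and Z: "zero_dim_subscheme_ideal r I" "I \<subseteq> annihilator F"
  shows "(if 3 * \<alpha> + 2 * \<beta> = 0 then 2 else 3) \<le> r"
  using cactus_lower_bound_degenerate(1)[OF T _ \<beta> _ Z] n by (simp add: mult.commute split: if_splits)

theorem corollary4p9:
  fixes F :: "('n::finite, 'a::field_char_0) mpoly"
  assumes "CARD('n) \<ge> 3"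
    and "form 3 F"
    and "symmetric F"
  shows "(\<not> (CARD('n) \<ge> 4 \<and> (\<exists>a0 a1. a1 \<noteq> 0 \<and> F = cubic_p1p2 a0 a1)) \<longrightarrow>
            cactus_rank F = waring_rank 3 (to_closure F))
       \<and> (CARD('n) \<ge> 4 \<and> (\<exists>a0 a1. a1 \<noteq> 0 \<and> F = cubic_p1p2 a0 a1) \<longrightarrow>
            cactus_rank F = CARD('n) + 1 \<and>
            CARD('n) + 1 < 2 * (CARD('n) - 1) \<and>
            waring_rank 3 (to_closure F) = 2 * (CARD('n) - 1))"
proof -
  note n = assms(1)
  obtain \<alpha> \<beta> \<gamma> where T: "symmetric_tensor \<alpha> \<beta> \<gamma> F"
    using assms by (rule symmetric_imp_symmetric_tensor)
  note T' = symmetric_tensor_to_closure[OF T]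
  have F': "form 3 (to_closure F)" using T' by (simp add: symmetric_tensor_def)
  have ex: "(\<exists>a0 a1. a1 \<noteq> 0 \<and> F = cubic_p1p2 a0 a1) \<longleftrightarrow> \<gamma> = 0 \<and> \<beta> \<noteq> 0"
    using n T by (rule exceptional_iff)
  consider "\<gamma> = 0" "\<beta> \<noteq> 0" | "\<gamma> = 0" "\<beta> = 0" | "\<gamma> \<noteq> 0" by blast
  then show ?thesis
  proof cases
    case 1
    have T0: "symmetric_tensor \<alpha> \<beta> 0 F" using T 1 by simp
    have T0': "symmetric_tensor (to_ac \<alpha>) (to_ac \<beta>) 0 (to_closure F)" using T' 1 by simp
    have cr: "cactus_rank F = CARD('n) + 1"
    proof (rule cactus_rank_eqI)
      show "has_apolar_scheme (CARD('n) + 1) F"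
        using has_apolar_scheme_line_quadric[OF T0] n by simp
      show "CARD('n) + 1 \<le> r" if "zero_dim_subscheme_ideal r I" "I \<subseteq> annihilator F" for r I
        using cactus_lower_bound_line_quadric[OF T0 n 1(2) that] .
    qed
    obtain A :: "('n \<times> bool) set" and c p where
      A: "finite A" "card A = 2 * (CARD('n) - 1)" "decomposes (to_closure F) A c p"
      by (rule line_quadric_decomposition[OF T0' n])
    have wr: "waring_rank 3 (to_closure F) = 2 * (CARD('n) - 1)"
      unfolding A(2)[symmetric]
    proof (rule waring_rank_eqI[OF F' A(1,3)])
      fix r :: nat and l assume "decomposes (to_closure F) {..<r} (\<lambda>_. 6) l"
      then show "card A \<le> r"
        using waring_lower_bound_line_quadric[OF T0' n] 1(2) A(2) by simp
    qed
    \<comment> \<open>For n = 3 both ranks are 4 and agree; the strict inequality begins at n =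
      4.\<close>
    show ?thesis using cr wr n 1 ex by auto
  next
    case 2
    have c3: "coef3 F x y z = \<alpha>" and c3': "coef3 (to_closure F) x y z = to_ac \<alpha>" for x y z
      using T T' 2 by (simp_all add: symmetric_tensor_def)
    \<comment> \<open>F is a multiple of the cube of p_1; the empty index set covers F = 0, where
      both ranks are 0.\<close>
    define A where "A = (if \<alpha> = 0 then {} else {()})"
    have "cactus_rank F = waring_rank 3 (to_closure F)"
    proof (rule cactus_waring_eqI[OF F'])
      show "decomposes (to_closure F) A (\<lambda>_. to_ac \<alpha>) (\<lambda>_ _. 1)" "finite A"
        by (simp_all add: decomposes_def c3' A_def)
      have "decomposes F A (\<lambda>_. \<alpha>) (\<lambda>_ _. 1)" by (simp add: decomposes_def c3 A_def)
      then show "has_apolar_scheme (card A) F"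
        using \<open>finite A\<close> assms(2) by (intro has_apolar_scheme_decomposes)
      show "card A \<le> r" if "zero_dim_subscheme_ideal r I" "I \<subseteq> annihilator F" for r I
        using cactus_lower_bound_nonzero[OF that] c3 by (auto simp: A_def)
      show "card A \<le> r" if "zero_dim_subscheme_ideal r I" "I \<subseteq> annihilator (to_closure F)" for r I
        using cactus_lower_bound_nonzero[OF that] c3' by (auto simp: A_def)
    qed simp
    moreover have "\<not> (\<exists>a0 a1. a1 \<noteq> 0 \<and> F = cubic_p1p2 a0 a1)" using ex 2 by blast
    ultimately show ?thesis by blast
  next
    case 3
    have "cactus_rank F = waring_rank 3 (to_closure F)"
    proof (cases "4 \<le> CARD('n) \<or> \<gamma> + of_nat CARD('n) * \<beta> \<noteq> 0")
      case True
      define m where "m = (if \<alpha> * \<gamma>\<^sup>2 = 3 * \<gamma> * \<beta>\<^sup>2 + of_nat CARD('n) * \<beta> ^ 3 then CARD('n) else CARD('n) + 1)"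
      have ac_eq: "to_ac x = to_ac y \<longleftrightarrow> x = y" for x y :: 'a by simp
      have "to_ac \<alpha> * (to_ac \<gamma>)\<^sup>2 = 3 * to_ac \<gamma> * (to_ac \<beta>)\<^sup>2 + of_nat CARD('n) * to_ac \<beta> ^ 3 \<longleftrightarrow>
          to_ac (\<alpha> * \<gamma>\<^sup>2) = to_ac (3 * \<gamma> * \<beta>\<^sup>2 + of_nat CARD('n) * \<beta> ^ 3)"
        by (simp del: to_ac_eq_iff)
      then have m': "m = (if to_ac \<alpha> * (to_ac \<gamma>)\<^sup>2 = 3 * to_ac \<gamma> * (to_ac \<beta>)\<^sup>2
          + of_nat CARD('n) * to_ac \<beta> ^ 3 then CARD('n) else CARD('n) + 1)"
        unfolding ac_eq m_def by simp
      have "to_ac \<gamma> + of_nat CARD('n) * to_ac \<beta> = to_ac (\<gamma> + of_nat CARD('n) * \<beta>)" by simp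
      then have True': "4 \<le> CARD('n) \<or> to_ac \<gamma> + of_nat CARD('n) * to_ac \<beta> \<noteq> 0"
        using True by (simp only: to_ac_eq_0_iff)
      have \<gamma>': "to_ac \<gamma> \<noteq> 0" using 3 by simp
      obtain A :: "'n option set" and c p where A: "decomposes F A c p" "card A = m"
        using fermat_decomposition[OF T 3] unfolding m_def .
      obtain A' :: "'n option set" and c' p' where A': "decomposes (to_closure F) A' c' p'" "card A' = m"
        using fermat_decomposition[OF T' \<gamma>'] unfolding m' .
      show ?thesis
      proof (rule cactus_waring_eqI[OF F' _ _ _ A'(1) finite A'(2)])
        show "has_apolar_scheme m F"
          using has_apolar_scheme_decomposes[OF assms(2) finite A(1)] A(2) by simp
        show "m \<le> r" if "zero_dim_subscheme_ideal r I" "I \<subseteq> annihilator F" for r I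
          using cactus_lower_bound_fermat[OF T n 3 True that] unfolding m_def .
        show "m \<le> r" if "zero_dim_subscheme_ideal r I" "I \<subseteq> annihilator (to_closure F)" for r I
          using cactus_lower_bound_fermat[OF T' n \<gamma>' True' that] unfolding m' .
      qed
    next
      case False
      \<comment> \<open>The three forms \<gamma> X_i + \<beta> p_1 now sum to 0 and span a space of
        dimension 2, where two cubes replace the three.\<close>
      then have n3: "CARD('n) = 3" using n by simp
      have \<gamma>: "\<gamma> = - (3 * \<beta>)" using False n3 by (simp add: add_eq_0_iff)
      then have \<beta>: "\<beta> \<noteq> 0" using 3 by auto
      have T3: "symmetric_tensor \<alpha> \<beta> (- (3 * \<beta>)) F" using T unfolding \<gamma> .
      have T3': "symmetric_tensor (to_ac \<alpha>) (to_ac \<beta>) (- (3 * to_ac \<beta>)) (to_closure F)"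
        using T' unfolding \<gamma> by simp
      define m :: nat where "m = (if 3 * \<alpha> + 2 * \<beta> = 0 then 2 else 3)"
      have "3 * to_ac \<alpha> + 2 * to_ac \<beta> = to_ac (3 * \<alpha> + 2 * \<beta>)" by simp
      then have m': "m = (if 3 * to_ac \<alpha> + 2 * to_ac \<beta> = 0 then 2 else 3)"
        by (simp only: m_def to_ac_eq_0_iff)
      obtain p q r :: 'n where pqr: "UNIV = {p, q, r}" "p \<noteq> q" "p \<noteq> r" "q \<noteq> r"
        using n3 by (auto simp: card_3_iff)
      obtain A :: "nat set" and c p where A: "decomposes (to_closure F) A c p" "finite A" "card A = m"
        using ternary_decomposition[OF T3' n3] unfolding m' .
      show ?thesis
      proof (rule cactus_waring_eqI[OF F' _ _ _ A])
        show "has_apolar_scheme m F"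
          using has_apolar_scheme_ternary_2[OF pqr T3] has_apolar_scheme_ternary_3[OF pqr T3]
          by (simp add: m_def)
        show "m \<le> r" if "zero_dim_subscheme_ideal r I" "I \<subseteq> annihilator F" for r I
          using cactus_lower_bound_ternary[OF T3 n3 \<beta> that] unfolding m_def .
        show "m \<le> r" if "zero_dim_subscheme_ideal r I" "I \<subseteq> annihilator (to_closure F)" for r I
          using cactus_lower_bound_ternary[OF T3' n3 _ that] \<beta> unfolding m' by simp
      qed
    qed
    moreover have "\<not> (\<exists>a0 a1. a1 \<noteq> 0 \<and> F = cubic_p1p2 a0 a1)" using ex 3 by blast
    ultimately show ?thesis by blast
  qed
qed

end
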